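(* Let $\Omega\subset\mathbb{R}^N$ be a bounded regular domain, $\lambda_0:\Omega\to(0,\infty)$ a function bounded away from zero and from infinity, and $g:\partial\Omega\to\mathbb{R}$ a fixed Lipschitz function. Let $(u_p)_{p\ge2}$ be the family of weak solutions to $$-\Delta_p u_p+\lambda_0(x)\chi_{\{u_p>0\}}(x)=0\ \text{ in }\Omega,\qquad u_p=g\ \text{ on }\partial\Omega.$$ Then, up to a subsequence (i.e. along some sequence $p_j\to\infty$), $u_p\to u_\infty$ uniformly in $\overline\Omega$. Furthermore, such a limit $u_\infty$ is a viscosity solution of $$\max\left\{-\Delta_\infty u_\infty,\ -|\nabla u_\infty|+\chi_{\{u_\infty>0\}}\right\}=0\ \text{ in }\Omega,\qquad u_\infty=g\ \text{ on }\partial\Omega.$$ Finally, $u_\infty$ is Lipschitz continuous with $$[u_\infty]_{\mathrm{Lip}(\overline\Omega)}\le \mathfrak{C}(N)\max\left\{1,[g]_{\mathrm{Lip}(\partial\Omega)}\right\},$$ where $\mathfrak{C}(N)$ is a constant depending only on $N$.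
   Context: $\Delta_p u=\operatorname{div}(|\nabla u|^{p-2}\nabla u)$ and $\Delta_\infty u=\nabla u^T D^2u\,\nabla u$. "Regular domain" means a domain with smooth boundary. A weak solution $u_p\in W^{1,p}(\Omega)$ satisfies $\int_\Omega|\nabla u_p|^{p-2}\nabla u_p\cdot\nabla\varphi\,dx=-\int_\Omega\lambda_0\chi_{\{u_p>0\}}\varphi\,dx$ for all $\varphi\in C^1_0(\Omega)$ and takes the boundary value $g$; for each $p$ it is unique. $[f]_{\mathrm{Lip}(K)}=\sup_{x\ne y\in K}|f(x)-f(y)|/|x-y|$. Viscosity solutions of $\max\{-\Delta_\infty u,\chi_{\{u>0\}}-|\nabla u|\}=0$ in $\Omega$: an upper semicontinuous function $u:\Omega\to\mathbb{R}$ is a viscosity subsolution if, whenever $x_0\in\Omega$ and $\varphi\in C^2(\Omega)$ are such that $u-\varphi$ has a strict local maximum at $x_0$, then $\max\{-\Delta_\infty\varphi(x_0),\chi_{\{u>0\}}(x_0)-|\nabla\varphi(x_0)|\}\le0$. A lower semicontinuous $u$ is a viscosity supersolution if, whenever $u-\varphi$ has a strict local minimum at $x_0$, then $\max\{-\Delta_\infty\varphi(x_0),\chi_{\{u\ge0\}}(x_0)-|\nabla\varphi(x_0)|\}\ge0$. A viscosity solution is a continuous function that is both; the boundary condition means $u\in C(\overline\Omega)$ with $u=g$ on $\partial\Omega$. *)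

theory Defs
  imports "HOL-Analysis.Analysis"
begin

section \<open>Differential operators\<close>

text \<open>\<open>Ck_on k S f\<close> is meant for open \<open>S\<close>: all directional derivatives of \<open>f\<close> up to order \<open>k\<close>
  exist and are continuous on \<open>S\<close>.\<close>

primrec Ck_on ::
  "nat \<Rightarrow> 'a::real_normed_vector set \<Rightarrow> ('a \<Rightarrow> 'b::real_normed_vector) \<Rightarrow> bool" where
  "Ck_on 0 S f \<longleftrightarrow> continuous_on S f"
| "Ck_on (Suc k) S f \<longleftrightarrow>
     f differentiable_on S \<and> (\<forall>v. Ck_on k S (\<lambda>x. frechet_derivative f (at x) v))"

definition smooth_on :: "'a::real_normed_vector set \<Rightarrow> ('a \<Rightarrow> 'b::real_normed_vector) \<Rightarrow> bool" where
  "smooth_on S f \<longleftrightarrow> (\<forall>k. Ck_on k S f)"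

definition grad :: "('a::euclidean_space \<Rightarrow> real) \<Rightarrow> 'a \<Rightarrow> 'a" where
  "grad f x = (\<Sum>b\<in>Basis. frechet_derivative f (at x) b *\<^sub>R b)"

text \<open>\<open>hess f x v w\<close> is \<open>v\<^sup>T D\<^sup>2f(x) w\<close>.\<close>

definition hess :: "('a::euclidean_space \<Rightarrow> real) \<Rightarrow> 'a \<Rightarrow> 'a \<Rightarrow> 'a \<Rightarrow> real" where
  "hess f x v w = frechet_derivative (\<lambda>y. frechet_derivative f (at y) v) (at x) w"

definition inf_laplacian :: "('a::euclidean_space \<Rightarrow> real) \<Rightarrow> 'a \<Rightarrow> real" where
  "inf_laplacian f x = hess f x (grad f x) (grad f x)"


section \<open>Bounded regular domains\<close>

text \<open>Near each boundary point the set lies strictly on one side of the graph of a smooth function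
  over a hyperplane: \<open>e\<close> is the vertical direction, and \<open>\<gamma>\<close> is only evaluated at points
  of the hyperplane orthogonal to \<open>e\<close>.\<close>

definition smooth_boundary :: "'a::euclidean_space set \<Rightarrow> bool" where
  "smooth_boundary \<Omega> \<longleftrightarrow>
     (\<forall>x0\<in>frontier \<Omega>. \<exists>r>0. \<exists>e \<gamma>. norm e = 1 \<and> smooth_on UNIV (\<gamma> :: 'a \<Rightarrow> real) \<and>
        \<Omega> \<inter> ball x0 r = {x \<in> ball x0 r. \<gamma> (x - (x \<bullet> e) *\<^sub>R e) < x \<bullet> e})"

definition bounded_regular_domain :: "'a::euclidean_space set \<Rightarrow> bool" where
  "bounded_regular_domain \<Omega> \<longleftrightarrow>
     open \<Omega> \<and> connected \<Omega> \<and> \<Omega> \<noteq> {} \<and> bounded \<Omega> \<and> smooth_boundary \<Omega>"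


section \<open>Sobolev spaces and weak solutions\<close>

text \<open>\<open>C\<^sup>1\<close> functions with compact support in \<open>\<Omega>\<close>, extended by zero to the whole space.\<close>

definition C1_0 :: "'a::euclidean_space set \<Rightarrow> ('a \<Rightarrow> real) \<Rightarrow> bool" where
  "C1_0 \<Omega> \<phi> \<longleftrightarrow> Ck_on 1 UNIV \<phi> \<and>
     compact (closure {x. \<phi> x \<noteq> 0}) \<and> closure {x. \<phi> x \<noteq> 0} \<subseteq> \<Omega>"

definition in_Lp :: "real \<Rightarrow> 'a::euclidean_space set \<Rightarrow> ('a \<Rightarrow> 'b::euclidean_space) \<Rightarrow> bool" where
  "in_Lp p \<Omega> f \<longleftrightarrow> f \<in> borel_measurable (lebesgue_on \<Omega>) \<and>
     integrable (lebesgue_on \<Omega>) (\<lambda>x. norm (f x) powr p)"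

definition locally_integrable ::
  "'a::euclidean_space set \<Rightarrow> ('a \<Rightarrow> 'b::euclidean_space) \<Rightarrow> bool" where
  "locally_integrable \<Omega> f \<longleftrightarrow> (\<forall>K. compact K \<and> K \<subseteq> \<Omega> \<longrightarrow> integrable (lebesgue_on K) f)"

text \<open>As in Gilbarg and Trudinger, Chapter 7, weak first derivatives are tested with \<open>C\<^sup>1\<close>
  functions of compact support, and \<open>W\<^sub>0\<^sup>1\<^sup>,\<^sup>p\<close> is the closure of these functions in \<open>W\<^sup>1\<^sup>,\<^sup>p\<close>.\<close>

definition has_weak_gradient ::
  "'a::euclidean_space set \<Rightarrow> ('a \<Rightarrow> real) \<Rightarrow> ('a \<Rightarrow> 'a) \<Rightarrow> bool" where
  "has_weak_gradient \<Omega> u Du \<longleftrightarrow> locally_integrable \<Omega> u \<and> locally_integrable \<Omega> Du \<and>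
     (\<forall>\<phi>. C1_0 \<Omega> \<phi> \<longrightarrow>
        (\<integral>x. u x *\<^sub>R grad \<phi> x \<partial>lebesgue_on \<Omega>) = - (\<integral>x. \<phi> x *\<^sub>R Du x \<partial>lebesgue_on \<Omega>))"

text \<open>\<open>u \<in> W\<^sup>1\<^sup>,\<^sup>p(\<Omega>)\<close> with weak gradient \<open>Du\<close>.\<close>

definition in_W1p ::
  "real \<Rightarrow> 'a::euclidean_space set \<Rightarrow> ('a \<Rightarrow> real) \<Rightarrow> ('a \<Rightarrow> 'a) \<Rightarrow> bool" where
  "in_W1p p \<Omega> u Du \<longleftrightarrow> in_Lp p \<Omega> u \<and> in_Lp p \<Omega> Du \<and> has_weak_gradient \<Omega> u Du"

definition in_W1p0 :: "real \<Rightarrow> 'a::euclidean_space set \<Rightarrow> ('a \<Rightarrow> real) \<Rightarrow> bool" where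
  "in_W1p0 p \<Omega> w \<longleftrightarrow> (\<exists>Dw \<phi>. in_W1p p \<Omega> w Dw \<and> (\<forall>n::nat. C1_0 \<Omega> (\<phi> n)) \<and>
     (\<lambda>n. \<integral>x. \<bar>\<phi> n x - w x\<bar> powr p \<partial>lebesgue_on \<Omega>) \<longlonglongrightarrow> 0 \<and>
     (\<lambda>n. \<integral>x. norm (grad (\<phi> n) x - Dw x) powr p \<partial>lebesgue_on \<Omega>) \<longlonglongrightarrow> 0)"

text \<open>Boundary values of Sobolev functions, for Lipschitz \<open>g\<close>: \<open>u - G \<in> W\<^sub>0\<^sup>1\<^sup>,\<^sup>p(\<Omega>)\<close> for some
  Lipschitz extension \<open>G\<close> of \<open>g\<close> to the closure (the choice of \<open>G\<close> is immaterial).\<close>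

definition has_boundary_value ::
  "real \<Rightarrow> 'a::euclidean_space set \<Rightarrow> ('a \<Rightarrow> real) \<Rightarrow> ('a \<Rightarrow> real) \<Rightarrow> bool" where
  "has_boundary_value p \<Omega> u g \<longleftrightarrow>
     (\<exists>G L. L-lipschitz_on (closure \<Omega>) G \<and> (\<forall>x\<in>frontier \<Omega>. G x = g x) \<and>
        in_W1p0 p \<Omega> (\<lambda>x. u x - G x))"

definition weak_solution ::
  "real \<Rightarrow> 'a::euclidean_space set \<Rightarrow> ('a \<Rightarrow> real) \<Rightarrow> ('a \<Rightarrow> real) \<Rightarrow> ('a \<Rightarrow> real) \<Rightarrow> bool" where
  "weak_solution p \<Omega> lam g u \<longleftrightarrow>
     (\<exists>Du. in_W1p p \<Omega> u Du \<and>
        (\<forall>\<phi>. C1_0 \<Omega> \<phi> \<longrightarrow>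
           (\<integral>x. (norm (Du x) powr (p - 2) *\<^sub>R Du x) \<bullet> grad \<phi> x \<partial>lebesgue_on \<Omega>)
           = - (\<integral>x. lam x * indicator {y. u y > 0} x * \<phi> x \<partial>lebesgue_on \<Omega>))) \<and>
     has_boundary_value p \<Omega> u g"


section \<open>Viscosity solutions of the limit problem\<close>

definition usc_on :: "'a::topological_space set \<Rightarrow> ('a \<Rightarrow> real) \<Rightarrow> bool" where
  "usc_on S u \<longleftrightarrow> (\<forall>x\<in>S. \<forall>a>u x. \<forall>\<^sub>F y in at x within S. u y < a)"

definition lsc_on :: "'a::topological_space set \<Rightarrow> ('a \<Rightarrow> real) \<Rightarrow> bool" where
  "lsc_on S u \<longleftrightarrow> (\<forall>x\<in>S. \<forall>a<u x. \<forall>\<^sub>F y in at x within S. u y > a)"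

definition strict_local_max_at :: "'a::metric_space set \<Rightarrow> ('a \<Rightarrow> real) \<Rightarrow> 'a \<Rightarrow> bool" where
  "strict_local_max_at S f x0 \<longleftrightarrow> (\<exists>r>0. \<forall>x\<in>S \<inter> ball x0 r. x \<noteq> x0 \<longrightarrow> f x < f x0)"

definition strict_local_min_at :: "'a::metric_space set \<Rightarrow> ('a \<Rightarrow> real) \<Rightarrow> 'a \<Rightarrow> bool" where
  "strict_local_min_at S f x0 \<longleftrightarrow> (\<exists>r>0. \<forall>x\<in>S \<inter> ball x0 r. x \<noteq> x0 \<longrightarrow> f x > f x0)"

text \<open>The characteristic functions in the two definitions below differ on \<open>{u = 0}\<close> on purpose.\<close>

definition viscosity_subsolution :: "'a::euclidean_space set \<Rightarrow> ('a \<Rightarrow> real) \<Rightarrow> bool" where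
  "viscosity_subsolution \<Omega> u \<longleftrightarrow> usc_on \<Omega> u \<and>
     (\<forall>x0\<in>\<Omega>. \<forall>\<phi>. Ck_on 2 \<Omega> \<phi> \<and> strict_local_max_at \<Omega> (\<lambda>x. u x - \<phi> x) x0 \<longrightarrow>
        max (- inf_laplacian \<phi> x0) (indicator {x. u x > 0} x0 - norm (grad \<phi> x0)) \<le> 0)"

definition viscosity_supersolution :: "'a::euclidean_space set \<Rightarrow> ('a \<Rightarrow> real) \<Rightarrow> bool" where
  "viscosity_supersolution \<Omega> u \<longleftrightarrow> lsc_on \<Omega> u \<and>
     (\<forall>x0\<in>\<Omega>. \<forall>\<phi>. Ck_on 2 \<Omega> \<phi> \<and> strict_local_min_at \<Omega> (\<lambda>x. u x - \<phi> x) x0 \<longrightarrow>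
        max (- inf_laplacian \<phi> x0) (indicator {x. u x \<ge> 0} x0 - norm (grad \<phi> x0)) \<ge> 0)"

definition viscosity_solution :: "'a::euclidean_space set \<Rightarrow> ('a \<Rightarrow> real) \<Rightarrow> bool" where
  "viscosity_solution \<Omega> u \<longleftrightarrow>
     continuous_on \<Omega> u \<and> viscosity_subsolution \<Omega> u \<and> viscosity_supersolution \<Omega> u"


section \<open>Uniform subsequential limits and the Lipschitz seminorm\<close>

text \<open>Elements of \<open>W\<^sup>1\<^sup>,\<^sup>p(\<Omega>)\<close> are determined up to null sets, so uniform convergence on the closure
  refers to their representatives that are continuous up to the boundary (unique on the closure).\<close>

definition continuous_representative ::
  "'a::euclidean_space set \<Rightarrow> ('a \<Rightarrow> real) \<Rightarrow> ('a \<Rightarrow> real) \<Rightarrow> bool" where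
  "continuous_representative \<Omega> f v \<longleftrightarrow>
     continuous_on (closure \<Omega>) v \<and> (AE x in lebesgue_on \<Omega>. v x = f x)"

definition uniform_subsequential_limit ::
  "'a::euclidean_space set \<Rightarrow> (real \<Rightarrow> 'a \<Rightarrow> real) \<Rightarrow> ('a \<Rightarrow> real) \<Rightarrow> bool" where
  "uniform_subsequential_limit \<Omega> u w \<longleftrightarrow>
     (\<exists>(p :: nat \<Rightarrow> real) v. (\<forall>j. p j \<ge> 2) \<and> filterlim p at_top sequentially \<and>
        (\<forall>j. continuous_representative \<Omega> (u (p j)) (v j)) \<and>
        uniform_limit (closure \<Omega>) v w sequentially)"

text \<open>A real supremum: meaningful only for functions that are Lipschitz on \<open>K\<close>, and for \<open>K\<close> with at
  least two points.\<close>

definition lip_seminorm :: "'a::metric_space set \<Rightarrow> ('a \<Rightarrow> real) \<Rightarrow> real" where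
  "lip_seminorm K f = (SUP (x, y)\<in>{(x, y). x \<in> K \<and> y \<in> K \<and> x \<noteq> y}. \<bar>f x - f y\<bar> / dist x y)"

end

theory Submission
  imports Defs "HOL-Real_Asymp.Real_Asymp" "HOL-Complex_Analysis.Great_Picard"
begin

text \<open>Let \<open>F\<close> be a smooth function with \<open>|\<nabla>F| \<le> L = max 1 [g]\<close> that is uniformly close on the boundary to \<open>g\<close>
  (a mollified McShane extension). Testing the equation with a truncation of \<open>u\<^sub>p - F\<close> near zero, which has compact
  support, bounds the \<open>L\<^sup>p\<close> norm of its gradient by \<open>2 L \<kappa>\<^sub>p\<close> with \<open>\<kappa>\<^sub>p \<rightarrow> 1\<close>. Morrey's inequality on the whole space,
  whose constant depends only on \<open>N\<close> once \<open>p \<ge> 2 N\<close>, then gives a modulus of continuity for \<open>u\<^sub>p\<close> up to the boundary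
  that is uniform in \<open>p\<close> and tends to a Lipschitz bound; it holds across the whole closure because the truncation
  extends by zero. Compactness is the Arzela--Ascoli theorem.

  If a limit \<open>w\<close> violates a viscosity inequality at \<open>x\<^sub>0\<close> with test function \<open>\<phi>\<close>, then on a small ball
  \<open>\<Delta>\<^sub>p\<phi> = |\<nabla>\<phi>|\<^sup>p\<^sup>-\<^sup>4 (|\<nabla>\<phi>|\<^sup>2 \<Delta>\<phi> + (p - 2) \<Delta>\<^sub>\<infinity>\<phi>)\<close> lies strictly on one side of the source term for large
  \<open>p\<close>, and testing the equation with the part of \<open>u\<^sub>p - \<phi>\<close> above (or below) a suitable level contradicts the monotonicity
  of \<open>v \<mapsto> |v|\<^sup>p\<^sup>-\<^sup>2 v\<close>.\<close>

section \<open>Calculus preliminaries\<close>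

text \<open>The boundary datum enters through a Lipschitz extension whose mollifications have
  bounded gradients that are only shown to converge weakly. So no Sobolev chain rule is invoked:
  truncations act on C^1 approximants of the solution, and limits are taken in integrals linear in
  the gradient. Morrey's inequality is arranged to survive this: gradients enter it through such
  linear integrals, and its right-hand side contains the norm of the limit alone. The constant
  \<open>1 + 16 N\<close>: the datum contributes L, Morrey's constant is 8 N and the energy factor 2
  L, where 2 is the p-th root of the crude bound (a + b)^p \<le> 2^p (a^p + b^p). The max with 1
  ensures L \<le> L^p. The two bounds on \<open>lam\<close> act separately: where |\<nabla>\<phi>| <
  1, the p-Laplacian of \<phi> falls below the lower bound for large p; where |\<nabla>\<phi>| > 1
  and the infinity Laplacian is positive, it exceeds the upper one. At points with w = 0 the sign of
  the approximating solutions is undetermined, hence the different characteristic functions.\<close>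

lemma Hoelder_inequality:
  fixes f g :: "'a \<Rightarrow> real"
  assumes p: "p > 1" and q: "q > 1" and pq: "1/p + 1/q = 1"
    and f: "f \<in> borel_measurable M" and g: "g \<in> borel_measurable M"
    and fp: "integrable M (\<lambda>x. \<bar>f x\<bar> powr p)" and gq: "integrable M (\<lambda>x. \<bar>g x\<bar> powr q)"
  shows "integrable M (\<lambda>x. f x * g x)"
    and "(\<integral>x. \<bar>f x * g x\<bar> \<partial>M) \<le>
      (\<integral>x. \<bar>f x\<bar> powr p \<partial>M) powr (1/p) * (\<integral>x. \<bar>g x\<bar> powr q \<partial>M) powr (1/q)"
proof -
  have Y: "\<bar>a * b\<bar> \<le> \<bar>a\<bar> powr p / p + \<bar>b\<bar> powr q / q" for a b :: real
    using Youngs_inequality[OF p q pq, of "\<bar>a\<bar>" "\<bar>b\<bar>"] by (simp add: abs_mult)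
  have I: "integrable M (\<lambda>x. \<bar>f x\<bar> powr p / p + \<bar>g x\<bar> powr q / q)"
    using fp gq by auto
  show int: "integrable M (\<lambda>x. f x * g x)"
    by (rule Bochner_Integration.integrable_bound[OF I]) (use f g in \<open>auto intro!: AE_I2 order_trans[OF Y]\<close>)
  define A where "A = (\<integral>x. \<bar>f x\<bar> powr p \<partial>M)"
  define B where "B = (\<integral>x. \<bar>g x\<bar> powr q \<partial>M)"
  have A0: "A \<ge> 0" and B0: "B \<ge> 0" unfolding A_def B_def by auto
  \<comment> \<open>The normalisation below divides by both norms, so a vanishing one is settled
    first: the product is then zero almost everywhere.\<close>
  have zero: "(\<integral>x. \<bar>f x * g x\<bar> \<partial>M) = 0" if "A = 0 \<or> B = 0"
  proof -
    have "AE x in M. f x * g x = 0"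
    proof (cases "A = 0")
      case True
      then have "AE x in M. \<bar>f x\<bar> powr p = 0"
        unfolding A_def by (subst (asm) integral_nonneg_eq_0_iff_AE[OF fp]) auto
      then show ?thesis by eventually_elim auto
    next
      case False
      with that have "AE x in M. \<bar>g x\<bar> powr q = 0"
        unfolding B_def by (subst (asm) integral_nonneg_eq_0_iff_AE[OF gq]) auto
      then show ?thesis by eventually_elim auto
    qed
    then have "(\<integral>x. \<bar>f x * g x\<bar> \<partial>M) = (\<integral>x. 0 \<partial>M)"
      by (intro integral_cong_AE) (use f g in auto)
    then show ?thesis by simp
  qed
  have "(\<integral>x. \<bar>f x * g x\<bar> \<partial>M) \<le> A powr (1/p) * B powr (1/q)"
  proof (cases "A = 0 \<or> B = 0")
    case True
    then show ?thesis using zero by auto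
  next
    case False
    with A0 B0 have A: "A > 0" and B: "B > 0" by auto
    define a where "a = A powr (1/p)"
    define b where "b = B powr (1/q)"
    have ab: "a > 0" "b > 0" using A B by (auto simp: a_def b_def)
    have ap: "a powr p = A" and bq: "b powr q = B"
      using A B p q by (auto simp: a_def b_def powr_powr)
    have "(\<integral>x. \<bar>f x * g x\<bar> / (a * b) \<partial>M) \<le> (\<integral>x. \<bar>f x\<bar> powr p / A / p + \<bar>g x\<bar> powr q / B / q \<partial>M)"
    proof (rule integral_mono)
      show "integrable M (\<lambda>x. \<bar>f x * g x\<bar> / (a * b))" using int by auto
      show "integrable M (\<lambda>x. \<bar>f x\<bar> powr p / A / p + \<bar>g x\<bar> powr q / B / q)" using fp gq by auto
      fix x
      have "\<bar>f x * g x\<bar> / (a * b) = \<bar>(f x / a) * (g x / b)\<bar>" using ab by (simp add: abs_mult)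
      also have "\<dots> \<le> \<bar>f x / a\<bar> powr p / p + \<bar>g x / b\<bar> powr q / q" by (rule Y)
      also have "\<dots> = \<bar>f x\<bar> powr p / A / p + \<bar>g x\<bar> powr q / B / q"
        using ab by (simp add: powr_divide ap bq)
      finally show "\<bar>f x * g x\<bar> / (a * b) \<le> \<bar>f x\<bar> powr p / A / p + \<bar>g x\<bar> powr q / B / q" .
    qed
    also have "\<dots> = 1/p + 1/q"
      using fp gq A B by (simp flip: A_def B_def)
    finally have "(\<integral>x. \<bar>f x * g x\<bar> \<partial>M) / (a * b) \<le> 1" using pq by simp
    then show ?thesis using ab by (simp add: a_def b_def field_simps)
  qed
  then show "(\<integral>x. \<bar>f x * g x\<bar> \<partial>M) \<le>
      (\<integral>x. \<bar>f x\<bar> powr p \<partial>M) powr (1/p) * (\<integral>x. \<bar>g x\<bar> powr q \<partial>M) powr (1/q)"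
    by (simp add: A_def B_def)
qed

text \<open>The factor 2^p is crude, but what matters is its p-th root 2, which is bounded in p and
  survives into the final Lipschitz constant.\<close>

lemma powr_add_le:
  fixes a b p :: real
  assumes "a \<ge> 0" "b \<ge> 0" "p \<ge> 0"
  shows "(a + b) powr p \<le> 2 powr p * (a powr p + b powr p)"
proof -
  have "(a + b) powr p \<le> (2 * max a b) powr p"
    by (rule powr_mono2) (use assms in auto)
  also have "\<dots> = 2 powr p * (max a b) powr p"
    using assms by (simp add: powr_mult)
  also have "\<dots> \<le> 2 powr p * (a powr p + b powr p)"
    by (intro mult_left_mono) (auto simp: max_def)
  finally show ?thesis .
qed

lemma integrable_lebesgue_on_bounded:
  fixes f :: "'a::euclidean_space \<Rightarrow> 'b::euclidean_space"
  assumes "f \<in> borel_measurable (lebesgue_on S)" "S \<in> lmeasurable" "\<And>x. x \<in> S \<Longrightarrow> norm (f x) \<le> B"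
  shows "integrable (lebesgue_on S) f"
proof -
  interpret finite_measure "lebesgue_on S" by (rule finite_measure_lebesgue_on) fact
  show ?thesis by (rule integrable_const_bound[where B=B]) (use assms in \<open>auto intro!: AE_I2\<close>)
qed

lemma integrable_mult_bounded:
  fixes f :: "'a \<Rightarrow> 'b::{banach,second_countable_topology}" and \<theta> :: "'a \<Rightarrow> real"
  assumes "integrable M f" "\<theta> \<in> borel_measurable M" "AE x in M. \<bar>\<theta> x\<bar> \<le> B"
  shows "integrable M (\<lambda>x. \<theta> x *\<^sub>R f x)"
proof (rule Bochner_Integration.integrable_bound)
  show "integrable M (\<lambda>x. B * norm (f x))" using assms by auto
  show "AE x in M. norm (\<theta> x *\<^sub>R f x) \<le> norm (B * norm (f x))"
    using assms(3)
  proof eventually_elim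
    case (elim x)
    then have "B \<ge> 0" by linarith
    then show ?case using elim by (auto simp: abs_mult intro!: mult_right_mono)
  qed
qed (use assms in auto)


section \<open>Gradients and compactly supported C^1 functions\<close>

lemma linear_functional_eq_inner:
  fixes f :: "'a::euclidean_space \<Rightarrow> real"
  assumes "linear f"
  shows "f v = (\<Sum>b\<in>Basis. f b *\<^sub>R b) \<bullet> v"
proof -
  have "f v = f (\<Sum>b\<in>Basis. (v \<bullet> b) *\<^sub>R b)" by (simp add: euclidean_representation)
  also have "\<dots> = (\<Sum>b\<in>Basis. (v \<bullet> b) * f b)"
    using assms by (simp add: linear_sum linear_cmul)
  also have "\<dots> = (\<Sum>b\<in>Basis. f b *\<^sub>R b) \<bullet> v"
    by (subst inner_sum_left) (simp add: inner_commute[of v] mult.commute)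
  finally show ?thesis .
qed

lemma has_derivative_grad:
  fixes f :: "'a::euclidean_space \<Rightarrow> real"
  assumes "f differentiable (at x)"
  shows "(f has_derivative (\<lambda>v. grad f x \<bullet> v)) (at x)"
proof -
  have d: "(f has_derivative frechet_derivative f (at x)) (at x)"
    using assms frechet_derivative_works by blast
  then have "frechet_derivative f (at x) = (\<lambda>v. grad f x \<bullet> v)"
    unfolding grad_def using linear_functional_eq_inner has_derivative_linear by blast
  with d show ?thesis by metis
qed

lemma frechet_derivative_eq_grad:
  fixes f :: "'a::euclidean_space \<Rightarrow> real"
  assumes "f differentiable (at x)"
  shows "frechet_derivative f (at x) v = grad f x \<bullet> v"
  using frechet_derivative_at[OF has_derivative_grad[OF assms]] by metis

lemma grad_eqI:
  fixes f :: "'a::euclidean_space \<Rightarrow> real"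
  assumes "(f has_derivative (\<lambda>v. g \<bullet> v)) (at x)"
  shows "grad f x = g"
  unfolding grad_def frechet_derivative_at[OF assms, symmetric]
  by (simp add: euclidean_representation)

lemma Ck_on_1_D:
  fixes f :: "'a::euclidean_space \<Rightarrow> real"
  assumes "Ck_on 1 S f" "open S"
  shows "x \<in> S \<Longrightarrow> (f has_derivative (\<lambda>v. grad f x \<bullet> v)) (at x)"
    and "continuous_on S (grad f)" and "continuous_on S f"
proof -
  have d: "f differentiable (at x)" if "x \<in> S" for x
    using assms that by (auto simp: differentiable_on_eq_differentiable_at)
  then show "x \<in> S \<Longrightarrow> (f has_derivative (\<lambda>v. grad f x \<bullet> v)) (at x)"
    using has_derivative_grad by blast
  show "continuous_on S (grad f)"
    unfolding grad_def using assms by (auto intro!: continuous_intros)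
  show "continuous_on S f"
    using d by (meson differentiable_imp_continuous_within continuous_at_imp_continuous_on)
qed

lemma Ck_on_1_I:
  fixes f :: "'a::euclidean_space \<Rightarrow> real"
  assumes "open S" "\<And>x. x \<in> S \<Longrightarrow> (f has_derivative (\<lambda>v. G x \<bullet> v)) (at x)" "continuous_on S G"
  shows "Ck_on 1 S f"
proof -
  have "f differentiable_on S"
    using assms(1,2) by (auto simp: differentiable_on_eq_differentiable_at differentiable_def)
  moreover have "continuous_on S (\<lambda>x. frechet_derivative f (at x) v)" for v
  proof -
    have "continuous_on S (\<lambda>x. G x \<bullet> v)" by (intro continuous_intros assms)
    then show ?thesis
      by (rule continuous_on_eq) (simp add: frechet_derivative_at[OF assms(2), symmetric])
  qed
  ultimately show ?thesis by simp
qed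

lemma Ck_on_mono: "Ck_on k S f \<Longrightarrow> T \<subseteq> S \<Longrightarrow> Ck_on k T f"
  by (induction k arbitrary: f) (auto intro: continuous_on_subset differentiable_on_subset)

lemma C1_0_D:
  fixes f :: "'a::euclidean_space \<Rightarrow> real"
  assumes "C1_0 \<Omega> f"
  shows "(f has_derivative (\<lambda>v. grad f x \<bullet> v)) (at x)"
    and "continuous_on UNIV (grad f)" and "continuous_on UNIV f"
    and "x \<notin> \<Omega> \<Longrightarrow> f x = 0" and "x \<notin> \<Omega> \<Longrightarrow> grad f x = 0"
    and "\<exists>B. \<forall>x. norm (grad f x) \<le> B" and "\<exists>B. \<forall>x. \<bar>f x\<bar> \<le> B"
    and "\<exists>K. compact K \<and> K \<subseteq> \<Omega> \<and> (\<forall>x. x \<notin> K \<longrightarrow> f x = 0 \<and> grad f x = 0)"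
proof -
  have 1: "Ck_on 1 UNIV f" using assms by (simp add: C1_0_def)
  show d: "(f has_derivative (\<lambda>v. grad f x \<bullet> v)) (at x)" for x
    using Ck_on_1_D[OF 1] by auto
  show cg: "continuous_on UNIV (grad f)" and cf: "continuous_on UNIV f"
    using Ck_on_1_D[OF 1] by auto
  define K where "K = closure {x. f x \<noteq> 0}"
  have K: "compact K" "K \<subseteq> \<Omega>" using assms by (auto simp: C1_0_def K_def)
  have z: "f x = 0" if "x \<notin> K" for x
    using that closure_subset[of "{x. f x \<noteq> 0}"] by (auto simp: K_def)
  have zg: "grad f x = 0" if "x \<notin> K" for x
  proof (rule grad_eqI)
    have "((\<lambda>_. 0) has_derivative (\<lambda>v. 0)) (at x)" by simp
    then have "(f has_derivative (\<lambda>v. 0)) (at x)"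
      by (rule has_derivative_transform_within_open[where s = "-K"])
        (use that z K in \<open>auto simp: open_Compl compact_imp_closed\<close>)
    then show "(f has_derivative (\<lambda>v. 0 \<bullet> v)) (at x)" by simp
  qed
  show "x \<notin> \<Omega> \<Longrightarrow> f x = 0" "x \<notin> \<Omega> \<Longrightarrow> grad f x = 0" using z[of x] zg[of x] K(2) by blast+
  show "\<exists>K. compact K \<and> K \<subseteq> \<Omega> \<and> (\<forall>x. x \<notin> K \<longrightarrow> f x = 0 \<and> grad f x = 0)"
    by (rule exI[of _ K]) (simp add: K z zg)
  have "bounded (grad f ` K)" "bounded (f ` K)"
    by (intro compact_imp_bounded compact_continuous_image K(1) continuous_on_subset[OF cg] continuous_on_subset[OF cf] subset_UNIV)+
  then have "\<exists>B. \<forall>x\<in>K. norm (grad f x) \<le> B" "\<exists>B. \<forall>x\<in>K. norm (f x) \<le> B"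
    by (simp_all add: bounded_iff)
  then obtain B B' where B: "\<And>x. x \<in> K \<Longrightarrow> norm (grad f x) \<le> B" "\<And>x. x \<in> K \<Longrightarrow> norm (f x) \<le> B'"
    by metis
  have "norm (grad f x) \<le> max B 0" for x using B(1)[of x] zg[of x] by (cases "x \<in> K") auto
  then show "\<exists>B. \<forall>x. norm (grad f x) \<le> B" by blast
  have "\<bar>f x\<bar> \<le> max B' 0" for x using B(2)[of x] z[of x] by (cases "x \<in> K") auto
  then show "\<exists>B. \<forall>x. \<bar>f x\<bar> \<le> B" by blast
qed

text \<open>\<open>V\<close> and the complement of \<open>K\<close> are open and cover the space;
  the extension is \<open>f\<close> on the first and zero on the second, hence C^1 throughout.
  Cutoffs, products and truncated differences become test functions this way, however
  \<open>f\<close> behaves near the boundary of \<open>V\<close>.\<close>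

lemma C1_0_glue:
  fixes f :: "'a::euclidean_space \<Rightarrow> real"
  assumes V: "open V" and K: "compact K" "K \<subseteq> V" and f: "Ck_on 1 V f"
    and z: "\<And>x. x \<in> V \<Longrightarrow> x \<notin> K \<Longrightarrow> f x = 0"
  defines "g \<equiv> \<lambda>x. if x \<in> V then f x else 0"
  shows "C1_0 V g" and "grad g x = (if x \<in> V then grad f x else 0)"
proof -
  define G where "G = (\<lambda>x. if x \<in> V then grad f x else 0)"
  have oK: "open (-K)" using K by (simp add: open_Compl compact_imp_closed)
  have d1: "(g has_derivative (\<lambda>v. G x \<bullet> v)) (at x)" if "x \<in> V" for x
  proof -
    have "(f has_derivative (\<lambda>v. G x \<bullet> v)) (at x)" using Ck_on_1_D(1)[OF f V that] that by (simp add: G_def)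
    then show ?thesis
      by (rule has_derivative_transform_within_open[OF _ V that]) (simp add: g_def)
  qed
  have d2: "(g has_derivative (\<lambda>v. 0 \<bullet> v)) (at x)" if "x \<notin> K" for x
  proof -
    have "((\<lambda>_. 0) has_derivative (\<lambda>v. 0 \<bullet> v)) (at x)" by simp
    then show ?thesis
      by (rule has_derivative_transform_within_open[where s = "-K"])
        (use that z oK in \<open>auto simp: g_def\<close>)
  qed
  have G0: "G x = 0" if "x \<notin> K" for x
    using grad_eqI[OF d2[OF that]] grad_eqI[OF d1, of x] by (cases "x \<in> V") (auto simp: G_def)
  have d: "(g has_derivative (\<lambda>v. G x \<bullet> v)) (at x)" for x
  proof (cases "x \<in> K")
    case True
    then show ?thesis using K by (intro d1) auto
  next
    case False
    then show ?thesis using d2[OF False] by (simp only: G0[OF False])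
  qed
  have "continuous_on (V \<union> -K) G"
  proof (rule continuous_on_open_Un)
    show "continuous_on V G"
      by (rule continuous_on_eq[OF Ck_on_1_D(2)[OF f V]]) (simp add: G_def)
    show "continuous_on (-K) G"
      by (rule continuous_on_eq[of _ "\<lambda>_. 0"]) (auto simp: G0)
  qed (use V oK in auto)
  moreover have "V \<union> -K = UNIV" using K by auto
  ultimately have cG: "continuous_on UNIV G" by simp
  have sub: "closure {x. g x \<noteq> 0} \<subseteq> K"
    by (rule closure_minimal) (use z K compact_imp_closed in \<open>auto simp: g_def split: if_splits\<close>)
  have "compact (closure {x. g x \<noteq> 0})"
    using sub K by (meson bounded_subset closed_closure compact_eq_bounded_closed)
  then show "C1_0 V g" unfolding C1_0_def using Ck_on_1_I[OF _ d cG] sub K by auto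
  show "grad g x = (if x \<in> V then grad f x else 0)"
    using grad_eqI[OF d, of x] by (simp add: G_def)
qed

lemma C1_0_mono: "C1_0 S f \<Longrightarrow> S \<subseteq> T \<Longrightarrow> C1_0 T f"
  unfolding C1_0_def by blast

lemma C1_0_diff:
  fixes f g :: "'a::euclidean_space \<Rightarrow> real"
  assumes "C1_0 \<Omega> f" "C1_0 \<Omega> g" "open \<Omega>"
  shows "C1_0 \<Omega> (\<lambda>x. f x - g x)" and "grad (\<lambda>x. f x - g x) x = grad f x - grad g x"
proof -
  obtain K1 where K1: "compact K1" "K1 \<subseteq> \<Omega>" "\<And>x. x \<notin> K1 \<Longrightarrow> f x = 0" using C1_0_D(8)[OF assms(1)] by blast
  obtain K2 where K2: "compact K2" "K2 \<subseteq> \<Omega>" "\<And>x. x \<notin> K2 \<Longrightarrow> g x = 0" using C1_0_D(8)[OF assms(2)] by blast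
  have d: "((\<lambda>x. f x - g x) has_derivative (\<lambda>v. (grad f x - grad g x) \<bullet> v)) (at x)" for x
    using has_derivative_diff[OF C1_0_D(1)[OF assms(1)] C1_0_D(1)[OF assms(2)]]
    by (simp add: inner_diff_left)
  show "grad (\<lambda>x. f x - g x) x = grad f x - grad g x" by (rule grad_eqI[OF d])
  have "Ck_on 1 UNIV (\<lambda>x. f x - g x)"
    by (rule Ck_on_1_I[OF _ d]) (auto intro!: continuous_intros C1_0_D(2)[OF assms(1)] C1_0_D(2)[OF assms(2)])
  then have 1: "Ck_on 1 \<Omega> (\<lambda>x. f x - g x)" by (rule Ck_on_mono) auto
  have "(\<lambda>x. if x \<in> \<Omega> then f x - g x else 0) = (\<lambda>x. f x - g x)"
    using C1_0_D(4)[OF assms(1)] C1_0_D(4)[OF assms(2)] by auto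
  then show "C1_0 \<Omega> (\<lambda>x. f x - g x)"
    using C1_0_glue(1)[OF assms(3) compact_Un[OF K1(1) K2(1)] _ 1] K1 K2 by auto
qed


section \<open>C^1 substitutes for the positive part\<close>

definition sqpos :: "real \<Rightarrow> real" where "sqpos s = (max 0 s)\<^sup>2"

lemma sqpos_DERIV: "(sqpos has_real_derivative 2 * max 0 s) (at s)"
proof -
  consider "s > 0" | "s < 0" | "s = 0" by linarith
  then show ?thesis
  proof cases
    case 1
    have "((\<lambda>s::real. s\<^sup>2) has_real_derivative 2 * max 0 s) (at s)"
      using 1 by (auto intro!: derivative_eq_intros)
    then show ?thesis
      by (rule has_field_derivative_transform_within_open[where S="{0<..}"]) (use 1 in \<open>auto simp: sqpos_def\<close>)
  next
    case 2
    have "((\<lambda>s::real. 0) has_real_derivative 2 * max 0 s) (at s)"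
      using 2 by (auto intro!: derivative_eq_intros)
    then show ?thesis
      by (rule has_field_derivative_transform_within_open[where S="{..<0}"]) (use 2 in \<open>auto simp: sqpos_def\<close>)
  next
    case 3
    have "((\<lambda>h. (sqpos (0+h) - sqpos 0) / h) \<longlongrightarrow> 0) (at 0)"
    proof (rule Lim_null_comparison)
      show "\<forall>\<^sub>F h in at 0. norm ((sqpos (0+h) - sqpos 0) / h) \<le> \<bar>h\<bar>"
        by (auto simp: eventually_at_filter sqpos_def max_def power2_eq_square intro!: always_eventually)
      show "((\<lambda>h::real. \<bar>h\<bar>) \<longlongrightarrow> 0) (at 0)" by (auto intro!: tendsto_eq_intros)
    qed
    then show ?thesis using 3 by (simp add: DERIV_def)
  qed
qed

text \<open>For d > 0 this replaces the positive part of \<open>t\<close> by a C^1 function: it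
  vanishes exactly when t \<le> 0, its slope lies between 0 and 1, and it differs from the positive
  part by at most \<open>d\<close>. For t > 0 its graph is a branch of a hyperbola.\<close>

definition tau :: "real \<Rightarrow> real \<Rightarrow> real" where "tau d t = sqrt (sqpos t + d\<^sup>2) - d"

definition tau' :: "real \<Rightarrow> real \<Rightarrow> real" where "tau' d t = max 0 t / sqrt (sqpos t + d\<^sup>2)"

lemma tau_DERIV: "d > 0 \<Longrightarrow> (tau d has_real_derivative tau' d t) (at t)"
proof -
  assume d: "d > 0"
  have pos: "sqpos t + d\<^sup>2 > 0" using d by (simp add: sqpos_def add_nonneg_pos)
  show ?thesis unfolding tau_def tau'_def
    using DERIV_diff[OF DERIV_chain[OF DERIV_real_sqrt[OF pos] DERIV_add[OF sqpos_DERIV DERIV_const]] DERIV_const[of d]]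
    by (simp add: o_def field_simps)
qed

lemma tau'_bounds: "d > 0 \<Longrightarrow> 0 \<le> tau' d t" "d > 0 \<Longrightarrow> tau' d t \<le> 1"
proof -
  assume d: "d > 0"
  show "0 \<le> tau' d t" by (simp add: tau'_def sqpos_def)
  have "max 0 t = sqrt ((max 0 t)\<^sup>2)" by simp
  also have "\<dots> \<le> sqrt (sqpos t + d\<^sup>2)" by (rule real_sqrt_le_mono) (simp add: sqpos_def)
  finally show "tau' d t \<le> 1" using d
    by (simp add: tau'_def divide_le_eq_1 sqpos_def add_nonneg_pos)
qed

lemma continuous_tau': "d > 0 \<Longrightarrow> continuous_on A (tau' d)"
proof -
  assume d: "d > 0"
  have "sqrt ((max 0 t)\<^sup>2 + d\<^sup>2) \<noteq> 0" for t
    using d by (smt (verit, best) real_sqrt_eq_0_iff zero_le_power2 zero_less_power)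
  then show ?thesis unfolding tau'_def sqpos_def
    by (intro continuous_intros) auto
qed

lemma tau_nonpos: "d > 0 \<Longrightarrow> t \<le> 0 \<Longrightarrow> tau d t = 0" "d > 0 \<Longrightarrow> t \<le> 0 \<Longrightarrow> tau' d t = 0"
  by (auto simp: tau_def tau'_def sqpos_def)

lemma tau_pos: "d > 0 \<Longrightarrow> t > 0 \<Longrightarrow> tau d t > 0"
  by (auto simp: tau_def sqpos_def real_less_rsqrt)

lemma tau_bounds: "d > 0 \<Longrightarrow> t \<ge> 0 \<Longrightarrow> tau d t \<le> t" "d > 0 \<Longrightarrow> t - d \<le> tau d t"
proof -
  assume d: "d > 0"
  show "tau d t \<le> t" if "t \<ge> 0"
  proof -
    have "sqrt (t\<^sup>2 + d\<^sup>2) \<le> t + d"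
      by (rule real_le_lsqrt) (use d that in \<open>auto simp: power2_sum\<close>)
    then show ?thesis using that by (simp add: tau_def sqpos_def max_def)
  qed
  show "t - d \<le> tau d t"
    using real_sqrt_le_mono[of "(max 0 t)\<^sup>2" "(max 0 t)\<^sup>2 + d\<^sup>2"]
    unfolding tau_def sqpos_def by (smt (verit, best) d real_sqrt_abs zero_le_power2 power2_abs real_sqrt_le_iff)
qed


section \<open>Integration by parts\<close>

lemma DERIV_along_line:
  fixes f :: "'a::euclidean_space \<Rightarrow> real"
  assumes "(f has_derivative (\<lambda>v. g \<bullet> v)) (at (x + s *\<^sub>R e))"
  shows "((\<lambda>t. f (x + t *\<^sub>R e)) has_real_derivative g \<bullet> e) (at s)"
proof -
  have "((\<lambda>t. x + t *\<^sub>R e) has_derivative (\<lambda>t. t *\<^sub>R e)) (at s)"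
    by (auto intro!: derivative_eq_intros)
  from has_derivative_compose[OF this assms] show ?thesis
    by (simp add: has_field_derivative_def mult_commute_abs)
qed

lemma integrable_compact_support:
  fixes h :: "'a::euclidean_space \<Rightarrow> 'b::euclidean_space"
  assumes V: "V \<in> lmeasurable" and c: "continuous_on V h" and K: "compact K" "K \<subseteq> V"
    and z: "\<And>x. x \<in> V \<Longrightarrow> x \<notin> K \<Longrightarrow> h x = 0"
  shows "integrable (lebesgue_on V) h"
proof -
  have "bounded (h ` K)"
    by (intro compact_imp_bounded compact_continuous_image K(1) continuous_on_subset[OF c] K(2))
  then obtain B where B: "\<forall>x\<in>K. norm (h x) \<le> B" by (auto simp: bounded_iff)
  show ?thesis
  proof (rule integrable_lebesgue_on_bounded[OF _ V])
    show "h \<in> borel_measurable (lebesgue_on V)"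
      by (rule continuous_imp_measurable_on_sets_lebesgue[OF c]) (use V in \<open>auto simp: fmeasurable_def\<close>)
    show "norm (h x) \<le> max B 0" if "x \<in> V" for x
      using B z[OF that] by (cases "x \<in> K") auto
  qed
qed

lemma lborel_integral_translate:
  fixes f :: "'a::euclidean_space \<Rightarrow> real"
  assumes "f \<in> borel_measurable borel"
  shows "(\<integral>x. f (x + a) \<partial>lborel) = (\<integral>x. f x \<partial>lborel)"
proof -
  have "(\<integral>x. f x \<partial>lborel) = (\<integral>x. f x \<partial>distr lborel borel ((+) a))" by (simp add: lborel_distr_plus)
  also have "\<dots> = (\<integral>x. f (a + x) \<partial>lborel)" by (rule integral_distr) (use assms in auto)
  finally show ?thesis by (simp add: add.commute)
qed

lemma lborel_integral_reflect:
  fixes f :: "'a::euclidean_space \<Rightarrow> real"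
  assumes "f \<in> borel_measurable borel"
  shows "(\<integral>x. f (a - x) \<partial>lborel) = (\<integral>x. f x \<partial>lborel)"
proof -
  have "(\<integral>x. f x \<partial>lborel) = (\<integral>x. f x \<partial>density (distr lborel borel (\<lambda>x. a + (-1) *\<^sub>R x)) (\<lambda>_. ennreal (\<bar>-1\<bar>^DIM('a))))"
    by (subst lborel_affine[of "-1" a]) auto
  also have "\<dots> = (\<integral>x. f x \<partial>distr lborel borel (\<lambda>x. a + (-1) *\<^sub>R x))"
    by (subst integral_density) (use assms in auto)
  also have "\<dots> = (\<integral>x. f (a + (-1) *\<^sub>R x) \<partial>lborel)" by (rule integral_distr) (use assms in auto)
  finally show ?thesis by simp
qed

lemma integral_cbox_eq_lborel:
  fixes f :: "'a::euclidean_space \<Rightarrow> real"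
  assumes c: "continuous_on UNIV f" and z: "\<And>x. x \<notin> cbox a b \<Longrightarrow> f x = 0"
  shows "integrable lborel f" and "integral (cbox a b) f = (\<integral>x. f x \<partial>lborel)"
proof -
  have e: "(\<lambda>x. indicator (cbox a b) x *\<^sub>R f x) = f"
  proof
    fix x show "indicator (cbox a b) x *\<^sub>R f x = f x" by (cases "x \<in> cbox a b") (auto simp: z)
  qed
  have i: "integrable lborel (\<lambda>x. indicator (cbox a b) x *\<^sub>R f x)"
    by (rule borel_integrable_compact) (auto intro: continuous_on_subset[OF c])
  then show "integrable lborel f" unfolding e .
  have "set_integrable lborel (cbox a b) f" using i by (simp add: set_integrable_def)
  from set_borel_integral_eq_integral(2)[OF this] show "integral (cbox a b) f = (\<integral>x. f x \<partial>lborel)"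
    unfolding set_lebesgue_integral_def e by simp
qed

lemma integral_lebesgue_on_eq_lborel:
  fixes f :: "'a::euclidean_space \<Rightarrow> real"
  assumes "continuous_on UNIV f" "S \<in> sets lebesgue" "\<And>x. x \<notin> S \<Longrightarrow> f x = 0"
  shows "(\<integral>x. f x \<partial>lebesgue_on S) = (\<integral>x. f x \<partial>lborel)"
proof -
  have m: "f \<in> borel_measurable borel" using assms(1) by (rule borel_measurable_continuous_onI)
  have "(\<integral>x. f x \<partial>lebesgue_on S) = (\<integral>x. (if x \<in> S then f x else 0) \<partial>lebesgue)"
    by (rule Lebesgue_Measure.integral_restrict_UNIV[OF assms(2), symmetric])
  also have "(\<lambda>x. if x \<in> S then f x else 0) = f" using assms(3) by auto
  also have "(\<integral>x. f x \<partial>lebesgue) = (\<integral>x. f x \<partial>lborel)" by (rule integral_completion) (use m in auto)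
  finally show ?thesis .
qed

text \<open>The difference quotients have integral zero by translation invariance of Lebesgue measure.\<close>

lemma integral_grad_C1_0:
  fixes \<psi> :: "'a::euclidean_space \<Rightarrow> real"
  assumes \<psi>: "C1_0 \<Omega> \<psi>" and \<Omega>: "\<Omega> \<in> lmeasurable"
  shows "(\<integral>x. grad \<psi> x \<bullet> e \<partial>lebesgue_on \<Omega>) = 0"
proof -
  note D = C1_0_D[OF \<psi>]
  obtain B0 where B0: "\<And>x. norm (grad \<psi> x) \<le> B0" using D(6) by blast
  obtain K where K: "compact K" "K \<subseteq> \<Omega>" "\<And>x. x \<notin> K \<Longrightarrow> \<psi> x = 0" "\<And>x. x \<notin> K \<Longrightarrow> grad \<psi> x = 0"
    using D(8) by blast
  obtain R where R: "\<And>x. x \<in> K \<Longrightarrow> norm x \<le> R" using compact_imp_bounded[OF K(1)] by (auto simp: bounded_iff)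
  define B where "B = B0 * norm e"
  have B00: "B0 \<ge> 0" using B0[of 0] norm_ge_zero order_trans by blast
  have cpsi: "continuous_on UNIV \<psi>" and cg: "continuous_on UNIV (grad \<psi>)" using D by auto
  have mpsi: "\<psi> \<in> borel_measurable borel" using cpsi by (rule borel_measurable_continuous_onI)
  obtain c :: 'a where c: "cball 0 R \<subseteq> cbox (-c) c" using bounded_subset_cbox_symmetric[OF bounded_cball] by metis
  have intpsi: "integrable lborel \<psi>"
    by (rule integral_cbox_eq_lborel(1)[OF cpsi, of "-c" c]) (use K(3) R c in \<open>force\<close>)
  \<comment> \<open>Step lengths of the difference quotients; since they are at most 1, all shifted
    supports stay in one ball, which provides the dominating function.\<close>
  define t where "t = (\<lambda>n. 1 / (real n + 1))"
  have t: "t n > 0" "t n \<le> 1" for n by (auto simp: t_def)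
  have t0: "t \<longlonglongrightarrow> 0" unfolding t_def
    using LIMSEQ_inverse_real_of_nat by (simp add: inverse_eq_divide add.commute)
  define q where "q = (\<lambda>n x. (\<psi> (x + t n *\<^sub>R e) - \<psi> x) / t n)"
  have intt: "integrable lborel (\<lambda>x. \<psi> (x + a))" for a
  proof -
    obtain c' :: 'a where c': "cball 0 (R + norm a) \<subseteq> cbox (-c') c'" using bounded_subset_cbox_symmetric[OF bounded_cball] by metis
    have "\<psi> (x + a) = 0" if "x \<notin> cbox (-c') c'" for x
    proof -
      have "norm x > R + norm a" using that c' by (auto simp: subset_iff not_le)
      then have "norm (x + a) > R" using norm_triangle_ineq4[of "x + a" a] by simp
      then show ?thesis using K(3) R by force
    qed
    then show ?thesis
      by (intro integral_cbox_eq_lborel(1)[of _ "-c'" c'] continuous_on_compose2[OF cpsi] continuous_intros) auto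
  qed
  have q0: "(\<integral>x. q n x \<partial>lborel) = 0" for n
    unfolding q_def using intt[of "t n *\<^sub>R e"] intpsi lborel_integral_translate[OF mpsi, of "t n *\<^sub>R e"] by simp
  have lip: "\<bar>\<psi> y - \<psi> x\<bar> \<le> B0 * norm (y - x)" for x y
  proof -
    have "norm (\<psi> y - \<psi> x) \<le> B0 * norm (y - x)"
    proof (rule differentiable_bound[of UNIV])
      show "(\<psi> has_derivative (\<lambda>v. grad \<psi> x \<bullet> v)) (at x within UNIV)" for x using D(1) by simp
      show "onorm (\<lambda>v. grad \<psi> x \<bullet> v) \<le> B0" for x
      proof (rule onorm_le)
        fix v
        have "norm (grad \<psi> x \<bullet> v) \<le> norm (grad \<psi> x) * norm v" by (simp add: Cauchy_Schwarz_ineq2)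
        also have "\<dots> \<le> B0 * norm v" by (intro mult_right_mono B0) auto
        finally show "norm (grad \<psi> x \<bullet> v) \<le> B0 * norm v" .
      qed
    qed auto
    then show ?thesis by simp
  qed
  define R' where "R' = R + norm e"
  have qb: "\<bar>q n x\<bar> \<le> B * indicator (cball 0 R') x" for n x
  proof (cases "x \<in> cball 0 R'")
    case True
    have "\<bar>q n x\<bar> = \<bar>\<psi> (x + t n *\<^sub>R e) - \<psi> x\<bar> / t n" using t[of n] by (simp add: q_def)
    also have "\<dots> \<le> (B0 * norm (t n *\<^sub>R e)) / t n"
      using lip[of "x + t n *\<^sub>R e" x] t[of n] by (intro divide_right_mono) auto
    also have "\<dots> = B" using t[of n] by (simp add: B_def)
    finally show ?thesis using True by simp
  next
    case False
    then have n: "norm x > R + norm e" by (simp add: R'_def)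
    have "norm (t n *\<^sub>R e) \<le> norm e" using t[of n] by (simp add: mult_left_le_one_le)
    then have "norm (x + t n *\<^sub>R e) > R" "norm x > R"
      using n norm_triangle_ineq4[of "x + t n *\<^sub>R e" "t n *\<^sub>R e"] norm_ge_zero[of e] by (simp_all, linarith+)
    then have "\<psi> (x + t n *\<^sub>R e) = 0" "\<psi> x = 0" using K(3) R not_le by blast+
    then show ?thesis using False by (simp add: q_def)
  qed
  have lim: "(\<lambda>n. q n x) \<longlonglongrightarrow> grad \<psi> x \<bullet> e" for x
  proof -
    have "((\<lambda>s. \<psi> (x + s *\<^sub>R e)) has_real_derivative grad \<psi> x \<bullet> e) (at 0)"
      by (rule DERIV_along_line) (simp add: D(1))
    then have "((\<lambda>h. (\<psi> (x + h *\<^sub>R e) - \<psi> x) / h) \<longlongrightarrow> grad \<psi> x \<bullet> e) (at 0)"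
      by (simp add: DERIV_def)
    moreover have "filterlim t (at 0) sequentially"
      using t0 t(1) by (auto simp: filterlim_at less_imp_neq[symmetric])
    ultimately show ?thesis unfolding q_def by (rule filterlim_compose)
  qed
  have "(\<lambda>n. \<integral>x. q n x \<partial>lborel) \<longlonglongrightarrow> (\<integral>x. grad \<psi> x \<bullet> e \<partial>lborel)"
  proof (rule integral_dominated_convergence[where w="\<lambda>x. B * indicator (cball 0 R') x"])
    show "(\<lambda>x. grad \<psi> x \<bullet> e) \<in> borel_measurable lborel"
      by (simp, intro borel_measurable_continuous_onI continuous_intros cg)
    show "q n \<in> borel_measurable lborel" for n unfolding q_def using intt[of "t n *\<^sub>R e"] intpsi by auto
    show "integrable lborel (\<lambda>x::'a. B * indicator (cball 0 R') x)"
      using emeasure_bounded_finite[OF bounded_cball, of "0::'a" R']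
      by (intro integrable_mult_right integrable_real_indicator) auto
    show "AE x in lborel. (\<lambda>n. q n x) \<longlonglongrightarrow> grad \<psi> x \<bullet> e" using lim by auto
    show "AE x in lborel. norm (q n x) \<le> B * indicator (cball 0 R') x" for n using qb by auto
  qed
  then have "(\<integral>x. grad \<psi> x \<bullet> e \<partial>lborel) = 0" using q0 by (simp add: LIMSEQ_const_iff)
  moreover have "(\<integral>x. grad \<psi> x \<bullet> e \<partial>lebesgue_on \<Omega>) = (\<integral>x. grad \<psi> x \<bullet> e \<partial>lborel)"
    by (rule integral_lebesgue_on_eq_lborel) (use cg \<Omega> D(5) in \<open>auto intro!: continuous_intros simp: fmeasurable_def\<close>)
  ultimately show ?thesis by simp
qed

lemma C1_0_mult:
  fixes f \<eta> :: "'a::euclidean_space \<Rightarrow> real"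
  assumes V: "open V" and f: "Ck_on 1 V f" and \<eta>: "C1_0 V \<eta>"
  defines "g \<equiv> \<lambda>x. if x \<in> V then f x * \<eta> x else 0"
  shows "C1_0 V g" and "x \<in> V \<Longrightarrow> grad g x = f x *\<^sub>R grad \<eta> x + \<eta> x *\<^sub>R grad f x"
proof -
  obtain K where K: "compact K" "K \<subseteq> V" "\<And>x. x \<notin> K \<Longrightarrow> \<eta> x = 0" "\<And>x. x \<notin> K \<Longrightarrow> grad \<eta> x = 0"
    using C1_0_D(8)[OF \<eta>] by blast
  have d: "((\<lambda>x. f x * \<eta> x) has_derivative (\<lambda>v. (f x *\<^sub>R grad \<eta> x + \<eta> x *\<^sub>R grad f x) \<bullet> v)) (at x)" if "x \<in> V" for x
    using has_derivative_mult[OF Ck_on_1_D(1)[OF f V that] C1_0_D(1)[OF \<eta>]]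
    by (simp add: inner_add_left mult.commute)
  have 1: "Ck_on 1 V (\<lambda>x. f x * \<eta> x)"
    by (rule Ck_on_1_I[OF V d])
      (auto intro!: continuous_intros Ck_on_1_D(2,3)[OF f V] continuous_on_subset[OF C1_0_D(2)[OF \<eta>]] continuous_on_subset[OF C1_0_D(3)[OF \<eta>]])
  show "C1_0 V g" unfolding g_def by (rule C1_0_glue(1)[OF V K(1,2) 1]) (simp add: K(3))
  show "grad g x = f x *\<^sub>R grad \<eta> x + \<eta> x *\<^sub>R grad f x" if "x \<in> V"
    using C1_0_glue(2)[OF V K(1,2) 1, of x] grad_eqI[OF d[OF that]] that by (simp add: g_def K(3))
qed

text \<open>The product of \<open>f\<close> and \<open>\<eta>\<close>, extended by zero, is itself a
  test function, so its gradient integrates to zero. Both halves of the product rule are integrable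
  on their own because \<open>\<eta>\<close> is supported in a compact subset of \<open>V\<close>,
  where \<open>f\<close> is C^1.\<close>

lemma integration_by_parts_C1_0:
  fixes f \<eta> :: "'a::euclidean_space \<Rightarrow> real"
  assumes V: "open V" "V \<in> lmeasurable" and f: "Ck_on 1 V f" and \<eta>: "C1_0 V \<eta>"
  shows "integrable (lebesgue_on V) (\<lambda>x. f x * (grad \<eta> x \<bullet> e))" "integrable (lebesgue_on V) (\<lambda>x. \<eta> x * (grad f x \<bullet> e))"
    "(\<integral>x. f x * (grad \<eta> x \<bullet> e) \<partial>lebesgue_on V) = - (\<integral>x. \<eta> x * (grad f x \<bullet> e) \<partial>lebesgue_on V)"
proof -
  obtain K where K: "compact K" "K \<subseteq> V" "\<And>x. x \<notin> K \<Longrightarrow> \<eta> x = 0" "\<And>x. x \<notin> K \<Longrightarrow> grad \<eta> x = 0"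
    using C1_0_D(8)[OF \<eta>] by blast
  show 1: "integrable (lebesgue_on V) (\<lambda>x. f x * (grad \<eta> x \<bullet> e))"
    by (rule integrable_compact_support[OF V(2) _ K(1,2)])
      (auto simp: K intro!: continuous_intros Ck_on_1_D(2,3)[OF f V(1)] continuous_on_subset[OF C1_0_D(2)[OF \<eta>]])
  show 2: "integrable (lebesgue_on V) (\<lambda>x. \<eta> x * (grad f x \<bullet> e))"
    by (rule integrable_compact_support[OF V(2) _ K(1,2)])
      (auto simp: K intro!: continuous_intros Ck_on_1_D(2,3)[OF f V(1)] continuous_on_subset[OF C1_0_D(3)[OF \<eta>]])
  note M = C1_0_mult[OF V(1) f \<eta>]
  have "0 = (\<integral>x. grad (\<lambda>x. if x \<in> V then f x * \<eta> x else 0) x \<bullet> e \<partial>lebesgue_on V)"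
    using integral_grad_C1_0[OF M(1) V(2)] by simp
  also have "\<dots> = (\<integral>x. f x * (grad \<eta> x \<bullet> e) + \<eta> x * (grad f x \<bullet> e) \<partial>lebesgue_on V)"
    by (rule Bochner_Integration.integral_cong) (auto simp: M(2) inner_add_left)
  also have "\<dots> = (\<integral>x. f x * (grad \<eta> x \<bullet> e) \<partial>lebesgue_on V) + (\<integral>x. \<eta> x * (grad f x \<bullet> e) \<partial>lebesgue_on V)"
    by (rule Bochner_Integration.integral_add[OF 1 2])
  finally show "(\<integral>x. f x * (grad \<eta> x \<bullet> e) \<partial>lebesgue_on V) = - (\<integral>x. \<eta> x * (grad f x \<bullet> e) \<partial>lebesgue_on V)" by simp
qed

text \<open>Differentiating along the direction \<open>g\<close> itself turns the Lipschitz bound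
  into |g|^2 \<le> L |g|.\<close>

lemma norm_grad_le_lipschitz:
  fixes f :: "'a::euclidean_space \<Rightarrow> real"
  assumes d: "(f has_derivative (\<lambda>v. g \<bullet> v)) (at x)" and U: "open U" "x \<in> U"
    and lip: "\<And>y. y \<in> U \<Longrightarrow> \<bar>f y - f x\<bar> \<le> L * norm (y - x)"
  shows "norm g \<le> L"
proof (cases "g = 0")
  case True
  \<comment> \<open>When \<open>g = 0\<close> there remains L \<ge> 0, which follows from the bound
    at a second point of \<open>U\<close>.\<close>
  obtain r where r: "r > 0" "ball x r \<subseteq> U" using U openE by blast
  obtain b :: 'a where b: "b \<in> Basis" by (meson SOME_Basis)
  have "x + (r/2) *\<^sub>R b \<in> U" using r b by (auto simp: subset_iff dist_norm)
  from lip[OF this] have "0 \<le> L * (r/2)" using b r by simp (metis abs_ge_zero mult_nonneg_nonneg order_trans zero_le_numeral)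
  then show ?thesis using True r by (simp add: zero_le_mult_iff)
next
  case False
  have "((\<lambda>s. f (x + s *\<^sub>R g)) has_real_derivative g \<bullet> g) (at 0)"
    by (rule DERIV_along_line) (simp add: d)
  then have L: "((\<lambda>h. (f (x + h *\<^sub>R g) - f x) / h) \<longlongrightarrow> g \<bullet> g) (at 0)"
    by (simp add: DERIV_def)
  have "g \<bullet> g \<le> L * norm g"
  proof (rule tendsto_upperbound[OF L])
    have "((\<lambda>h. x + h *\<^sub>R g) \<longlongrightarrow> x + 0 *\<^sub>R g) (at 0)" by (intro tendsto_intros)
    then have "\<forall>\<^sub>F h in at 0. x + h *\<^sub>R g \<in> U"
      using topological_tendstoD[of "\<lambda>h. x + h *\<^sub>R g" x "at 0" U] U by simp
    moreover have "\<forall>\<^sub>F h in at (0::real). h \<noteq> 0" by (simp add: eventually_neq_at_within)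
    ultimately show "\<forall>\<^sub>F h in at 0. (f (x + h *\<^sub>R g) - f x) / h \<le> L * norm g"
    proof eventually_elim
      case (elim h)
      have "(f (x + h *\<^sub>R g) - f x) / h \<le> \<bar>f (x + h *\<^sub>R g) - f x\<bar> / \<bar>h\<bar>"
        by (metis abs_divide abs_ge_self)
      also have "\<dots> \<le> (L * norm (h *\<^sub>R g)) / \<bar>h\<bar>"
        using lip[OF elim(1)] by (intro divide_right_mono) auto
      also have "\<dots> = L * norm g" using elim(2) by simp
      finally show ?case .
    qed
  qed auto
  then have "norm g * norm g \<le> L * norm g" by (simp add: dot_square_norm power2_eq_square)
  then show ?thesis using False by simp
qed


section \<open>Smooth approximation\<close>

text \<open>A radial C^1 kernel supported in the closed ball of radius \<open>s\<close>. It is not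
  normalised; the mollification divides by its integral, called \<open>Z\<close> there.\<close>

definition bump :: "real \<Rightarrow> 'a::euclidean_space \<Rightarrow> real" where
  "bump s x = sqpos (s\<^sup>2 - x \<bullet> x)"

lemma bump_has_derivative:
  "(bump s has_derivative (\<lambda>v. (- (4 * max 0 (s\<^sup>2 - x \<bullet> x))) *\<^sub>R x \<bullet> v)) (at x)"
proof -
  have "((\<lambda>x. s\<^sup>2 - x \<bullet> x) has_derivative (\<lambda>v. - (2 * (x \<bullet> v)))) (at x)"
    by (auto intro!: derivative_eq_intros simp: inner_commute)
  from has_derivative_compose[OF this sqpos_DERIV[unfolded has_field_derivative_def]]
  show ?thesis unfolding bump_def by (simp add: mult.commute mult.left_commute)
qed

lemma bump_facts:
  shows "bump s x \<ge> 0" and "norm x > s \<Longrightarrow> s > 0 \<Longrightarrow> bump s x = 0" and "continuous_on A (bump s)"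
    and "s > 0 \<Longrightarrow> norm x < s \<Longrightarrow> bump s x > 0"
proof -
  show "bump s x \<ge> 0" by (simp add: bump_def sqpos_def)
  show "continuous_on A (bump s)" unfolding bump_def sqpos_def by (intro continuous_intros)
  show "bump s x = 0" if "norm x > s" "s > 0"
  proof -
    have "s\<^sup>2 \<le> (norm x)\<^sup>2" using that by (intro power_mono) auto
    then show ?thesis by (simp add: bump_def sqpos_def dot_square_norm)
  qed
  show "bump s x > 0" if "s > 0" "norm x < s"
  proof -
    have "(norm x)\<^sup>2 < s\<^sup>2" using that by (intro power_strict_mono) auto
    then show ?thesis by (simp add: bump_def sqpos_def dot_square_norm)
  qed
qed

text \<open>Convolution with a compactly supported \<open>C\<^sup>1\<close> kernel.\<close>

lemma lipschitz_smooth_approx: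
  fixes H :: "'a::euclidean_space \<Rightarrow> real"
  assumes lip: "L-lipschitz_on UNIV H" and eps: "\<epsilon> > 0" and S: "bounded S"
  shows "\<exists>F. Ck_on 1 UNIV F \<and> (\<forall>x\<in>S. \<bar>F x - H x\<bar> \<le> \<epsilon> \<and> norm (grad F x) \<le> L)"
proof -
  have L0: "L \<ge> 0" using lip by (rule lipschitz_on_nonneg)
  have Hl: "\<bar>H x - H y\<bar> \<le> L * norm (x - y)" for x y
    using lipschitz_onD[OF lip, of x y] by (simp add: dist_norm)
  have cH: "continuous_on UNIV H" using lip by (rule lipschitz_on_continuous_on)
  \<comment> \<open>The smoothing radius: \<open>H\<close> varies by at most L s \<le> \<epsilon>
    over the support of the kernel. The added 1 covers L = 0.\<close>
  define s where "s = \<epsilon> / (L + 1)"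
  have s: "s > 0" using eps L0 by (simp add: s_def)
  have Ls: "L * s \<le> \<epsilon>" using eps L0 by (simp add: s_def field_simps)
  obtain R where R: "\<And>x. x \<in> S \<Longrightarrow> norm x < R" "R > 0"
    using S by (metis bounded_pos_less)
  \<comment> \<open>This box contains the support of the kernel around every \<open>x\<close> with
    |x| < R, so for these \<open>x\<close> the integral over the box is the full convolution, while
    the Leibniz rule gets a fixed compact domain of integration.\<close>
  obtain c :: 'a where c: "cball 0 (R + s) \<subseteq> cbox (-c) c" using bounded_subset_cbox_symmetric[OF bounded_cball] by metis
  let ?k = "bump s :: 'a \<Rightarrow> real"
  define gk where "gk = (\<lambda>x::'a. (- (4 * max 0 (s\<^sup>2 - x \<bullet> x))) *\<^sub>R x)"
  have ck: "continuous_on UNIV ?k" by (rule bump_facts)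
  obtain c0 :: 'a where c0: "cball 0 s \<subseteq> cbox (-c0) c0" using bounded_subset_cbox_symmetric[OF bounded_cball] by metis
  have kz: "?k x = 0" if "norm x > s" for x using bump_facts(2)[OF that s] .
  have intk: "integrable lborel ?k"
    by (rule integral_cbox_eq_lborel(1)[OF ck, of "-c0" c0]) (use kz c0 in \<open>force\<close>)
  define Z where "Z = (\<integral>x. ?k x \<partial>lborel)"
  have Z: "Z > 0"
  proof -
    have "Z \<ge> 0" unfolding Z_def by (rule integral_nonneg_AE) (simp add: bump_facts)
    moreover have "Z \<noteq> 0"
    proof
      assume "Z = 0"
      then have "AE x in lborel. ?k x = 0"
        unfolding Z_def by (subst (asm) integral_nonneg_eq_0_iff_AE[OF intk]) (auto simp: bump_facts)
      then have "AE x in lborel. x \<notin> ball (0::'a) s"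
        by eventually_elim (use bump_facts(4)[OF s] in force)
      then have "emeasure lborel (ball (0::'a) s) = 0"
        by (subst (asm) AE_iff_measurable[OF _ refl]) (auto simp: ball_def)
      then have "ball (0::'a) s \<in> null_sets lebesgue" by (auto simp: null_sets_def)
      then show False using s open_not_negligible[of "ball (0::'a) s"] by (simp add: negligible_iff_null_sets)
    qed
    ultimately show ?thesis by simp
  qed
  define F where "F = (\<lambda>x. integral (cbox (-c) c) (\<lambda>y. H y * ?k (x - y)) / Z)"
  define fx where "fx = (\<lambda>x y. blinfun_inner_right (H y *\<^sub>R gk (x - y)))"
  have cgk: "continuous_on UNIV gk" unfolding gk_def by (intro continuous_intros)
  have cfx: "continuous_on (UNIV \<times> cbox (-c) c) (\<lambda>(x, y). fx x y)"
    unfolding fx_def case_prod_beta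
    by (intro bounded_linear.continuous_on[OF bounded_linear_blinfun_inner_right] continuous_intros
        continuous_on_compose2[OF cH] continuous_on_compose2[OF cgk]) auto
  have dF: "((\<lambda>x. integral (cbox (-c) c) (\<lambda>y. H y * ?k (x - y))) has_derivative integral (cbox (-c) c) (fx x)) (at x)" for x
  proof (rule leibniz_rule[where U=UNIV and fx=fx])
    fix x t :: 'a
    have "((\<lambda>x. x - t) has_derivative (\<lambda>v. v)) (at x)" by (auto intro!: derivative_eq_intros)
    from has_derivative_compose[OF this bump_has_derivative]
    have "((\<lambda>x. ?k (x - t)) has_derivative (\<lambda>v. gk (x - t) \<bullet> v)) (at x)" by (simp add: gk_def)
    moreover have "blinfun_apply (fx x t) = (\<lambda>v. H t * (gk (x - t) \<bullet> v))" by (auto simp: fx_def)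
    ultimately show "((\<lambda>x. H t * ?k (x - t)) has_derivative blinfun_apply (fx x t)) (at x within UNIV)"
      using has_derivative_mult_right[of "\<lambda>x. ?k (x - t)" _ _ "H t"] by simp
  next
    fix x :: 'a
    show "(\<lambda>y. H y * ?k (x - y)) integrable_on cbox (-c) c"
      by (intro integrable_continuous continuous_intros continuous_on_compose2[OF cH] continuous_on_compose2[OF ck]) auto
  qed (use cfx in auto)
  have dF': "(F has_derivative (\<lambda>v. integral (cbox (-c) c) (fx x) v / Z)) (at x)" for x
    unfolding F_def using has_derivative_mult_left[OF dF, of "1/Z"] by simp
  have "Ck_on 1 UNIV F"
  proof -
    have "F differentiable_on UNIV" using dF' by (auto simp: differentiable_on_def differentiable_def)
    moreover have "continuous_on UNIV (\<lambda>x. frechet_derivative F (at x) v)" for v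
    proof -
      have "continuous_on UNIV (\<lambda>x. integral (cbox (-c) c) (fx x))"
        by (rule integral_continuous_on_param) (use cfx in simp)
      then have "continuous_on UNIV (\<lambda>x. integral (cbox (-c) c) (fx x) v / Z)"
        using Z by (intro continuous_intros) auto
      then show ?thesis by (simp add: frechet_derivative_at[OF dF', symmetric])
    qed
    ultimately show ?thesis by simp
  qed
  moreover
  have cHk: "continuous_on UNIV (\<lambda>y. H y * ?k (x - y))" for x
    by (intro continuous_intros continuous_on_compose2[OF cH] continuous_on_compose2[OF ck]) auto
  have ckx: "continuous_on UNIV (\<lambda>y. ?k (x - y))" for x
    by (intro continuous_intros continuous_on_compose2[OF ck]) auto
  have supp: "?k (x - y) = 0" if "norm x < R" "y \<notin> cbox (-c) c" for x y
  proof -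
    have "norm y > R + s" using that(2) c by (auto simp: subset_iff not_le)
    then have "norm (x - y) > s" using that(1) norm_triangle_ineq2[of y x] by (simp add: norm_minus_commute)
    then show ?thesis by (rule kz)
  qed
  have iHk: "integrable lborel (\<lambda>y. H y * ?k (x - y))" "integrable lborel (\<lambda>y. ?k (x - y))"
    and F1: "F x = (\<integral>y. H y * ?k (x - y) \<partial>lborel) / Z" if "norm x < R" for x
  proof -
    show "integrable lborel (\<lambda>y. H y * ?k (x - y))"
      by (rule integral_cbox_eq_lborel(1)[OF cHk, of "-c" c]) (use supp that in auto)
    show "integrable lborel (\<lambda>y. ?k (x - y))"
      by (rule integral_cbox_eq_lborel(1)[OF ckx, of "-c" c]) (use supp that in auto)
    have "integral (cbox (-c) c) (\<lambda>y. H y * ?k (x - y)) = (\<integral>y. H y * ?k (x - y) \<partial>lborel)"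
      by (rule integral_cbox_eq_lborel(2)[OF cHk]) (use supp that in auto)
    then show "F x = (\<integral>y. H y * ?k (x - y) \<partial>lborel) / Z" by (simp add: F_def)
  qed
  have Zx: "(\<integral>y. ?k (x - y) \<partial>lborel) = Z" for x
    unfolding Z_def by (rule lborel_integral_reflect) (use intk in auto)
  \<comment> \<open>With the shift moved onto \<open>H\<close>, a difference of two values of
    \<open>F\<close> is an average of differences of \<open>H\<close> over the same displacement, so
    the constant \<open>L\<close> is kept without loss.\<close>
  have F2: "F x = (\<integral>y. H (x - y) * ?k y \<partial>lborel) / Z" "integrable lborel (\<lambda>y. H (x - y) * ?k y)" if "norm x < R" for x
  proof -
    have "(\<integral>y. H y * ?k (x - y) \<partial>lborel) = (\<integral>y. H (x - y) * ?k (x - (x - y)) \<partial>lborel)"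
      by (rule lborel_integral_reflect[symmetric])
        (use borel_measurable_continuous_onI[OF cHk] in auto)
    then show "F x = (\<integral>y. H (x - y) * ?k y \<partial>lborel) / Z" using F1[OF that] by simp
    show "integrable lborel (\<lambda>y. H (x - y) * ?k y)"
      by (rule integral_cbox_eq_lborel(1)[of _ "-c0" c0])
        (use kz c0 in \<open>force intro!: continuous_intros continuous_on_compose2[OF cH] continuous_on_compose2[OF ck]\<close>)+
  qed
  have "\<bar>F x - H x\<bar> \<le> \<epsilon>" if "x \<in> S" for x
  proof -
    note x = R(1)[OF that]
    have "F x - H x = (\<integral>y. H y * ?k (x - y) \<partial>lborel) / Z - H x * (\<integral>y. ?k (x - y) \<partial>lborel) / Z"
      using Z by (simp add: F1[OF x] Zx)
    also have "\<dots> = (\<integral>y. H y * ?k (x - y) - H x * ?k (x - y) \<partial>lborel) / Z"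
      using iHk[OF x] by (simp add: diff_divide_distrib)
    finally have 1: "\<bar>F x - H x\<bar> = \<bar>\<integral>y. H y * ?k (x - y) - H x * ?k (x - y) \<partial>lborel\<bar> / Z"
      using Z by simp
    have "\<bar>\<integral>y. H y * ?k (x - y) - H x * ?k (x - y) \<partial>lborel\<bar> \<le> (\<integral>y. \<bar>H y * ?k (x - y) - H x * ?k (x - y)\<bar> \<partial>lborel)"
      by (rule integral_abs_bound)
    also have "\<dots> \<le> (\<integral>y. \<epsilon> * ?k (x - y) \<partial>lborel)"
    proof (rule integral_mono)
      show "integrable lborel (\<lambda>y. \<bar>H y * ?k (x - y) - H x * ?k (x - y)\<bar>)" using iHk[OF x] by auto
      show "integrable lborel (\<lambda>y. \<epsilon> * ?k (x - y))" using iHk[OF x] by auto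
      fix y
      show "\<bar>H y * ?k (x - y) - H x * ?k (x - y)\<bar> \<le> \<epsilon> * ?k (x - y)"
      proof (cases "norm (x - y) > s")
        case False
        have "\<bar>H y - H x\<bar> \<le> L * norm (y - x)" by (rule Hl)
        also have "\<dots> \<le> L * s" using False L0 by (intro mult_left_mono) (auto simp: norm_minus_commute)
        finally have "\<bar>H y - H x\<bar> \<le> \<epsilon>" using Ls by simp
        then have "\<bar>H y - H x\<bar> * ?k (x - y) \<le> \<epsilon> * ?k (x - y)" by (intro mult_right_mono bump_facts)
        moreover have "\<bar>H y * ?k (x - y) - H x * ?k (x - y)\<bar> = \<bar>H y - H x\<bar> * ?k (x - y)"
          using bump_facts(1)[of s "x - y"] by (simp add: abs_mult flip: left_diff_distrib)
        ultimately show ?thesis by simp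
      qed (simp add: kz)
    qed
    also have "\<dots> = \<epsilon> * Z" by (simp add: Zx)
    finally show ?thesis unfolding 1 using Z by (simp add: pos_divide_le_eq)
  qed
  moreover have "norm (grad F x) \<le> L" if "x \<in> S" for x
  proof (rule norm_grad_le_lipschitz)
    show "(F has_derivative (\<lambda>v. grad F x \<bullet> v)) (at x)"
      using dF' has_derivative_grad differentiable_def by blast
    show "open (ball (0::'a) R)" "x \<in> ball 0 R" using R(1)[OF that] by auto
    fix y assume "y \<in> ball (0::'a) R"
    then have y: "norm y < R" by simp
    note x = R(1)[OF that]
    have "F y - F x = (\<integral>z. H (y - z) * ?k z - H (x - z) * ?k z \<partial>lborel) / Z"
      using F2(2)[OF x] F2(2)[OF y] by (simp add: F2(1)[OF x] F2(1)[OF y] diff_divide_distrib)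
    then have 1: "\<bar>F y - F x\<bar> = \<bar>\<integral>z. H (y - z) * ?k z - H (x - z) * ?k z \<partial>lborel\<bar> / Z" using Z by simp
    have "\<bar>\<integral>z. H (y - z) * ?k z - H (x - z) * ?k z \<partial>lborel\<bar> \<le> (\<integral>z. \<bar>H (y - z) * ?k z - H (x - z) * ?k z\<bar> \<partial>lborel)"
      by (rule integral_abs_bound)
    also have "\<dots> \<le> (\<integral>z. (L * norm (y - x)) * ?k z \<partial>lborel)"
    proof (rule integral_mono)
      show "integrable lborel (\<lambda>z. \<bar>H (y - z) * ?k z - H (x - z) * ?k z\<bar>)"
        using F2(2)[OF x] F2(2)[OF y] by auto
      show "integrable lborel (\<lambda>z. (L * norm (y - x)) * ?k z)" using intk by auto
      fix z
      have "\<bar>H (y - z) - H (x - z)\<bar> \<le> L * norm (y - x)" using Hl[of "y - z" "x - z"] by simp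
      then have "\<bar>H (y - z) - H (x - z)\<bar> * ?k z \<le> (L * norm (y - x)) * ?k z" by (intro mult_right_mono bump_facts)
      then show "\<bar>H (y - z) * ?k z - H (x - z) * ?k z\<bar> \<le> (L * norm (y - x)) * ?k z"
        using bump_facts(1)[of s z] by (simp add: abs_mult flip: left_diff_distrib)
    qed
    also have "\<dots> = (L * norm (y - x)) * Z" by (simp add: Z_def)
    finally show "\<bar>F y - F x\<bar> \<le> L * norm (y - x)" unfolding 1 using Z by (simp add: pos_divide_le_eq)
  qed
  ultimately show ?thesis by blast
qed

lemma C1_0_cutoff:
  fixes K U :: "'a::euclidean_space set"
  assumes K: "compact K" and U: "open U" and KU: "K \<subseteq> U"
  shows "\<exists>\<psi>. C1_0 U \<psi> \<and> (\<forall>x. 0 \<le> \<psi> x \<and> \<psi> x \<le> 1) \<and> (\<forall>x\<in>K. \<psi> x = 1)"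
proof (cases "K = {}")
  case True
  have "C1_0 U (\<lambda>_. 0)" unfolding C1_0_def
    using Ck_on_1_I[of UNIV "\<lambda>_::'a. 0" "\<lambda>_. 0"] by auto
  then show ?thesis using True by (intro exI[of _ "\<lambda>_. 0"]) auto
next
  case False
  obtain d where d: "d > 0" "{x. infdist x K \<le> d} \<subseteq> U"
    using compact_in_open_separated[OF False K U KU] by metis
  \<comment> \<open>A mollification within 1/4 of this function is at most 1/4 on \<open>K\<close>
    and at least 1/2 at points whose distance from \<open>K\<close> lies between 3 d / 4 and d. The
    profile \<open>\<xi>\<close> below is 1 on values up to 1/4 and 0 on values from 1/2 on.\<close>
  define H where "H = (\<lambda>x. infdist x K / d)"
  have "(1/d)-lipschitz_on UNIV H"
  proof (rule lipschitz_onI)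
    fix x y :: 'a
    show "dist (H x) (H y) \<le> 1 / d * dist x y"
      using d infdist_triangle_abs[of x K y] by (simp add: H_def dist_real_def divide_right_mono flip: diff_divide_distrib)
  qed (use d in auto)
  moreover have bS: "bounded {x. infdist x K \<le> d}"
    using compact_infdist_le[OF False K d(1)] compact_imp_bounded by blast
  ultimately obtain F where F: "Ck_on 1 UNIV F" "\<And>x. infdist x K \<le> d \<Longrightarrow> \<bar>F x - H x\<bar> \<le> 1/4"
    using lipschitz_smooth_approx[of "1/d" H "1/4" "{x. infdist x K \<le> d}"] by auto
  define \<xi> where "\<xi> = (\<lambda>t. sqpos (1 - sqpos (4 * t - 1)))"
  define \<xi>' where "\<xi>' = (\<lambda>t. 2 * max 0 (1 - sqpos (4 * t - 1)) * (- (2 * max 0 (4 * t - 1) * 4)))"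
  have \<xi>d: "(\<xi> has_real_derivative \<xi>' t) (at t)" for t
  proof -
    have "((\<lambda>t. 4 * t - 1) has_real_derivative 4) (at t)" by (auto intro!: derivative_eq_intros)
    from DERIV_chain2[OF sqpos_DERIV this]
    have "((\<lambda>t. 1 - sqpos (4 * t - 1)) has_real_derivative - (2 * max 0 (4 * t - 1) * 4)) (at t)"
      using DERIV_diff[OF DERIV_const] by force
    from DERIV_chain2[OF sqpos_DERIV this] show ?thesis unfolding \<xi>_def \<xi>'_def .
  qed
  have \<xi>c: "continuous_on UNIV \<xi>'" unfolding \<xi>'_def sqpos_def by (intro continuous_intros)
  define V where "V = {x. infdist x K < d}"
  have V: "open V" unfolding V_def by (intro open_Collect_less continuous_intros)
  define K' where "K' = {x. infdist x K \<le> 3/4 * d}"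
  have K': "compact K'" "K' \<subseteq> V" using d compact_infdist_le[OF False K, of "3/4*d"] by (auto simp: K'_def V_def)
  have dF: "((\<lambda>x. \<xi> (F x)) has_derivative (\<lambda>v. (\<xi>' (F x) *\<^sub>R grad F x) \<bullet> v)) (at x)" for x
    using has_derivative_compose[OF Ck_on_1_D(1)[OF F(1)] \<xi>d[unfolded has_field_derivative_def]]
    by simp
  have 1: "Ck_on 1 V (\<lambda>x. \<xi> (F x))"
    by (rule Ck_on_1_I[OF V dF])
      (auto intro!: continuous_intros continuous_on_compose2[OF \<xi>c] continuous_on_subset[OF Ck_on_1_D(2)[OF F(1)]]
        continuous_on_subset[OF Ck_on_1_D(3)[OF F(1)]])
  have z: "\<xi> (F x) = 0" if "x \<in> V" "x \<notin> K'" for x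
  proof -
    have "H x > 3/4" using that(2) d by (auto simp: K'_def H_def field_simps)
    moreover have "\<bar>F x - H x\<bar> \<le> 1/4" using F(2)[of x] that(1) by (simp add: V_def)
    ultimately have "4 * F x - 1 \<ge> 1" by linarith
    then have "sqpos (4 * F x - 1) \<ge> 1" by (simp add: sqpos_def)
    then show ?thesis by (simp add: \<xi>_def sqpos_def)
  qed
  define \<psi> where "\<psi> = (\<lambda>x. if x \<in> V then \<xi> (F x) else 0)"
  have "C1_0 V \<psi>" unfolding \<psi>_def by (rule C1_0_glue(1)[OF V K' 1 z])
  then have "C1_0 U \<psi>" by (rule C1_0_mono) (use d in \<open>auto simp: V_def\<close>)
  moreover have "0 \<le> \<xi> t" "\<xi> t \<le> 1" for t
  proof -
    show "0 \<le> \<xi> t" by (simp add: \<xi>_def sqpos_def)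
    have "max 0 (1 - sqpos (4 * t - 1)) \<le> 1" by (simp add: sqpos_def)
    then show "\<xi> t \<le> 1" unfolding \<xi>_def sqpos_def[of "1 - _"] by (intro power_le_one) auto
  qed
  then have "0 \<le> \<psi> x \<and> \<psi> x \<le> 1" for x by (simp add: \<psi>_def)
  moreover have "\<psi> x = 1" if "x \<in> K" for x
  proof -
    have "infdist x K = 0" using that by simp
    then have "x \<in> V" "F x \<le> 1/4" using d F(2)[of x] by (auto simp: V_def H_def)
    then show ?thesis by (simp add: \<psi>_def \<xi>_def sqpos_def)
  qed
  ultimately show ?thesis by blast
qed


section \<open>Weak limits of bounded sequences\<close>

lemma C1_0_integrable:
  fixes \<psi> :: "'a::euclidean_space \<Rightarrow> real"
  assumes "C1_0 \<Omega> \<psi>" "\<Omega> \<in> lmeasurable"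
  shows "\<psi> \<in> borel_measurable (lebesgue_on \<Omega>)" "integrable (lebesgue_on \<Omega>) \<psi>"
proof -
  have "\<Omega> \<in> sets lebesgue" using assms(2) by (simp add: fmeasurable_def)
  then show m: "\<psi> \<in> borel_measurable (lebesgue_on \<Omega>)"
    by (intro continuous_imp_measurable_on_sets_lebesgue continuous_on_subset[OF C1_0_D(3)[OF assms(1)]]) auto
  obtain B where "\<And>x. \<bar>\<psi> x\<bar> \<le> B" using C1_0_D(7)[OF assms(1)] by blast
  then show "integrable (lebesgue_on \<Omega>) \<psi>"
    by (intro integrable_lebesgue_on_bounded[OF m assms(2), of B]) auto
qed

text \<open>By regularity of Lebesgue measure \<open>E\<close> lies between a compact set
  \<open>T\<close> and an open set \<open>O'\<close> that are close to it in measure. A cutoff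
  between the two differs from the indicator only on the thin gap \<open>D\<close>.\<close>

lemma indicator_approx_C1_0:
  fixes E \<Omega> :: "'a::euclidean_space set"
  assumes \<Omega>: "open \<Omega>" "bounded \<Omega>" and E: "E \<in> sets (lebesgue_on \<Omega>)" and e: "e > 0"
  shows "\<exists>\<psi>. C1_0 \<Omega> \<psi> \<and> (\<forall>x. 0 \<le> \<psi> x \<and> \<psi> x \<le> 1) \<and> (\<integral>x. \<bar>\<psi> x - indicator E x\<bar> \<partial>lebesgue_on \<Omega>) \<le> e"
proof -
  have \<Omega>s: "\<Omega> \<in> sets lebesgue" using \<Omega> by auto
  have \<Omega>m: "\<Omega> \<in> lmeasurable" using \<Omega> by (simp add: lmeasurable_open)
  have E': "E \<in> sets lebesgue" "E \<subseteq> \<Omega>" using E \<Omega>s by (auto simp: sets_restrict_space_iff)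
  obtain O' where O': "open O'" "E \<subseteq> O'" "O' - E \<in> lmeasurable" "emeasure lebesgue (O' - E) < ennreal (e/2)"
    using sets_lebesgue_outer_open[OF E'(1), of "e/2"] e by auto
  obtain T where T: "closed T" "T \<subseteq> E" "E - T \<in> lmeasurable" "emeasure lebesgue (E - T) < ennreal (e/2)"
    using sets_lebesgue_inner_closed[OF E'(1), of "e/2"] e by auto
  have cT: "compact T" using T E' \<Omega> by (meson bounded_subset compact_eq_bounded_closed)
  obtain \<psi> where \<psi>: "C1_0 (O' \<inter> \<Omega>) \<psi>" "\<And>x. 0 \<le> \<psi> x \<and> \<psi> x \<le> 1" "\<And>x. x \<in> T \<Longrightarrow> \<psi> x = 1"
    using C1_0_cutoff[OF cT, of "O' \<inter> \<Omega>"] O' T E' \<Omega> by blast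
  have \<psi>\<Omega>: "C1_0 \<Omega> \<psi>" using \<psi>(1) by (rule C1_0_mono) auto
  define D where "D = (O' - E) \<union> (E - T)"
  have D: "D \<in> lmeasurable" using O' T by (auto simp: D_def)
  have mD: "measure lebesgue D \<le> e"
  proof -
    have 1: "measure lebesgue (O' - E) \<le> e/2"
      using O'(3,4) e by (simp add: emeasure_eq_measure2 ennreal_less_iff)
    have 2: "measure lebesgue (E - T) \<le> e/2"
      using T(3,4) e by (simp add: emeasure_eq_measure2 ennreal_less_iff)
    show ?thesis using measure_Un_le[of "O' - E" lebesgue "E - T"] O'(3) T(3) 1 2
      by (auto simp: fmeasurable_def D_def)
  qed
  have le: "\<bar>\<psi> x - indicator E x\<bar> \<le> indicator D x" for x
  proof (cases "x \<in> D")
    case True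
    then show ?thesis using \<psi>(2)[of x] by (auto simp: indicator_def)
  next
    case False
    then have "x \<in> T \<or> x \<notin> O'" by (auto simp: D_def)
    then show ?thesis
    proof
      assume "x \<in> T" then show ?thesis using \<psi>(3)[of x] T by (auto simp: indicator_def)
    next
      assume "x \<notin> O'"
      then show ?thesis using C1_0_D(4)[OF \<psi>(1), of x] O' by (auto simp: indicator_def)
    qed
  qed
  have iD: "integrable lebesgue (indicator D :: 'a \<Rightarrow> real)" using D by (simp add: lmeasurable_iff_integrable)
  have iD': "integrable (lebesgue_on \<Omega>) (indicator D :: 'a \<Rightarrow> real)"
    using integrable_restrict_space[of \<Omega> lebesgue "indicator D :: 'a \<Rightarrow> real"] integrable_mult_indicator[OF \<Omega>s iD] \<Omega>s
    by simp
  have iE: "integrable (lebesgue_on \<Omega>) (indicator E :: 'a \<Rightarrow> real)"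
    by (rule integrable_lebesgue_on_bounded[OF _ \<Omega>m, of _ 1]) (use E in \<open>auto simp: indicator_def\<close>)
  have "(\<integral>x. \<bar>\<psi> x - indicator E x\<bar> \<partial>lebesgue_on \<Omega>) \<le> (\<integral>x. indicator D x \<partial>lebesgue_on \<Omega>)"
    by (rule integral_mono) (use C1_0_integrable[OF \<psi>\<Omega> \<Omega>m] iE iD' le in auto)
  also have "\<dots> = (\<integral>x. indicator \<Omega> x *\<^sub>R indicator D x \<partial>lebesgue)"
    by (rule integral_restrict_space) (use \<Omega>s in auto)
  also have "\<dots> \<le> (\<integral>x. indicator D x \<partial>lebesgue)"
    by (rule integral_mono[OF integrable_mult_indicator[OF \<Omega>s iD] iD]) (auto simp: indicator_def)
  also have "\<dots> = measure lebesgue D" by simp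
  finally show ?thesis using \<psi>\<Omega> \<psi>(2) mD by (intro exI[of _ \<psi>]) auto
qed

text \<open>The bound \<open>L\<close> controls the replacement of the indicator by a test function
  under \<open>xn\<close>, uniformly in n. For \<open>d\<close> only integrability is known at this
  stage, so there the replacement error is handled by dominated convergence along a subsequence of
  test functions converging almost everywhere.\<close>

lemma weak_limit_indicator:
  fixes \<Omega> :: "'a::euclidean_space set" and xn :: "nat \<Rightarrow> 'a \<Rightarrow> real"
  assumes \<Omega>: "open \<Omega>" "bounded \<Omega>"
    and m: "\<And>n. xn n \<in> borel_measurable (lebesgue_on \<Omega>)" and L: "\<And>n x. x \<in> \<Omega> \<Longrightarrow> \<bar>xn n x\<bar> \<le> L"
    and d: "integrable (lebesgue_on \<Omega>) d"
    and conv: "\<And>\<psi>. C1_0 \<Omega> \<psi> \<Longrightarrow> (\<lambda>n. \<integral>x. \<psi> x * xn n x \<partial>lebesgue_on \<Omega>) \<longlonglongrightarrow> (\<integral>x. \<psi> x * d x \<partial>lebesgue_on \<Omega>)"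
    and E: "E \<in> sets (lebesgue_on \<Omega>)"
  shows "(\<lambda>n. \<integral>x. indicator E x * xn n x \<partial>lebesgue_on \<Omega>) \<longlonglongrightarrow> (\<integral>x. indicator E x * d x \<partial>lebesgue_on \<Omega>)"
proof -
  let ?M = "lebesgue_on \<Omega>"
  have \<Omega>m: "\<Omega> \<in> lmeasurable" using \<Omega> by (simp add: lmeasurable_open)
  have "\<exists>\<psi>. C1_0 \<Omega> \<psi> \<and> (\<forall>x. 0 \<le> \<psi> x \<and> \<psi> x \<le> 1) \<and> (\<integral>x. \<bar>\<psi> x - indicator E x\<bar> \<partial>?M) \<le> 1 / real (Suc j)" for j
    by (rule indicator_approx_C1_0[OF \<Omega> E]) simp
  then obtain \<psi> where \<psi>: "\<And>j. C1_0 \<Omega> (\<psi> j)" "\<And>j x. 0 \<le> \<psi> j x \<and> \<psi> j x \<le> 1"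
    "\<And>j. (\<integral>x. \<bar>\<psi> j x - indicator E x\<bar> \<partial>?M) \<le> 1 / real (Suc j)"
    by metis
  have m\<psi>: "\<psi> j \<in> borel_measurable ?M" "integrable ?M (\<psi> j)" for j
    using C1_0_integrable[OF \<psi>(1) \<Omega>m] by auto
  have mE: "(indicator E :: 'a \<Rightarrow> real) \<in> borel_measurable ?M" using E by simp
  have iE: "integrable ?M (indicator E :: 'a \<Rightarrow> real)"
    by (rule integrable_lebesgue_on_bounded[OF mE \<Omega>m, of 1]) (auto simp: indicator_def)
  have ix: "integrable ?M (xn n)" for n
    by (rule integrable_lebesgue_on_bounded[OF m \<Omega>m, where B=L]) (use L in auto)
  have L1: "(\<lambda>j. \<integral>x. \<bar>\<psi> j x - indicator E x\<bar> \<partial>?M) \<longlonglongrightarrow> 0"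
    by (rule tendsto_sandwich[OF _ _ tendsto_const LIMSEQ_inverse_real_of_nat])
      (use \<psi>(3) in \<open>auto simp: inverse_eq_divide\<close>)
  have "\<exists>r::nat\<Rightarrow>nat. strict_mono r \<and> (AE x in ?M. (\<lambda>j. \<psi> (r j) x - indicator E x) \<longlonglongrightarrow> 0)"
    by (rule tendsto_L1_AE_subseq) (use m\<psi> iE L1 in auto)
  then obtain r :: "nat \<Rightarrow> nat" where r: "strict_mono r" "AE x in ?M. (\<lambda>j. \<psi> (r j) x - indicator E x) \<longlonglongrightarrow> 0" by blast
  have le1: "\<bar>\<psi> j x - indicator E x\<bar> \<le> 1" for j x
    using \<psi>(2)[of j x] by (auto simp: indicator_def)
  have Ld: "(\<lambda>j. \<integral>x. \<bar>\<psi> (r j) x - indicator E x\<bar> * \<bar>d x\<bar> \<partial>?M) \<longlonglongrightarrow> (\<integral>x. 0 \<partial>?M)"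
  proof (rule integral_dominated_convergence[where w="\<lambda>x. \<bar>d x\<bar>"])
    show "AE x in ?M. (\<lambda>j. \<bar>\<psi> (r j) x - indicator E x\<bar> * \<bar>d x\<bar>) \<longlonglongrightarrow> 0"
      using r(2) by eventually_elim (auto intro!: tendsto_mult_left_zero tendsto_rabs_zero)
    show "AE x in ?M. norm (\<bar>\<psi> (r j) x - indicator E x\<bar> * \<bar>d x\<bar>) \<le> \<bar>d x\<bar>" for j
      using le1 by (auto simp: abs_mult intro!: mult_left_le_one_le)
  qed (use m\<psi> mE d in auto)
  have Lr: "(\<lambda>j. \<integral>x. \<bar>\<psi> (r j) x - indicator E x\<bar> \<partial>?M) \<longlonglongrightarrow> 0"
    using LIMSEQ_subseq_LIMSEQ[OF L1 r(1)] by (simp add: o_def)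
  have abs\<psi>: "AE x in ?M. \<bar>\<psi> j x\<bar> \<le> 1" for j using \<psi>(2) by (auto simp: abs_le_iff intro: order_trans[of _ 0])
  have i1: "integrable ?M (\<lambda>x. \<psi> j x * xn n x)" for j n
    using integrable_mult_bounded[OF ix m\<psi>(1) abs\<psi>] by simp
  have i1': "integrable ?M (\<lambda>x. indicator E x * xn n x)" for n
    using integrable_mult_bounded[OF ix mE, of 1] by auto
  have i2: "integrable ?M (\<lambda>x. \<psi> j x * d x)" for j
    using integrable_mult_bounded[OF d m\<psi>(1) abs\<psi>] by simp
  have i2': "integrable ?M (\<lambda>x. indicator E x * d x)"
    using integrable_mult_bounded[OF d mE, of 1] by auto
  have L0: "\<bar>L\<bar> \<ge> 0" by simp
  show ?thesis
  proof (rule LIMSEQ_I)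
    fix e :: real assume e: "e > 0"
    have "\<forall>\<^sub>F j in sequentially. \<bar>L\<bar> * (\<integral>x. \<bar>\<psi> (r j) x - indicator E x\<bar> \<partial>?M) < e/3"
      by (rule order_tendstoD(2)[OF tendsto_mult_right_zero[OF Lr]]) (use e in auto)
    moreover have "\<forall>\<^sub>F j in sequentially. (\<integral>x. \<bar>\<psi> (r j) x - indicator E x\<bar> * \<bar>d x\<bar> \<partial>?M) < e/3"
      by (rule order_tendstoD(2)[OF Ld]) (use e in auto)
    ultimately have "\<forall>\<^sub>F j in sequentially. \<bar>L\<bar> * (\<integral>x. \<bar>\<psi> (r j) x - indicator E x\<bar> \<partial>?M) < e/3 \<and>
      (\<integral>x. \<bar>\<psi> (r j) x - indicator E x\<bar> * \<bar>d x\<bar> \<partial>?M) < e/3" by eventually_elim auto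
    then obtain j where j: "\<bar>L\<bar> * (\<integral>x. \<bar>\<psi> (r j) x - indicator E x\<bar> \<partial>?M) < e/3"
      "(\<integral>x. \<bar>\<psi> (r j) x - indicator E x\<bar> * \<bar>d x\<bar> \<partial>?M) < e/3"
      by (auto simp: eventually_sequentially)
    let ?\<psi> = "\<psi> (r j)"
    obtain N where N: "\<And>n. n \<ge> N \<Longrightarrow> \<bar>(\<integral>x. ?\<psi> x * xn n x \<partial>?M) - (\<integral>x. ?\<psi> x * d x \<partial>?M)\<bar> < e/3"
      using LIMSEQ_D[OF conv[OF \<psi>(1)[of "r j"]], of "e/3"] e by auto
    show "\<exists>no. \<forall>n\<ge>no. norm ((\<integral>x. indicator E x * xn n x \<partial>?M) - (\<integral>x. indicator E x * d x \<partial>?M)) < e"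
    proof (intro exI[of _ N] allI impI)
      fix n assume n: "n \<ge> N"
      have "\<bar>(\<integral>x. indicator E x * xn n x \<partial>?M) - (\<integral>x. ?\<psi> x * xn n x \<partial>?M)\<bar>
        = \<bar>\<integral>x. indicator E x * xn n x - ?\<psi> x * xn n x \<partial>?M\<bar>"
        using i1 i1' by simp
      also have "\<dots> \<le> (\<integral>x. \<bar>indicator E x * xn n x - ?\<psi> x * xn n x\<bar> \<partial>?M)" by (rule integral_abs_bound)
      also have "\<dots> \<le> (\<integral>x. \<bar>L\<bar> * \<bar>?\<psi> x - indicator E x\<bar> \<partial>?M)"
      proof (rule integral_mono)
        fix x assume "x \<in> space ?M"
        then have "\<bar>xn n x\<bar> \<le> \<bar>L\<bar>" using L[of x n] by auto
        then have "\<bar>xn n x\<bar> * \<bar>?\<psi> x - indicator E x\<bar> \<le> \<bar>L\<bar> * \<bar>?\<psi> x - indicator E x\<bar>" by (intro mult_right_mono) auto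
        then show "\<bar>indicator E x * xn n x - ?\<psi> x * xn n x\<bar> \<le> \<bar>L\<bar> * \<bar>?\<psi> x - indicator E x\<bar>"
          unfolding left_diff_distrib[symmetric] by (simp add: abs_mult abs_minus_commute mult.commute[of "\<bar>xn n x\<bar>"])
      qed (use i1 i1' m\<psi> iE in auto)
      also have "\<dots> < e/3" using j(1) by simp
      finally have 1: "\<bar>(\<integral>x. indicator E x * xn n x \<partial>?M) - (\<integral>x. ?\<psi> x * xn n x \<partial>?M)\<bar> < e/3" .
      have "\<bar>(\<integral>x. ?\<psi> x * d x \<partial>?M) - (\<integral>x. indicator E x * d x \<partial>?M)\<bar>
        = \<bar>\<integral>x. ?\<psi> x * d x - indicator E x * d x \<partial>?M\<bar>"
        using i2 i2' by simp
      also have "\<dots> \<le> (\<integral>x. \<bar>?\<psi> x * d x - indicator E x * d x\<bar> \<partial>?M)" by (rule integral_abs_bound)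
      also have "\<dots> = (\<integral>x. \<bar>?\<psi> x - indicator E x\<bar> * \<bar>d x\<bar> \<partial>?M)"
        by (simp add: abs_mult flip: left_diff_distrib)
      also have "\<dots> < e/3" using j(2) by simp
      finally have 2: "\<bar>(\<integral>x. ?\<psi> x * d x \<partial>?M) - (\<integral>x. indicator E x * d x \<partial>?M)\<bar> < e/3" .
      show "norm ((\<integral>x. indicator E x * xn n x \<partial>?M) - (\<integral>x. indicator E x * d x \<partial>?M)) < e"
        using 1 2 N[OF n] unfolding real_norm_def by linarith
    qed
  qed
qed

text \<open>Tested with the indicator of the set where \<open>d\<close> exceeds \<open>L\<close>,
  the limit integral of \<open>d\<close> is at most that of \<open>L\<close>, which forces this set
  to be null.\<close>

lemma weak_limit_le:
  fixes \<Omega> :: "'a::euclidean_space set" and xn :: "nat \<Rightarrow> 'a \<Rightarrow> real"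
  assumes \<Omega>: "open \<Omega>" "bounded \<Omega>"
    and m: "\<And>n. xn n \<in> borel_measurable (lebesgue_on \<Omega>)" and L: "\<And>n x. x \<in> \<Omega> \<Longrightarrow> \<bar>xn n x\<bar> \<le> L"
    and d: "integrable (lebesgue_on \<Omega>) d"
    and conv: "\<And>\<psi>. C1_0 \<Omega> \<psi> \<Longrightarrow> (\<lambda>n. \<integral>x. \<psi> x * xn n x \<partial>lebesgue_on \<Omega>) \<longlonglongrightarrow> (\<integral>x. \<psi> x * d x \<partial>lebesgue_on \<Omega>)"
  shows "AE x in lebesgue_on \<Omega>. d x \<le> L"
proof -
  let ?M = "lebesgue_on \<Omega>"
  have \<Omega>m: "\<Omega> \<in> lmeasurable" using \<Omega> by (simp add: lmeasurable_open)
  define E where "E = {x \<in> space ?M. L < d x}"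
  have E: "E \<in> sets ?M" unfolding E_def using d by (intro borel_measurable_less) auto
  have mE: "(indicator E :: 'a \<Rightarrow> real) \<in> borel_measurable ?M" using E by simp
  have iE: "integrable ?M (indicator E :: 'a \<Rightarrow> real)"
    by (rule integrable_lebesgue_on_bounded[OF mE \<Omega>m, of 1]) (auto simp: indicator_def)
  have ix: "integrable ?M (xn n)" for n
    by (rule integrable_lebesgue_on_bounded[OF m \<Omega>m, where B=L]) (use L in auto)
  have i1': "integrable ?M (\<lambda>x. indicator E x * xn n x)" for n
    using integrable_mult_bounded[OF ix mE, of 1] by auto
  have i2': "integrable ?M (\<lambda>x. indicator E x * d x)"
    using integrable_mult_bounded[OF d mE, of 1] by auto
  note lim = weak_limit_indicator[OF assms E]
  have "(\<integral>x. indicator E x * d x \<partial>?M) \<le> (\<integral>x. indicator E x * L \<partial>?M)"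
  proof (rule LIMSEQ_le_const2[OF lim])
    have "(\<integral>x. indicator E x * xn n x \<partial>?M) \<le> (\<integral>x. indicator E x * L \<partial>?M)" for n
    proof (rule integral_mono[OF i1' integrable_mult_left[OF iE]])
      fix x assume "x \<in> space ?M"
      then show "indicator E x * xn n x \<le> indicator E x * L" using L[of x n] by (auto simp: indicator_def)
    qed
    then show "\<exists>N. \<forall>n\<ge>N. (\<integral>x. indicator E x * xn n x \<partial>?M) \<le> (\<integral>x. indicator E x * L \<partial>?M)" by blast
  qed
  then have "(\<integral>x. indicator E x * (d x - L) \<partial>?M) \<le> 0" using i2' iE by (simp add: right_diff_distrib)
  moreover have nn: "AE x in ?M. 0 \<le> indicator E x * (d x - L)" by (auto simp: E_def indicator_def)
  moreover have i: "integrable ?M (\<lambda>x. indicator E x * (d x - L))" using i2' iE by (simp add: right_diff_distrib)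
  ultimately have "(\<integral>x. indicator E x * (d x - L) \<partial>?M) = 0" using integral_nonneg_AE[OF nn] by linarith
  then have "AE x in ?M. indicator E x * (d x - L) = 0"
    using integral_nonneg_eq_0_iff_AE[OF i nn] by simp
  with AE_space[of ?M] show ?thesis
    by eventually_elim (auto simp: E_def indicator_def split: if_splits)
qed

text \<open>This is weak star convergence: for a sequence bounded by \<open>L\<close>, convergence
  against compactly supported C^1 functions extends to all integrable functions. Simple functions
  are dense in L^1, and \<open>L\<close> bounds the sequence and its limit alike.\<close>

lemma weak_limit:
  fixes \<Omega> :: "'a::euclidean_space set" and xn :: "nat \<Rightarrow> 'a \<Rightarrow> real"
  assumes \<Omega>: "open \<Omega>" "bounded \<Omega>"
    and m: "\<And>n. xn n \<in> borel_measurable (lebesgue_on \<Omega>)" and L: "\<And>n x. x \<in> \<Omega> \<Longrightarrow> \<bar>xn n x\<bar> \<le> L"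
    and d: "integrable (lebesgue_on \<Omega>) d"
    and conv: "\<And>\<psi>. C1_0 \<Omega> \<psi> \<Longrightarrow> (\<lambda>n. \<integral>x. \<psi> x * xn n x \<partial>lebesgue_on \<Omega>) \<longlonglongrightarrow> (\<integral>x. \<psi> x * d x \<partial>lebesgue_on \<Omega>)"
  shows "AE x in lebesgue_on \<Omega>. \<bar>d x\<bar> \<le> L"
    and "integrable (lebesgue_on \<Omega>) B \<Longrightarrow>
      (\<lambda>n. \<integral>x. B x * xn n x \<partial>lebesgue_on \<Omega>) \<longlonglongrightarrow> (\<integral>x. B x * d x \<partial>lebesgue_on \<Omega>)"
proof -
  let ?M = "lebesgue_on \<Omega>"
  have "AE x in ?M. d x \<le> L" by (rule weak_limit_le[OF assms])
  moreover have "AE x in ?M. - d x \<le> L"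
    by (rule weak_limit_le[OF \<Omega>, of "\<lambda>n x. - xn n x"]) (use m L d conv in \<open>auto intro: tendsto_minus\<close>)
  ultimately show dL: "AE x in ?M. \<bar>d x\<bar> \<le> L" by eventually_elim auto
  have md: "d \<in> borel_measurable ?M" using d by auto
  have ib: "integrable ?M (\<lambda>x. f x * xn n x)" if "integrable ?M f" for f n
    using integrable_mult_bounded[OF that m AE_I2, of n L] L by (auto simp: mult.commute)
  have id: "integrable ?M (\<lambda>x. f x * d x)" if "integrable ?M f" for f
    using integrable_mult_bounded[OF that md dL] by (simp add: mult.commute)
  show "(\<lambda>n. \<integral>x. B x * xn n x \<partial>?M) \<longlonglongrightarrow> (\<integral>x. B x * d x \<partial>?M)" if "integrable ?M B"
    using that
  proof (induction rule: integrable_induct)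
    case (base A c)
    have "(\<lambda>n. c * (\<integral>x. indicator A x * xn n x \<partial>?M)) \<longlonglongrightarrow> c * (\<integral>x. indicator A x * d x \<partial>?M)"
      by (intro tendsto_mult tendsto_const weak_limit_indicator[OF assms base(1)])
    then show ?case by (simp add: ac_simps flip: integral_mult_right_zero)
  next
    case (add f g)
    have "(\<lambda>n. (\<integral>x. f x * xn n x \<partial>?M) + (\<integral>x. g x * xn n x \<partial>?M)) \<longlonglongrightarrow> (\<integral>x. f x * d x \<partial>?M) + (\<integral>x. g x * d x \<partial>?M)"
      by (intro tendsto_add add.IH)
    then show ?case by (simp add: distrib_right Bochner_Integration.integral_add[OF ib[OF add.hyps(1)] ib[OF add.hyps(2)]]
      Bochner_Integration.integral_add[OF id[OF add.hyps(1)] id[OF add.hyps(2)]])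
  next
    case (lim f s)
    have s1: "(\<lambda>i. \<integral>x. \<bar>s i x - f x\<bar> \<partial>?M) \<longlonglongrightarrow> (\<integral>x. 0 \<partial>?M)"
    proof (rule integral_dominated_convergence[where w="\<lambda>x. 3 * \<bar>f x\<bar>"])
      show "AE x in ?M. (\<lambda>i. \<bar>s i x - f x\<bar>) \<longlonglongrightarrow> 0"
        using lim.hyps(2) by (intro AE_I2 tendsto_rabs_zero) (simp add: LIM_zero)
      show "AE x in ?M. norm \<bar>s i x - f x\<bar> \<le> 3 * \<bar>f x\<bar>" for i
      proof (rule AE_I2)
        fix x assume "x \<in> space ?M"
        from lim.hyps(3)[OF this, of i] show "norm \<bar>s i x - f x\<bar> \<le> 3 * \<bar>f x\<bar>" by simp
      qed
    qed (use lim.hyps in auto)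
    show ?case
    proof (rule LIMSEQ_I)
      fix e :: real assume e: "e > 0"
      have "\<forall>\<^sub>F i in sequentially. \<bar>L\<bar> * (\<integral>x. \<bar>s i x - f x\<bar> \<partial>?M) < e/3"
        by (rule order_tendstoD(2)[OF tendsto_mult_right_zero]) (use e s1 in auto)
      then obtain i where i: "\<bar>L\<bar> * (\<integral>x. \<bar>s i x - f x\<bar> \<partial>?M) < e/3" by (auto simp: eventually_sequentially)
      obtain N where N: "\<And>n. n \<ge> N \<Longrightarrow> \<bar>(\<integral>x. s i x * xn n x \<partial>?M) - (\<integral>x. s i x * d x \<partial>?M)\<bar> < e/3"
        using LIMSEQ_D[OF lim.IH[of i], of "e/3"] e by auto
      have key: "\<bar>(\<integral>x. f x * y x \<partial>?M) - (\<integral>x. s i x * y x \<partial>?M)\<bar> < e/3"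
        if y: "y \<in> borel_measurable ?M" "AE x in ?M. \<bar>y x\<bar> \<le> L" for y
      proof -
        have iy: "integrable ?M (\<lambda>x. g x * y x)" if "integrable ?M g" for g
          using integrable_mult_bounded[OF that y] by (simp add: mult.commute)
        have "\<bar>(\<integral>x. f x * y x \<partial>?M) - (\<integral>x. s i x * y x \<partial>?M)\<bar> = \<bar>\<integral>x. f x * y x - s i x * y x \<partial>?M\<bar>"
          using iy[OF lim.hyps(4)] iy[OF lim.hyps(1)] by simp
        also have "\<dots> \<le> (\<integral>x. \<bar>f x * y x - s i x * y x\<bar> \<partial>?M)" by (rule integral_abs_bound)
        also have "\<dots> \<le> (\<integral>x. \<bar>L\<bar> * \<bar>s i x - f x\<bar> \<partial>?M)"
        proof (rule integral_mono_AE)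
          show "AE x in ?M. \<bar>f x * y x - s i x * y x\<bar> \<le> \<bar>L\<bar> * \<bar>s i x - f x\<bar>"
            using y(2)
          proof eventually_elim
            case (elim x)
            then have "\<bar>y x\<bar> * \<bar>s i x - f x\<bar> \<le> \<bar>L\<bar> * \<bar>s i x - f x\<bar>" by (intro mult_right_mono) auto
            then show ?case unfolding left_diff_distrib[symmetric]
              by (simp add: abs_mult abs_minus_commute mult.commute[of "\<bar>y x\<bar>"])
          qed
        qed (use iy[OF lim.hyps(4)] iy[OF lim.hyps(1)] lim.hyps(1,4) in auto)
        finally show ?thesis using i by simp
      qed
      show "\<exists>no. \<forall>n\<ge>no. norm ((\<integral>x. f x * xn n x \<partial>?M) - (\<integral>x. f x * d x \<partial>?M)) < e"
      proof (intro exI[of _ N] allI impI)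
        fix n assume n: "n \<ge> N"
        have 1: "\<bar>(\<integral>x. f x * xn n x \<partial>?M) - (\<integral>x. s i x * xn n x \<partial>?M)\<bar> < e/3"
          by (rule key) (use m L in auto)
        have 2: "\<bar>(\<integral>x. f x * d x \<partial>?M) - (\<integral>x. s i x * d x \<partial>?M)\<bar> < e/3"
          by (rule key[OF md dL])
        show "norm ((\<integral>x. f x * xn n x \<partial>?M) - (\<integral>x. f x * d x \<partial>?M)) < e"
          using 1 2 N[OF n] unfolding real_norm_def by linarith
      qed
    qed
  qed
qed


section \<open>Morrey's inequality\<close>

text \<open>The boxes are the cube of half-side \<open>r\<close> about \<open>x\<close>, shrunk
  towards \<open>z\<close> by the factor \<open>t\<close>. As t decreases from 1 to 0, the average
  of a continuous function over them passes from its mean on the cube to its value at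
  \<open>z\<close>.\<close>

lemma cube_facts:
  fixes x z y :: "'a::euclidean_space" and r :: real
  assumes r: "r > 0"
  defines "a \<equiv> x - r *\<^sub>R One" and "b \<equiv> x + r *\<^sub>R One"
  shows "t > 0 \<Longrightarrow> measure lborel (cbox (z + t *\<^sub>R (a - z)) (z + t *\<^sub>R (b - z))) = (2 * r * t) ^ DIM('a)"
    and "t > 0 \<Longrightarrow> z \<in> cbox a b \<Longrightarrow> y \<in> cbox (z + t *\<^sub>R (a - z)) (z + t *\<^sub>R (b - z)) \<Longrightarrow>
       norm (y - z) \<le> t * (2 * r * real DIM('a))"
    and "norm (z - x) \<le> r \<Longrightarrow> z \<in> cbox a b"
proof -
  have ne: "(\<And>i. i \<in> Basis \<Longrightarrow> u \<bullet> i \<le> v \<bullet> i) \<Longrightarrow> measure lborel (cbox u v) = (\<Prod>i\<in>Basis. v \<bullet> i - u \<bullet> i)" for u v :: 'a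
    by (rule content_cbox) blast
  show "measure lborel (cbox (z + t *\<^sub>R (a - z)) (z + t *\<^sub>R (b - z))) = (2 * r * t) ^ DIM('a)" if t: "t > 0"
  proof -
    have "measure lborel (cbox (z + t *\<^sub>R (a - z)) (z + t *\<^sub>R (b - z))) =
        (\<Prod>i\<in>Basis. (z + t *\<^sub>R (b - z)) \<bullet> i - (z + t *\<^sub>R (a - z)) \<bullet> i)"
      by (rule ne) (use r t in \<open>auto simp: a_def b_def inner_simps mult_left_mono\<close>)
    also have "\<dots> = (\<Prod>i\<in>(Basis::'a set). 2 * r * t)"
      by (rule prod.cong) (auto simp: a_def b_def inner_simps algebra_simps)
    finally show ?thesis by simp
  qed
  show "norm (y - z) \<le> t * (2 * r * real DIM('a))"
    if t: "t > 0" and z: "z \<in> cbox a b" and y: "y \<in> cbox (z + t *\<^sub>R (a - z)) (z + t *\<^sub>R (b - z))"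
  proof -
    have "norm (y - z) \<le> (\<Sum>i\<in>Basis. \<bar>(y - z) \<bullet> i\<bar>)" by (rule norm_le_l1)
    also have "\<dots> \<le> (\<Sum>i\<in>(Basis::'a set). t * (2 * r))"
    proof (rule sum_mono)
      fix i :: 'a assume i: "i \<in> Basis"
      have 1: "t * ((a - z) \<bullet> i) \<le> (y - z) \<bullet> i" "(y - z) \<bullet> i \<le> t * ((b - z) \<bullet> i)"
        using y i by (auto simp: mem_box inner_simps)
      have "- (2 * r) \<le> (a - z) \<bullet> i" "(b - z) \<bullet> i \<le> 2 * r"
        using z i by (auto simp: mem_box a_def b_def inner_simps)
      then have "t * (- (2 * r)) \<le> t * ((a - z) \<bullet> i)" "t * ((b - z) \<bullet> i) \<le> t * (2 * r)"
        using t by (intro mult_left_mono; simp)+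
      then show "\<bar>(y - z) \<bullet> i\<bar> \<le> t * (2 * r)" using 1 by (auto simp: abs_le_iff)
    qed
    also have "\<dots> = t * (2 * r * real DIM('a))" by simp
    finally show ?thesis .
  qed
  show "z \<in> cbox a b" if "norm (z - x) \<le> r"
  proof -
    have "\<bar>(z - x) \<bullet> i\<bar> \<le> r" if "i \<in> Basis" for i
      using Basis_le_norm[OF that, of "z - x"] \<open>norm (z - x) \<le> r\<close> by linarith
    then show ?thesis by (force simp: mem_box a_def b_def inner_simps abs_le_iff)
  qed
qed

text \<open>Change of variables \<open>x = z + t (y - z)\<close> turns the derivative in \<open>t\<close> of the average of \<open>\<eta>\<close> over the
  shrunken cube into the integral of \<open>\<nabla>\<eta>\<close> against this field.\<close>

definition cube_field :: "'a::euclidean_space \<Rightarrow> 'a \<Rightarrow> 'a \<Rightarrow> real \<Rightarrow> 'a \<Rightarrow> 'a" where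
  "cube_field a b z t x = (if x \<in> cbox (z + t *\<^sub>R (a - z)) (z + t *\<^sub>R (b - z))
     then (1 / t ^ Suc DIM('a)) *\<^sub>R (x - z) else 0)"

lemma cube_field_measurable:
  "cube_field a b z t \<in> borel_measurable (lebesgue_on \<Omega>)"
proof -
  have "cube_field a b z t = (\<lambda>x. indicator (cbox (z + t *\<^sub>R (a - z)) (z + t *\<^sub>R (b - z))) x *\<^sub>R ((1 / t ^ Suc DIM('a)) *\<^sub>R (x - z)))"
    by (auto simp: cube_field_def indicator_def)
  then have "cube_field a b z t \<in> borel_measurable borel" by simp
  then show ?thesis
    using measurable_completion measurable_restrict_space1 by (metis measurable_lborel2)
qed

text \<open>The field has size at most 2 r N / t^N on a cube of volume (2 r t)^N. Hoelder's
  inequality turns the volume into t^(N - N/p), leaving t^(-N/p), which is integrable at 0 once p >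
  N. The pointwise bound admits the field as a bounded test field for weak convergence.\<close>

lemma cube_field_estimate:
  fixes x z :: "'a::euclidean_space" and r :: real and D :: "'a \<Rightarrow> 'a"
  assumes r: "r > 0" and \<Omega>: "open \<Omega>" "bounded \<Omega>" and p: "p > 1"
  defines "a \<equiv> x - r *\<^sub>R One" and "b \<equiv> x + r *\<^sub>R One"
  assumes z: "z \<in> cbox a b" and t: "t > 0"
    and D: "D \<in> borel_measurable (lebesgue_on \<Omega>)" "integrable (lebesgue_on \<Omega>) (\<lambda>x. norm (D x) powr p)"
  shows "\<bar>\<integral>x. cube_field a b z t x \<bullet> D x \<partial>lebesgue_on \<Omega>\<bar> \<le>
      (2 * r * DIM('a) * (2 * r) powr (DIM('a) - DIM('a) / p)) * (\<integral>x. norm (D x) powr p \<partial>lebesgue_on \<Omega>) powr (1/p) * t powr (- (DIM('a) / p))"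
    and "norm (cube_field a b z t y) \<le> 2 * r * DIM('a) / t ^ DIM('a)"
proof -
  let ?M = "lebesgue_on \<Omega>"
  let ?N = "DIM('a)"
  let ?Q = "cbox (z + t *\<^sub>R (a - z)) (z + t *\<^sub>R (b - z))"
  have \<Omega>m: "\<Omega> \<in> lmeasurable" using \<Omega> by (simp add: lmeasurable_open)
  have \<Omega>s: "\<Omega> \<in> sets lebesgue" using \<Omega> by auto
  have cf: "norm (cube_field a b z t y) \<le> (2 * r * ?N / t ^ ?N) * indicator ?Q y" for y
  proof (cases "y \<in> ?Q")
    case True
    have "norm (y - z) \<le> t * (2 * r * ?N)"
      using cube_facts(2)[OF r t, of z x y] z True by (simp add: a_def b_def)
    then have "norm (y - z) / t ^ Suc ?N \<le> t * (2 * r * ?N) / t ^ Suc ?N"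
      using t by (intro divide_right_mono) auto
    also have "\<dots> = 2 * r * ?N / t ^ ?N" using t by simp
    finally show ?thesis using True t by (simp add: cube_field_def)
  qed (simp add: cube_field_def)
  show "norm (cube_field a b z t y) \<le> 2 * r * DIM('a) / t ^ DIM('a)"
    using cf[of y] r t by (cases "y \<in> ?Q") auto
  define q where "q = p / (p - 1)"
  have q: "q > 1" "1/p + 1/q = 1" using p by (auto simp: q_def field_simps)
  have q1: "1/q = 1 - 1/p" using q by simp
  have mi: "(indicator ?Q :: 'a \<Rightarrow> real) \<in> borel_measurable ?M"
    by (intro measurable_restrict_space1 borel_measurable_indicator) auto
  have iQ: "integrable ?M (indicator ?Q :: 'a \<Rightarrow> real)"
    by (rule integrable_lebesgue_on_bounded[OF mi \<Omega>m, of 1]) (auto simp: indicator_def)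
  have pow: "(\<lambda>x. \<bar>indicator ?Q x\<bar> powr q) = (indicator ?Q :: 'a \<Rightarrow> real)"
    by (auto simp: indicator_def)
  have mQ: "(\<integral>x. indicator ?Q x \<partial>?M) \<le> (2 * r * t) ^ ?N"
  proof -
    have "(\<integral>x. indicator ?Q x \<partial>?M) = (\<integral>x. indicator \<Omega> x *\<^sub>R (indicator ?Q x :: real) \<partial>lebesgue)"
      by (rule integral_restrict_space) (use \<Omega>s in auto)
    also have "\<dots> \<le> (\<integral>x. indicator ?Q x \<partial>lebesgue)"
    proof (rule integral_mono)
      show i: "integrable lebesgue (indicator ?Q :: 'a \<Rightarrow> real)" by (simp flip: lmeasurable_iff_integrable)
      show "integrable lebesgue (\<lambda>x. indicator \<Omega> x *\<^sub>R (indicator ?Q x :: real))"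
        by (rule integrable_mult_indicator[OF \<Omega>s i])
    qed (auto simp: indicator_def)
    also have "\<dots> = measure lebesgue ?Q" by simp
    also have "\<dots> = (2 * r * t) ^ ?N" using cube_facts(1)[OF r t, of z x] by (simp add: a_def b_def)
    finally show ?thesis .
  qed
  have H: "integrable ?M (\<lambda>x. norm (D x) * indicator ?Q x)"
    "(\<integral>x. \<bar>norm (D x) * indicator ?Q x\<bar> \<partial>?M) \<le>
      (\<integral>x. norm (D x) powr p \<partial>?M) powr (1/p) * (\<integral>x. indicator ?Q x \<partial>?M) powr (1/q)"
    using Hoelder_inequality[OF p q, of "\<lambda>x. norm (D x)" ?M "indicator ?Q"] D mi iQ unfolding pow by simp_all
  let ?E = "(\<integral>x. norm (D x) powr p \<partial>?M) powr (1/p)"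
  have bnd: "\<bar>cube_field a b z t y \<bullet> D y\<bar> \<le> (2 * r * ?N / t ^ ?N) * \<bar>norm (D y) * indicator ?Q y\<bar>" for y
  proof -
    have "\<bar>cube_field a b z t y \<bullet> D y\<bar> \<le> norm (cube_field a b z t y) * norm (D y)" by (rule Cauchy_Schwarz_ineq2)
    also have "\<dots> \<le> ((2 * r * ?N / t ^ ?N) * indicator ?Q y) * norm (D y)"
      by (intro mult_right_mono cf) auto
    finally show ?thesis by (simp add: mult_ac)
  qed
  have "\<bar>\<integral>x. cube_field a b z t x \<bullet> D x \<partial>?M\<bar> \<le> (\<integral>x. \<bar>cube_field a b z t x \<bullet> D x\<bar> \<partial>?M)"
    by (rule integral_abs_bound)
  also have "\<dots> \<le> (\<integral>x. (2 * r * ?N / t ^ ?N) * \<bar>norm (D x) * indicator ?Q x\<bar> \<partial>?M)"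
  proof (rule integral_mono_AE')
    show "integrable ?M (\<lambda>x. (2 * r * ?N / t ^ ?N) * \<bar>norm (D x) * indicator ?Q x\<bar>)" using H(1) by auto
  qed (use bnd r t in auto)
  also have "\<dots> = (2 * r * ?N / t ^ ?N) * (\<integral>x. \<bar>norm (D x) * indicator ?Q x\<bar> \<partial>?M)" by simp
  also have "\<dots> \<le> (2 * r * ?N / t ^ ?N) * (?E * ((2 * r * t) ^ ?N) powr (1/q))"
  proof (intro mult_left_mono order_trans[OF H(2)])
    show "(\<integral>x. indicator ?Q x \<partial>?M) powr (1 / q) \<le> ((2 * r * t) ^ ?N) powr (1 / q)"
      using q mQ by (intro powr_mono2) (auto intro!: integral_nonneg_AE)
  qed (use r t in auto)
  also have "\<dots> = (2 * r * ?N * (2 * r) powr (?N - ?N / p)) * ?E * t powr (- (?N / p))"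
  proof -
    have "((2 * r * t) ^ ?N) powr (1/q) = (2 * r * t) powr (?N - ?N / p)"
      using r t by (simp add: q1 powr_powr powr_realpow[symmetric] right_diff_distrib)
    also have "\<dots> = (2 * r) powr (?N - ?N / p) * t powr (?N - ?N / p)"
      using r t by (simp add: powr_mult)
    also have "t powr (?N - ?N / p) = t ^ ?N * t powr (- (?N / p))"
      using t by (simp add: powr_diff powr_minus powr_realpow field_simps)
    finally show ?thesis using t by (simp add: field_simps)
  qed
  finally show "\<bar>\<integral>x. cube_field a b z t x \<bullet> D x \<partial>?M\<bar> \<le>
      (2 * r * ?N * (2 * r) powr (?N - ?N / p)) * ?E * t powr (- (?N / p))" .
qed

lemma cube_average_derivative:
  fixes \<eta> :: "'a::euclidean_space \<Rightarrow> real" and z :: 'a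
  assumes \<eta>: "C1_0 \<Omega> \<eta>" and \<Omega>: "open \<Omega>" and ab: "cbox a b \<noteq> {}"
  defines "m \<equiv> \<lambda>t. integral (cbox a b) (\<lambda>y. \<eta> (z + t *\<^sub>R (y - z)))"
  defines "m' \<equiv> \<lambda>t. integral (cbox a b) (\<lambda>y. grad \<eta> (z + t *\<^sub>R (y - z)) \<bullet> (y - z))"
  shows "(m has_real_derivative m' t) (at t)" and "continuous_on UNIV m'"
    and "t > 0 \<Longrightarrow> m' t = (\<integral>x. cube_field a b z t x \<bullet> grad \<eta> x \<partial>lebesgue_on \<Omega>)"
proof -
  have c\<eta>: "continuous_on UNIV \<eta>" and cg: "continuous_on UNIV (grad \<eta>)" using C1_0_D[OF \<eta>] by auto
  have cfx: "continuous_on (UNIV \<times> cbox a b) (\<lambda>(t, y). grad \<eta> (z + t *\<^sub>R (y - z)) \<bullet> (y - z))"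
    unfolding case_prod_beta by (intro continuous_intros continuous_on_compose2[OF cg]) auto
  show "(m has_real_derivative m' t) (at t)"
    unfolding m_def m'_def
  proof (rule leibniz_rule_field_derivative[where U=UNIV])
    show "((\<lambda>t. \<eta> (z + t *\<^sub>R (y - z))) has_real_derivative grad \<eta> (z + t *\<^sub>R (y - z)) \<bullet> (y - z)) (at t within UNIV)" for t y
      using DERIV_along_line[OF C1_0_D(1)[OF \<eta>]] by simp
    show "(\<lambda>y. \<eta> (z + t *\<^sub>R (y - z))) integrable_on cbox a b" for t
      by (intro integrable_continuous continuous_intros continuous_on_compose2[OF c\<eta>]) auto
  qed (use cfx in auto)
  show "continuous_on UNIV m'"
    unfolding m'_def by (rule integral_continuous_on_param) (use cfx in simp)
  show "m' t = (\<integral>x. cube_field a b z t x \<bullet> grad \<eta> x \<partial>lebesgue_on \<Omega>)" if t: "t > 0"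
  proof -
    let ?a = "z + t *\<^sub>R (a - z)" and ?b = "z + t *\<^sub>R (b - z)"
    \<comment> \<open>The factor 1/t comes from y - z = (x - z)/t; the Jacobian supplies the
      remaining t^(-N) of \<open>cube_field\<close>.\<close>
    define f where "f = (\<lambda>x. (1/t) * (grad \<eta> x \<bullet> (x - z)))"
    have cf: "continuous_on S f" for S
      unfolding f_def by (intro continuous_intros continuous_on_subset[OF cg]) auto
    have "(f has_integral integral (cbox ?a ?b) f) (cbox ?a ?b)"
      using cf by (intro integrable_integral integrable_continuous)
    from has_integral_affinity[OF this, of t "z - t *\<^sub>R z"] t
    have "((\<lambda>y. f (t *\<^sub>R y + (z - t *\<^sub>R z))) has_integral (1 / t ^ DIM('a)) * integral (cbox ?a ?b) f)
        ((\<lambda>x. (1 / t) *\<^sub>R x + - ((1 / t) *\<^sub>R (z - t *\<^sub>R z))) ` cbox ?a ?b)" by simp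
    moreover have "(\<lambda>x. (1 / t) *\<^sub>R x + - ((1 / t) *\<^sub>R (z - t *\<^sub>R z))) ` cbox ?a ?b = cbox a b"
    proof -
      have ne: "cbox ?a ?b \<noteq> {}"
        using ab t by (auto simp: box_ne_empty inner_simps mult_left_mono)
      have ea: "(1 / t) *\<^sub>R ?a + - ((1 / t) *\<^sub>R (z - t *\<^sub>R z)) = a"
        and eb: "(1 / t) *\<^sub>R ?b + - ((1 / t) *\<^sub>R (z - t *\<^sub>R z)) = b"
        using t by (simp_all add: algebra_simps)
      show ?thesis unfolding image_affinity_cbox using ne t ea eb by simp
    qed
    moreover have "f (t *\<^sub>R y + (z - t *\<^sub>R z)) = grad \<eta> (z + t *\<^sub>R (y - z)) \<bullet> (y - z)" for y
    proof -
      have 1: "t *\<^sub>R y + (z - t *\<^sub>R z) = z + t *\<^sub>R (y - z)" by (simp add: algebra_simps)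
      show ?thesis unfolding 1 f_def using t by simp
    qed
    ultimately have 1: "m' t = (1 / t ^ DIM('a)) * integral (cbox ?a ?b) f"
      unfolding m'_def by (simp add: integral_unique)
    have "integrable (lebesgue_on (cbox ?a ?b)) f" using cf by (rule continuous_imp_integrable)
    then have "integral (cbox ?a ?b) f = (\<integral>x. f x \<partial>lebesgue_on (cbox ?a ?b))"
      by (rule lebesgue_integral_eq_integral[symmetric]) auto
    also have "\<dots> = (\<integral>x. (if x \<in> cbox ?a ?b then f x else 0) \<partial>lebesgue)"
      by (rule Lebesgue_Measure.integral_restrict_UNIV[symmetric]) auto
    \<comment> \<open>The gradient of \<open>\<eta>\<close> vanishes off \<Omega>, so the cube may
      stick out of \<Omega> without changing the integral.\<close>
    also have "(\<lambda>x. if x \<in> cbox ?a ?b then f x else 0) = (\<lambda>x. if x \<in> \<Omega> then (if x \<in> cbox ?a ?b then f x else 0) else 0)"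
      using C1_0_D(5)[OF \<eta>] by (auto simp: f_def)
    also have "(\<integral>x. (if x \<in> \<Omega> then (if x \<in> cbox ?a ?b then f x else 0) else 0) \<partial>lebesgue) =
       (\<integral>x. (if x \<in> cbox ?a ?b then f x else 0) \<partial>lebesgue_on \<Omega>)"
      by (rule Lebesgue_Measure.integral_restrict_UNIV) (use \<Omega> in auto)
    finally have "m' t = (\<integral>x. (1 / t ^ DIM('a)) * (if x \<in> cbox ?a ?b then f x else 0) \<partial>lebesgue_on \<Omega>)"
      unfolding 1 by simp
    also have "\<dots> = (\<integral>x. cube_field a b z t x \<bullet> grad \<eta> x \<partial>lebesgue_on \<Omega>)"
      by (rule Bochner_Integration.integral_cong) (auto simp: cube_field_def f_def inner_commute)
    finally show ?thesis .
  qed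
qed

lemma integrable_powr_01:
  assumes "\<alpha> < 1"
  shows "integrable (lebesgue_on {0..1}) (\<lambda>t::real. t powr (-\<alpha>))"
    and "(\<integral>t. t powr (-\<alpha>) \<partial>lebesgue_on {0..1}) = 1 / (1 - \<alpha>)"
proof -
  have h: "((\<lambda>t. t powr (-\<alpha>)) has_integral 1 / (1 - \<alpha>)) {0..1::real}"
    using has_integral_powr_from_0[of "-\<alpha>" 1] assms by simp
  then have "(\<lambda>t::real. t powr (-\<alpha>)) absolutely_integrable_on {0..1}"
    by (intro nonnegative_absolutely_integrable_1) (auto simp: integrable_on_def)
  then show i: "integrable (lebesgue_on {0..1}) (\<lambda>t::real. t powr (-\<alpha>))"
    by (simp add: set_integrable_def integrable_restrict_space)
  show "(\<integral>t. t powr (-\<alpha>) \<partial>lebesgue_on {0..1}) = 1 / (1 - \<alpha>)"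
    using lebesgue_integral_eq_integral[OF i] integral_unique[OF h] by simp
qed

text \<open>Only weak convergence of the gradients is needed: for fixed \<open>t\<close>, the derivative of the average over
  the shrunken cube is a bounded linear functional of the gradient.\<close>

lemma Morrey_weak:
  fixes \<Omega> :: "'a::euclidean_space set" and \<eta> :: "nat \<Rightarrow> 'a \<Rightarrow> real"
  assumes \<Omega>: "open \<Omega>" "bounded \<Omega>" and p: "p \<ge> 2 * real DIM('a)"
    and \<eta>: "\<And>j. C1_0 \<Omega> (\<eta> j)" and lim: "\<And>x. (\<lambda>j. \<eta> j x) \<longlonglongrightarrow> e x"
    and D: "D \<in> borel_measurable (lebesgue_on \<Omega>)" "integrable (lebesgue_on \<Omega>) (\<lambda>x. norm (D x) powr p)"
    and B: "\<And>j. (\<integral>x. norm (grad (\<eta> j) x) powr p \<partial>lebesgue_on \<Omega>) \<le> B"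
    and weak: "\<And>\<psi> c. \<psi> \<in> borel_measurable (lebesgue_on \<Omega>) \<Longrightarrow> (\<And>x. norm (\<psi> x) \<le> c) \<Longrightarrow>
      (\<lambda>j. \<integral>x. \<psi> x \<bullet> grad (\<eta> j) x \<partial>lebesgue_on \<Omega>) \<longlonglongrightarrow> (\<integral>x. \<psi> x \<bullet> D x \<partial>lebesgue_on \<Omega>)"
  shows "\<bar>e x - e y\<bar> \<le> 8 * DIM('a) * norm (x - y) powr (1 - DIM('a) / p) * (\<integral>x. norm (D x) powr p \<partial>lebesgue_on \<Omega>) powr (1/p)"
proof (cases "x = y")
  case False
  let ?M = "lebesgue_on \<Omega>"
  let ?N = "DIM('a)"
  let ?T = "lebesgue_on {0..1::real}"
  define E where "E = (\<integral>x. norm (D x) powr p \<partial>?M) powr (1/p)"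
  define r where "r = norm (x - y)"
  have r: "r > 0" using False by (simp add: r_def)
  \<comment> \<open>The cube about \<open>x\<close> of half-side |x - y| contains both points, so
    both values are compared with the same average.\<close>
  define a where "a = x - r *\<^sub>R One"
  define b where "b = x + r *\<^sub>R One"
  have N1: "real ?N \<ge> 1" by (simp add: Suc_leI)
  have p1: "p > 1" using p N1 by linarith
  have \<alpha>: "?N / p \<le> 1/2" "?N / p \<ge> 0" using p p1 by (auto simp: field_simps)
  have \<Omega>m: "\<Omega> \<in> lmeasurable" using \<Omega> by (simp add: lmeasurable_open)
  define K where "K = 2 * r * ?N * (2 * r) powr (?N - ?N / p)"
  have K: "K \<ge> 0" using r by (simp add: K_def)
  have E0: "E \<ge> 0" by (simp add: E_def)
  have Q: "(2 * r) ^ ?N = measure lborel (cbox a b)"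
    using cube_facts(1)[OF r, of 1 0 x] by (simp add: a_def b_def)
  have g: "grad (\<eta> j) \<in> borel_measurable ?M" "integrable ?M (\<lambda>x. norm (grad (\<eta> j) x) powr p)" for j
  proof -
    show m: "grad (\<eta> j) \<in> borel_measurable ?M"
      by (intro continuous_imp_measurable_on_sets_lebesgue continuous_on_subset[OF C1_0_D(2)[OF \<eta>]]) (use \<Omega> in auto)
    obtain c where c: "\<And>x. norm (grad (\<eta> j) x) \<le> c" using C1_0_D(6)[OF \<eta>] by blast
    show "integrable ?M (\<lambda>x. norm (grad (\<eta> j) x) powr p)"
      by (rule integrable_lebesgue_on_bounded[OF _ \<Omega>m, of _ "c powr p"]) (use m c p1 in \<open>auto intro!: powr_mono2\<close>)
  qed
  have B0: "B \<ge> 0" 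
  proof -
    have "0 \<le> (\<integral>x. norm (grad (\<eta> 0) x) powr p \<partial>?M)" by (rule integral_nonneg_AE) auto
    with B[of 0] show ?thesis by linarith
  qed
  have key: "\<exists>\<epsilon>. \<epsilon> \<longlonglongrightarrow> 0 \<and> (\<forall>j. \<bar>integral (cbox a b) (\<eta> j) - (2 * r) ^ ?N * \<eta> j z\<bar> \<le> 2 * (K * E) + \<epsilon> j)"
    if z: "z \<in> cbox a b" for z
  proof -
    define m' where "m' = (\<lambda>j t. integral (cbox a b) (\<lambda>y. grad (\<eta> j) (z + t *\<^sub>R (y - z)) \<bullet> (y - z)))"
    have ab: "cbox a b \<noteq> {}" using z by auto
    have CA1: "((\<lambda>t. integral (cbox a b) (\<lambda>y. \<eta> j (z + t *\<^sub>R (y - z)))) has_real_derivative m' j t) (at t)" for j t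
      unfolding m'_def by (rule cube_average_derivative(1)[OF \<eta> \<Omega>(1) ab])
    have CA2: "continuous_on UNIV (m' j)" for j
      unfolding m'_def by (rule cube_average_derivative(2)[OF \<eta> \<Omega>(1) ab])
    have CA3: "m' j t = (\<integral>x. cube_field a b z t x \<bullet> grad (\<eta> j) x \<partial>?M)" if "t > 0" for j t
      unfolding m'_def by (rule cube_average_derivative(3)[OF \<eta> \<Omega>(1) ab that])
    \<comment> \<open>The excess of the derivative over the bound expected from the limit field
      \<open>D\<close>. It tends to zero for each t > 0 by weak convergence, and the energy bound
      \<open>B\<close> dominates it; this is how \<open>B\<close> drops out of the final
      estimate.\<close>
    define G where "G = (\<lambda>j t. max (\<bar>m' j t\<bar> - K * E * t powr (- (?N / p))) 0)"
    define Bp where "Bp = B powr (1/p)"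
    have cm: "continuous_on S (m' j)" for j S
      using CA2 continuous_on_subset by blast
    have mm: "m' j \<in> borel_measurable ?T" for j
      by (rule continuous_imp_measurable_on_sets_lebesgue[OF cm]) auto
    have im: "integrable ?T (m' j)" for j
      by (rule continuous_imp_integrable_real[OF cm])
    note P = integrable_powr_01[of "?N / p"]
    have P1: "integrable ?T (\<lambda>t. t powr (- (?N / p)))" using P(1) \<alpha> by simp
    \<comment> \<open>Here p \<ge> 2 N enters: N/p \<le> 1/2 bounds the integral 1/(1 - N/p) by 2,
      so that Morrey's constant does not depend on p.\<close>
    have P2: "(\<integral>t. t powr (- (?N / p)) \<partial>?T) \<le> 2"
    proof -
      have "1 / (1 - ?N / p) \<le> 1 / (1/2)" by (rule frac_le) (use \<alpha>(1) in linarith)+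
      then show ?thesis using P(2) \<alpha> by simp
    qed
    have pos: "AE t in ?T. t > 0"
    proof -
      have "AE t in lebesgue. (t::real) \<noteq> 0" by (rule AE_completion[OF AE_lborel_singleton])
      then have "AE t in ?T. t \<noteq> 0" by (subst AE_restrict_space_iff) auto
      with AE_space[of ?T] show ?thesis by eventually_elim auto
    qed
    have mb: "\<bar>m' j t\<bar> \<le> K * Bp * t powr (- (?N / p))" if "t > 0" for j t
    proof -
      have "m' j t = (\<integral>x. cube_field a b z t x \<bullet> grad (\<eta> j) x \<partial>?M)"
        by (rule CA3[OF that])
      also have "\<bar>\<dots>\<bar> \<le> K * (\<integral>x. norm (grad (\<eta> j) x) powr p \<partial>?M) powr (1/p) * t powr (- (?N / p))"
        using cube_field_estimate(1)[OF r \<Omega> p1 _ that g, where z=z and x=x] z by (simp add: a_def b_def K_def)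
      also have "\<dots> \<le> K * Bp * t powr (- (?N / p))"
        unfolding Bp_def using B[of j] p1 K
        by (intro mult_right_mono mult_left_mono powr_mono2) (auto intro!: integral_nonneg_AE)
      finally show ?thesis .
    qed
    have G0: "(\<lambda>j. \<integral>t. G j t \<partial>?T) \<longlonglongrightarrow> (\<integral>t. 0 \<partial>?T)"
    proof (rule integral_dominated_convergence[where w="\<lambda>t. K * Bp * t powr (- (?N / p))"])
      show "G j \<in> borel_measurable ?T" for j
        unfolding G_def using mm P1 by (intro borel_measurable_max borel_measurable_diff borel_measurable_times) auto
      show "integrable ?T (\<lambda>t. K * Bp * t powr (- (?N / p)))" using P1 by (intro integrable_mult_right) auto
      show "AE t in ?T. (\<lambda>j. G j t) \<longlonglongrightarrow> 0"
        using pos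
      proof eventually_elim
        case (elim t)
        define l where "l = (\<integral>x. cube_field a b z t x \<bullet> D x \<partial>?M)"
        have "(\<lambda>j. m' j t) \<longlonglongrightarrow> l"
        proof -
          have "norm (cube_field a b z t u) \<le> 2 * r * ?N / t ^ ?N" for u
            using cube_field_estimate(2)[OF r \<Omega> p1 _ elim D, where z=z and x=x and y=u] z by (simp add: a_def b_def)
          from weak[OF cube_field_measurable this] show ?thesis unfolding l_def CA3[OF elim] .
        qed
        then have "(\<lambda>j. G j t) \<longlonglongrightarrow> max (\<bar>l\<bar> - K * E * t powr (- (?N / p))) 0"
          unfolding G_def by (intro tendsto_intros)
        moreover have "\<bar>l\<bar> \<le> K * E * t powr (- (?N / p))"
          unfolding l_def using cube_field_estimate(1)[OF r \<Omega> p1 _ elim D, where z=z and x=x] z by (simp add: a_def b_def K_def E_def)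
        ultimately show ?case by simp
      qed
      show "AE t in ?T. norm (G j t) \<le> K * Bp * t powr (- (?N / p))" for j
        using pos
      proof eventually_elim
        case (elim t)
        have "0 \<le> K * E * t powr (- (?N / p))" using K E0 by simp
        then show ?case using mb[OF elim, of j] by (auto simp: G_def)
      qed
    qed auto
    have iG: "integrable ?T (G j)" for j
      unfolding G_def using im P1 by (intro integrable_max) auto
    have "\<bar>integral (cbox a b) (\<eta> j) - (2 * r) ^ ?N * \<eta> j z\<bar> \<le> 2 * (K * E) + (\<integral>t. G j t \<partial>?T)" for j
    proof -
      define m where "m = (\<lambda>t. integral (cbox a b) (\<lambda>y. \<eta> j (z + t *\<^sub>R (y - z))))"
      have "(m' j has_integral m 1 - m 0) {0..1}"
      proof (rule fundamental_theorem_of_calculus)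
        fix t :: real
        show "(m has_vector_derivative m' j t) (at t within {0..1})"
          using CA1[of j t] unfolding m_def
          by (simp add: has_real_derivative_iff_has_vector_derivative has_vector_derivative_at_within)
      qed auto
      then have "m 1 - m 0 = (\<integral>t. m' j t \<partial>?T)"
        using lebesgue_integral_eq_integral[OF im] by (simp add: integral_unique)
      then have "\<bar>m 1 - m 0\<bar> \<le> (\<integral>t. \<bar>m' j t\<bar> \<partial>?T)" by (simp add: integral_abs_bound)
      also have "\<dots> \<le> (\<integral>t. K * E * t powr (- (?N / p)) + G j t \<partial>?T)"
        by (rule integral_mono) (use im iG P1 in \<open>auto simp: G_def\<close>)
      also have "\<dots> = K * E * (\<integral>t. t powr (- (?N / p)) \<partial>?T) + (\<integral>t. G j t \<partial>?T)"
        using iG P1 by simp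
      also have "\<dots> \<le> K * E * 2 + (\<integral>t. G j t \<partial>?T)"
        using P2 K E0 by (intro add_right_mono mult_left_mono) auto
      finally have "\<bar>m 1 - m 0\<bar> \<le> K * E * 2 + (\<integral>t. G j t \<partial>?T)" .
      moreover have "m 1 = integral (cbox a b) (\<eta> j)" by (simp add: m_def)
      moreover have "m 0 = (2 * r) ^ ?N * \<eta> j z" unfolding Q by (simp add: m_def)
      ultimately show ?thesis by simp
    qed
    then show ?thesis using G0 by (intro exI[of _ "\<lambda>j. \<integral>t. G j t \<partial>?T"]) simp
  qed
  have xy: "x \<in> cbox a b" "y \<in> cbox a b"
    using cube_facts(3)[OF r, of x x] cube_facts(3)[OF r, of y x] r by (auto simp: a_def b_def r_def norm_minus_commute)
  obtain \<epsilon>1 where \<epsilon>1: "\<epsilon>1 \<longlonglongrightarrow> 0" "\<And>j. \<bar>integral (cbox a b) (\<eta> j) - (2 * r) ^ ?N * \<eta> j x\<bar> \<le> 2 * (K * E) + \<epsilon>1 j"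
    using key[OF xy(1)] by blast
  obtain \<epsilon>2 where \<epsilon>2: "\<epsilon>2 \<longlonglongrightarrow> 0" "\<And>j. \<bar>integral (cbox a b) (\<eta> j) - (2 * r) ^ ?N * \<eta> j y\<bar> \<le> 2 * (K * E) + \<epsilon>2 j"
    using key[OF xy(2)] by blast
  \<comment> \<open>Twice 2 K E, once for each point; together with the factor 2 r N inside
    \<open>K\<close> this produces the constant 8 N.\<close>
  have "(2 * r) ^ ?N * \<bar>e x - e y\<bar> \<le> 4 * (K * E) + 0 + 0"
  proof (rule LIMSEQ_le)
    show "(\<lambda>j. (2 * r) ^ ?N * \<bar>\<eta> j x - \<eta> j y\<bar>) \<longlonglongrightarrow> (2 * r) ^ ?N * \<bar>e x - e y\<bar>"
      by (intro tendsto_intros lim)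
    show "(\<lambda>j. 4 * (K * E) + \<epsilon>1 j + \<epsilon>2 j) \<longlonglongrightarrow> 4 * (K * E) + 0 + 0"
      by (intro tendsto_intros \<epsilon>1 \<epsilon>2)
    have "(2 * r) ^ ?N * \<bar>\<eta> j x - \<eta> j y\<bar> \<le> 4 * (K * E) + \<epsilon>1 j + \<epsilon>2 j" for j
    proof -
      have "(2 * r) ^ ?N * \<bar>\<eta> j x - \<eta> j y\<bar> = \<bar>(2 * r) ^ ?N * (\<eta> j x - \<eta> j y)\<bar>" using r by (simp add: abs_mult)
      also have "\<dots> = \<bar>(2 * r) ^ ?N * \<eta> j x - (2 * r) ^ ?N * \<eta> j y\<bar>" by (simp only: right_diff_distrib)
      finally show ?thesis using \<epsilon>1(2)[of j] \<epsilon>2(2)[of j] by linarith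
    qed
    then show "\<exists>N. \<forall>n\<ge>N. (2 * r) ^ ?N * \<bar>\<eta> n x - \<eta> n y\<bar> \<le> 4 * (K * E) + \<epsilon>1 n + \<epsilon>2 n" by blast
  qed
  then have "\<bar>e x - e y\<bar> \<le> 4 * (K * E) / (2 * r) ^ ?N" using r by (simp add: field_simps)
  also have "\<dots> = 8 * ?N * E * r * ((2 * r) powr (?N - ?N / p) / (2 * r) ^ ?N)" by (simp add: K_def)
  also have "(2 * r) powr (?N - ?N / p) / (2 * r) ^ ?N = (2 * r) powr (- (?N / p))"
    using r by (simp add: powr_diff powr_minus powr_realpow field_simps)
  also have "8 * ?N * E * r * (2 * r) powr (- (?N / p)) \<le> 8 * ?N * E * r * r powr (- (?N / p))"
    using r \<alpha> E0 by (intro mult_left_mono powr_mono2') auto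
  also have "\<dots> = 8 * ?N * r powr (1 - ?N / p) * E"
    using r by (simp add: powr_diff powr_minus field_simps)
  finally show ?thesis by (simp add: E_def r_def)
qed auto


section \<open>Sobolev functions with zero boundary values\<close>

text \<open>The infimum of the cones of slope \<open>L\<close> with vertices on the graph over
  \<open>S\<close> is the largest \<open>L\<close>-Lipschitz extension. It puts the data on the
  whole space, where they can be mollified.\<close>

lemma McShane_extension:
  fixes G :: "'a::metric_space \<Rightarrow> real"
  assumes lip: "L-lipschitz_on S G" and S: "S \<noteq> {}"
  shows "\<exists>H. L-lipschitz_on UNIV H \<and> (\<forall>x\<in>S. H x = G x)"
proof -
  have L0: "L \<ge> 0" using lip by (rule lipschitz_on_nonneg)
  define H where "H = (\<lambda>x. INF y\<in>S. G y + L * dist x y)"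
  have Gl: "G y \<ge> G z - L * dist y z" if "y \<in> S" "z \<in> S" for y z
    using lipschitz_onD[OF lip that] by (simp add: dist_real_def abs_le_iff)
  have bdd: "bdd_below ((\<lambda>y. G y + L * dist x y) ` S)" for x
  proof -
    obtain z where z: "z \<in> S" using S by blast
    have "G z - L * dist x z \<le> G y + L * dist x y" if "y \<in> S" for y
    proof -
      have "L * dist y z \<le> L * (dist x y + dist x z)"
        using L0 by (intro mult_left_mono) (metis add.commute dist_commute dist_triangle)
      then show ?thesis using Gl[OF that z] by (simp add: distrib_left)
    qed
    then show ?thesis by (rule bdd_belowI2)
  qed
  have le: "H x \<le> H z + L * dist x z" for x z
  proof -
    have "H x - L * dist x z \<le> (INF y\<in>S. G y + L * dist z y)"
    proof (rule cINF_greatest[OF S])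
      fix y assume y: "y \<in> S"
      have "H x \<le> G y + L * dist x y" unfolding H_def by (rule cINF_lower[OF bdd y])
      moreover have "L * dist x y \<le> L * (dist x z + dist z y)"
        using L0 by (intro mult_left_mono dist_triangle)
      ultimately show "H x - L * dist x z \<le> G y + L * dist z y" by (simp add: distrib_left)
    qed
    then show ?thesis by (simp add: H_def)
  qed
  have "L-lipschitz_on UNIV H"
  proof (rule lipschitz_onI)
    fix x y show "dist (H x) (H y) \<le> L * dist x y"
      using le[of x y] le[of y x] by (simp add: dist_real_def abs_le_iff dist_commute)
  qed (rule L0)
  moreover have "H x = G x" if x: "x \<in> S" for x
  proof (rule antisym)
    have "H x \<le> G x + L * dist x x" unfolding H_def by (rule cINF_lower[OF bdd x])
    then show "H x \<le> G x" by simp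
    show "G x \<le> H x" unfolding H_def
      by (rule cINF_greatest[OF S]) (use Gl[OF _ x] in \<open>force simp: dist_commute\<close>)
  qed
  ultimately show ?thesis by blast
qed

lemma Lp_imp_integrable:
  fixes f :: "'a::euclidean_space \<Rightarrow> 'b::euclidean_space"
  assumes f: "f \<in> borel_measurable (lebesgue_on \<Omega>)" "integrable (lebesgue_on \<Omega>) (\<lambda>x. norm (f x) powr p)"
    and \<Omega>: "\<Omega> \<in> lmeasurable" and p: "p \<ge> 1"
  shows "integrable (lebesgue_on \<Omega>) f"
proof (rule Bochner_Integration.integrable_bound)
  show "integrable (lebesgue_on \<Omega>) (\<lambda>x. 1 + norm (f x) powr p)"
    using f(2) integrable_lebesgue_on_bounded[of "\<lambda>_. 1::real" \<Omega> 1] \<Omega> by auto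
  have "t \<le> 1 + t powr p" if "t \<ge> 0" for t :: real
  proof (cases "t \<ge> 1")
    case True
    have "t powr 1 \<le> t powr p" using True p by (intro powr_mono) auto
    then show ?thesis using True by simp
  qed (use powr_ge_zero[of t p] in linarith)
  then show "AE x in lebesgue_on \<Omega>. norm (f x) \<le> norm (1 + norm (f x) powr p)" by simp
qed (rule f)

lemma Lp_sum:
  fixes f g :: "'a \<Rightarrow> 'b::euclidean_space"
  assumes f: "f \<in> borel_measurable M" "integrable M (\<lambda>x. norm (f x) powr p)"
    and g: "g \<in> borel_measurable M" "integrable M (\<lambda>x. norm (g x) powr p)" and p: "p \<ge> 0"
  shows "integrable M (\<lambda>x. norm (f x + g x) powr p)"
    and "(\<integral>x. norm (f x + g x) powr p \<partial>M) \<le> 2 powr p * ((\<integral>x. norm (f x) powr p \<partial>M) + (\<integral>x. norm (g x) powr p \<partial>M))"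
    and "integrable M (\<lambda>x. norm (f x - g x) powr p)"
    and "(\<integral>x. norm (f x - g x) powr p \<partial>M) \<le> 2 powr p * ((\<integral>x. norm (f x) powr p \<partial>M) + (\<integral>x. norm (g x) powr p \<partial>M))"
proof -
  have i: "integrable M (\<lambda>x. 2 powr p * (norm (f x) powr p + norm (g x) powr p))" using f g by auto
  have le: "norm (f x + g x) powr p \<le> 2 powr p * (norm (f x) powr p + norm (g x) powr p)"
    "norm (f x - g x) powr p \<le> 2 powr p * (norm (f x) powr p + norm (g x) powr p)" for x
    using p by (intro order_trans[OF powr_mono2 powr_add_le] norm_triangle_ineq norm_triangle_ineq4; simp)+
  show 1: "integrable M (\<lambda>x. norm (f x + g x) powr p)"
    by (rule Bochner_Integration.integrable_bound[OF i]) (use f g le in auto)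
  show 2: "integrable M (\<lambda>x. norm (f x - g x) powr p)"
    by (rule Bochner_Integration.integrable_bound[OF i]) (use f g le in auto)
  have e: "(\<integral>x. 2 powr p * (norm (f x) powr p + norm (g x) powr p) \<partial>M) =
      2 powr p * ((\<integral>x. norm (f x) powr p \<partial>M) + (\<integral>x. norm (g x) powr p \<partial>M))"
    using f g by simp
  show "(\<integral>x. norm (f x + g x) powr p \<partial>M) \<le> 2 powr p * ((\<integral>x. norm (f x) powr p \<partial>M) + (\<integral>x. norm (g x) powr p \<partial>M))"
    unfolding e[symmetric] by (rule integral_mono[OF 1 i le(1)])
  show "(\<integral>x. norm (f x - g x) powr p \<partial>M) \<le> 2 powr p * ((\<integral>x. norm (f x) powr p \<partial>M) + (\<integral>x. norm (g x) powr p \<partial>M))"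
    unfolding e[symmetric] by (rule integral_mono[OF 2 i le(2)])
qed

lemma grad_C1_0_Lp:
  fixes \<phi> :: "'a::euclidean_space \<Rightarrow> real"
  assumes \<phi>: "C1_0 \<Omega> \<phi>" and \<Omega>: "\<Omega> \<in> lmeasurable" and p: "p \<ge> 0"
  shows "grad \<phi> \<in> borel_measurable (lebesgue_on \<Omega>)" "integrable (lebesgue_on \<Omega>) (\<lambda>x. norm (grad \<phi> x) powr p)"
proof -
  show m: "grad \<phi> \<in> borel_measurable (lebesgue_on \<Omega>)"
    by (intro continuous_imp_measurable_on_sets_lebesgue continuous_on_subset[OF C1_0_D(2)[OF \<phi>]])
      (use \<Omega> in \<open>auto simp: fmeasurable_def\<close>)
  obtain c where c: "\<And>x. norm (grad \<phi> x) \<le> c" using C1_0_D(6)[OF \<phi>] by blast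
  show "integrable (lebesgue_on \<Omega>) (\<lambda>x. norm (grad \<phi> x) powr p)"
    by (rule integrable_lebesgue_on_bounded[OF _ \<Omega>, of _ "c powr p"]) (use m c p in \<open>auto intro!: powr_mono2\<close>)
qed

lemma Morrey_C1_0:
  fixes \<phi> :: "'a::euclidean_space \<Rightarrow> real"
  assumes \<Omega>: "open \<Omega>" "bounded \<Omega>" and p: "p \<ge> 2 * real DIM('a)" and \<phi>: "C1_0 \<Omega> \<phi>"
  shows "\<bar>\<phi> x - \<phi> y\<bar> \<le> 8 * DIM('a) * norm (x - y) powr (1 - DIM('a) / p) * (\<integral>x. norm (grad \<phi> x) powr p \<partial>lebesgue_on \<Omega>) powr (1/p)"
proof -
  have \<Omega>m: "\<Omega> \<in> lmeasurable" using \<Omega> by (simp add: lmeasurable_open)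
  have "p \<ge> 0" using p by (meson of_nat_0_le_iff mult_nonneg_nonneg order_trans zero_le_numeral)
  then show ?thesis
    by (intro Morrey_weak[OF \<Omega> p, of "\<lambda>_. \<phi>" \<phi> "grad \<phi>" "\<integral>x. norm (grad \<phi> x) powr p \<partial>lebesgue_on \<Omega>"]
        \<phi> grad_C1_0_Lp[OF \<phi> \<Omega>m] order_refl tendsto_const)
qed

text \<open>A point outside \<open>\<Omega>\<close> at controlled distance turns a Hoelder bound into a sup bound.\<close>

lemma sup_bound_from_Hoelder:
  fixes e :: "'a::euclidean_space \<Rightarrow> real"
  assumes \<Omega>: "\<Omega> \<subseteq> ball 0 R" and R: "R > 0" and z: "\<And>x. x \<notin> \<Omega> \<Longrightarrow> e x = 0"
    and h: "\<And>x y. \<bar>e x - e y\<bar> \<le> C * norm (x - y) powr \<alpha> * S" and C: "C \<ge> 0" "S \<ge> 0" "\<alpha> \<ge> 0"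
  shows "\<bar>e x\<bar> \<le> C * (2 * R) powr \<alpha> * S"
proof (cases "x \<in> \<Omega>")
  case True
  obtain b :: 'a where b: "b \<in> Basis" by (meson SOME_Basis)
  have "R *\<^sub>R b \<notin> \<Omega>" using \<Omega> b R by auto
  then have "\<bar>e x\<bar> = \<bar>e x - e (R *\<^sub>R b)\<bar>" using z by simp
  also have "\<dots> \<le> C * norm (x - R *\<^sub>R b) powr \<alpha> * S" by (rule h)
  also have "\<dots> \<le> C * (2 * R) powr \<alpha> * S"
  proof (intro mult_right_mono mult_left_mono powr_mono2)
    have "norm x \<le> R" using True \<Omega> by (auto simp: subset_iff less_imp_le)
    then show "norm (x - R *\<^sub>R b) \<le> 2 * R" using norm_triangle_ineq4[of x "R *\<^sub>R b"] b R by simp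
  qed (use C in auto)
  finally show ?thesis .
qed (use z C in auto)

text \<open>Differences of the approximants are again test functions, so Morrey's inequality bounds
  their supremum by the p-norm of the difference of the gradients. Sobolev convergence thus becomes
  uniform on the whole space, and the zero values outside \<Omega> persist in the limit.\<close>

lemma W1p0_continuous_representative:
  fixes \<Omega> :: "'a::euclidean_space set" and \<phi> :: "nat \<Rightarrow> 'a \<Rightarrow> real"
  assumes \<Omega>: "open \<Omega>" "bounded \<Omega>" and p: "p \<ge> 2 * real DIM('a)" "p > 1"
    and \<phi>: "\<And>n. C1_0 \<Omega> (\<phi> n)"
    and w: "w \<in> borel_measurable (lebesgue_on \<Omega>)" "integrable (lebesgue_on \<Omega>) (\<lambda>x. norm (w x) powr p)"
    and Dw: "Dw \<in> borel_measurable (lebesgue_on \<Omega>)" "integrable (lebesgue_on \<Omega>) (\<lambda>x. norm (Dw x) powr p)"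
    and c1: "(\<lambda>n. \<integral>x. \<bar>\<phi> n x - w x\<bar> powr p \<partial>lebesgue_on \<Omega>) \<longlonglongrightarrow> 0"
    and c2: "(\<lambda>n. \<integral>x. norm (grad (\<phi> n) x - Dw x) powr p \<partial>lebesgue_on \<Omega>) \<longlonglongrightarrow> 0"
  shows "\<exists>W. continuous_on UNIV W \<and> (\<forall>x. x \<notin> \<Omega> \<longrightarrow> W x = 0) \<and> uniform_limit UNIV \<phi> W sequentially \<and>
      (AE x in lebesgue_on \<Omega>. W x = w x)"
proof -
  let ?M = "lebesgue_on \<Omega>"
  have \<Omega>m: "\<Omega> \<in> lmeasurable" using \<Omega> by (simp add: lmeasurable_open)
  obtain R where R: "\<Omega> \<subseteq> ball 0 R" "R > 0" using bounded_subset_ballD[OF \<Omega>(2), of 0] by auto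
  have p0: "p \<ge> 0" using p by simp
  have \<alpha>: "1 - DIM('a) / p \<ge> 0" using p by (simp add: field_simps)
  define K where "K = 8 * DIM('a) * (2 * R) powr (1 - DIM('a) / p)"
  have K: "K > 0" using R by (simp add: K_def)
  define I where "I = (\<lambda>n. \<integral>x. norm (grad (\<phi> n) x - Dw x) powr p \<partial>?M)"
  have I0: "I n \<ge> 0" for n unfolding I_def by (rule integral_nonneg_AE) auto
  note G = grad_C1_0_Lp[OF \<phi> \<Omega>m p0]
  have bound: "\<bar>\<phi> n x - \<phi> m x\<bar> \<le> K * (2 powr p * (I n + I m)) powr (1/p)" for n m x
  proof -
    let ?d = "\<lambda>x. \<phi> n x - \<phi> m x"
    have d: "C1_0 \<Omega> ?d" by (rule C1_0_diff(1)[OF \<phi> \<phi> \<Omega>(1)])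
    have gd: "grad ?d x = (grad (\<phi> n) x - Dw x) - (grad (\<phi> m) x - Dw x)" for x
      using C1_0_diff(2)[OF \<phi> \<phi> \<Omega>(1)] by simp
    have le: "(\<integral>x. norm (grad ?d x) powr p \<partial>?M) \<le> 2 powr p * (I n + I m)"
      unfolding gd I_def
      by (rule Lp_sum(4)) (use Lp_sum(3)[OF G Dw p0] G Dw p0 in auto)
    have "\<bar>?d x\<bar> \<le> 8 * DIM('a) * (2 * R) powr (1 - DIM('a) / p) * (\<integral>x. norm (grad ?d x) powr p \<partial>?M) powr (1/p)"
      by (rule sup_bound_from_Hoelder[OF R(1,2) _ Morrey_C1_0[OF \<Omega> p(1) d]])
        (use C1_0_D(4)[OF d] \<alpha> in auto)
    also have "\<dots> \<le> K * (2 powr p * (I n + I m)) powr (1/p)"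
      unfolding K_def[symmetric] using K p0 le by (intro mult_left_mono powr_mono2) (auto intro!: integral_nonneg_AE)
    finally show ?thesis .
  qed
  have "uniformly_Cauchy_on UNIV \<phi>"
    unfolding uniformly_Cauchy_on_def
  proof (intro allI impI)
    fix e :: real assume e: "e > 0"
    \<comment> \<open>Solves K (2^p 2 \<delta>)^(1/p) = e/2, the bound for two indices whose
      gradient errors are below \<delta>.\<close>
    define \<delta> where "\<delta> = (e / (2 * K)) powr p / (2 * 2 powr p)"
    have \<delta>: "\<delta> > 0" using e K by (simp add: \<delta>_def)
    obtain N where N: "\<And>n. n \<ge> N \<Longrightarrow> I n < \<delta>"
      using order_tendstoD(2)[OF c2 \<delta>] by (auto simp: eventually_sequentially I_def)
    show "\<exists>M. \<forall>x\<in>UNIV. \<forall>m\<ge>M. \<forall>n\<ge>M. dist (\<phi> m x) (\<phi> n x) < e"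
    proof (intro exI[of _ N] ballI allI impI)
      fix x m n assume mn: "m \<ge> N" "n \<ge> N"
      have "2 powr p * (I m + I n) \<le> 2 powr p * (2 * \<delta>)"
        using N[OF mn(1)] N[OF mn(2)] by (intro mult_left_mono) auto
      also have "\<dots> = (e / (2 * K)) powr p" by (simp add: \<delta>_def)
      finally have "(2 powr p * (I m + I n)) powr (1/p) \<le> ((e / (2 * K)) powr p) powr (1/p)"
        using I0 p by (intro powr_mono2) auto
      also have "\<dots> = e / (2 * K)" using e K p by (simp add: powr_powr)
      finally have "K * (2 powr p * (I m + I n)) powr (1/p) \<le> K * (e / (2 * K))" using K by (intro mult_left_mono) auto
      also have "\<dots> = e / 2" using K by simp
      finally show "dist (\<phi> m x) (\<phi> n x) < e" using bound[of m x n] e by (simp add: dist_real_def)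
    qed
  qed
  then have "uniformly_convergent_on UNIV \<phi>" by (rule Cauchy_uniformly_convergent)
  then obtain W where W: "uniform_limit UNIV \<phi> W sequentially" by (auto simp: uniformly_convergent_on_def)
  have Wp: "(\<lambda>n. \<phi> n x) \<longlonglongrightarrow> W x" for x by (rule tendsto_uniform_limitI[OF W]) simp
  have "continuous_on UNIV W"
    by (rule uniform_limit_theorem[OF _ W]) (use C1_0_D(3)[OF \<phi>] in auto)
  moreover have "W x = 0" if "x \<notin> \<Omega>" for x
    using LIMSEQ_unique[OF Wp[of x]] C1_0_D(4)[OF \<phi> that] by auto
  moreover have "AE x in ?M. W x = w x"
  proof -
    have i: "integrable ?M (\<lambda>x. \<bar>\<phi> n x - w x\<bar> powr p)" for n
    proof -
      have "integrable ?M (\<lambda>x. norm (\<phi> n x) powr p)"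
      proof -
        obtain c where c: "\<And>x. \<bar>\<phi> n x\<bar> \<le> c" using C1_0_D(7)[OF \<phi>] by blast
        show ?thesis
          by (rule integrable_lebesgue_on_bounded[OF _ \<Omega>m, of _ "c powr p"])
            (use C1_0_integrable[OF \<phi> \<Omega>m] c p0 in \<open>auto intro!: powr_mono2\<close>)
      qed
      from Lp_sum(3)[OF C1_0_integrable(1)[OF \<phi> \<Omega>m] this w p0] show ?thesis by simp
    qed
    have "\<exists>r::nat\<Rightarrow>nat. strict_mono r \<and> (AE x in ?M. (\<lambda>n. \<bar>\<phi> (r n) x - w x\<bar> powr p) \<longlonglongrightarrow> 0)"
      by (rule tendsto_L1_AE_subseq) (use i c1 in auto)
    then obtain r :: "nat \<Rightarrow> nat" where r: "strict_mono r" "AE x in ?M. (\<lambda>n. \<bar>\<phi> (r n) x - w x\<bar> powr p) \<longlonglongrightarrow> 0" by blast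
    from r(2) show ?thesis
    proof eventually_elim
      case (elim x)
      have "(\<lambda>n. (\<bar>\<phi> (r n) x - w x\<bar> powr p) powr (1/p)) \<longlonglongrightarrow> 0 powr (1/p)"
        by (rule tendsto_powr'[OF elim tendsto_const]) (use p in auto)
      then have "(\<lambda>n. \<bar>\<phi> (r n) x - w x\<bar>) \<longlonglongrightarrow> 0" using p by (simp add: powr_powr)
      then have "(\<lambda>n. \<phi> (r n) x) \<longlonglongrightarrow> w x" by (simp add: tendsto_rabs_zero_iff LIM_zero_iff)
      moreover have "(\<lambda>n. \<phi> (r n) x) \<longlonglongrightarrow> W x"
        using LIMSEQ_subseq_LIMSEQ[OF Wp r(1)] by (simp add: o_def)
      ultimately show ?case by (rule LIMSEQ_unique[OF _ _, symmetric])
    qed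
  qed
  ultimately show ?thesis using W by blast
qed


section \<open>Weak solutions\<close>

text \<open>Since \<open>G n\<close> tends to \<open>H\<close> uniformly, integration by parts
  identifies the limit of the gradients against test functions as the weak gradient
  \<open>DG\<close> of \<open>H\<close>. Their common bound \<open>L\<close> lets
  \<open>weak_limit\<close> extend this, component by component, to integrable fields
  \<open>B\<close>.\<close>

lemma weak_gradient_limit:
  fixes \<Omega> :: "'a::euclidean_space set" and G :: "nat \<Rightarrow> 'a \<Rightarrow> real"
  assumes \<Omega>: "open \<Omega>" "bounded \<Omega>"
    and G: "\<And>n. Ck_on 1 UNIV (G n)"
    and GH: "\<And>n x. x \<in> \<Omega> \<Longrightarrow> \<bar>G n x - H x\<bar> \<le> 1 / Suc n" and L: "\<And>n x. x \<in> \<Omega> \<Longrightarrow> norm (grad (G n) x) \<le> L"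
    and H: "integrable (lebesgue_on \<Omega>) H"
    and DG: "integrable (lebesgue_on \<Omega>) DG"
    and weak: "\<And>\<psi>. C1_0 \<Omega> \<psi> \<Longrightarrow> (\<integral>x. H x *\<^sub>R grad \<psi> x \<partial>lebesgue_on \<Omega>) = - (\<integral>x. \<psi> x *\<^sub>R DG x \<partial>lebesgue_on \<Omega>)"
    and B: "integrable (lebesgue_on \<Omega>) B"
  shows "integrable (lebesgue_on \<Omega>) (\<lambda>x. B x \<bullet> DG x)"
    and "integrable (lebesgue_on \<Omega>) (\<lambda>x. B x \<bullet> grad (G n) x)"
    and "(\<lambda>n. \<integral>x. B x \<bullet> grad (G n) x \<partial>lebesgue_on \<Omega>) \<longlonglongrightarrow> (\<integral>x. B x \<bullet> DG x \<partial>lebesgue_on \<Omega>)"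
proof -
  let ?M = "lebesgue_on \<Omega>"
  have \<Omega>m: "\<Omega> \<in> lmeasurable" using \<Omega> by (simp add: lmeasurable_open)
  have \<Omega>s: "\<Omega> \<in> sets lebesgue" using \<Omega> by auto
  have mg: "grad (G n) \<in> borel_measurable ?M" for n
    by (intro continuous_imp_measurable_on_sets_lebesgue[OF _ \<Omega>s] continuous_on_subset[OF Ck_on_1_D(2)[OF G open_UNIV]]) auto
  have mG: "G n \<in> borel_measurable ?M" for n
    by (intro continuous_imp_measurable_on_sets_lebesgue[OF _ \<Omega>s] continuous_on_subset[OF Ck_on_1_D(3)[OF G open_UNIV]]) auto
  have mH: "H \<in> borel_measurable ?M" using H by auto
  have comp: "AE x in ?M. \<bar>DG x \<bullet> b\<bar> \<le> L" "integrable ?M B' \<Longrightarrow>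
      (\<lambda>n. \<integral>x. B' x * (grad (G n) x \<bullet> b) \<partial>?M) \<longlonglongrightarrow> (\<integral>x. B' x * (DG x \<bullet> b) \<partial>?M)"
    if b: "b \<in> Basis" for b and B' :: "'a \<Rightarrow> real"
  proof -
    have Lb: "\<bar>grad (G n) x \<bullet> b\<bar> \<le> L" if "x \<in> \<Omega>" for n x
      using Basis_le_norm[OF b, of "grad (G n) x"] L[OF that, of n] by linarith
    have mgb: "(\<lambda>x. grad (G n) x \<bullet> b) \<in> borel_measurable ?M" for n using mg by auto
    have dgb: "integrable ?M (\<lambda>x. DG x \<bullet> b)" using DG by auto
    have conv: "(\<lambda>n. \<integral>x. \<psi> x * (grad (G n) x \<bullet> b) \<partial>?M) \<longlonglongrightarrow> (\<integral>x. \<psi> x * (DG x \<bullet> b) \<partial>?M)" if \<psi>: "C1_0 \<Omega> \<psi>" for \<psi>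
    proof -
      obtain c where c: "\<And>x. norm (grad \<psi> x) \<le> c" using C1_0_D(6)[OF \<psi>] by blast
      obtain c' where c': "\<And>x. \<bar>\<psi> x\<bar> \<le> c'" using C1_0_D(7)[OF \<psi>] by blast
      have c0: "c \<ge> 0" using c[of 0] norm_ge_zero order_trans by blast
      have m\<psi>: "grad \<psi> \<in> borel_measurable ?M" using grad_C1_0_Lp(1)[OF \<psi> \<Omega>m, of 0] by simp
      have m\<psi>': "\<psi> \<in> borel_measurable ?M" using C1_0_integrable[OF \<psi> \<Omega>m] by simp
      have cb: "\<bar>grad \<psi> x \<bullet> b\<bar> \<le> c" for x using Basis_le_norm[OF b, of "grad \<psi> x"] c[of x] by linarith
      have 1: "(\<integral>x. \<psi> x * (grad (G n) x \<bullet> b) \<partial>?M) = - (\<integral>x. G n x * (grad \<psi> x \<bullet> b) \<partial>?M)" for n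
        using integration_by_parts_C1_0(3)[OF \<Omega>(1) \<Omega>m Ck_on_mono[OF G] \<psi>, of n b] by simp
      have "(\<lambda>n. \<integral>x. G n x * (grad \<psi> x \<bullet> b) \<partial>?M) \<longlonglongrightarrow> (\<integral>x. H x * (grad \<psi> x \<bullet> b) \<partial>?M)"
      proof (rule integral_dominated_convergence[where w="\<lambda>x. (\<bar>H x\<bar> + 1) * c"])
        show "integrable ?M (\<lambda>x. (\<bar>H x\<bar> + 1) * c)"
          using H integrable_lebesgue_on_bounded[of "\<lambda>_. 1::real" \<Omega> 1] \<Omega>m by auto
        show "AE x in ?M. (\<lambda>n. G n x * (grad \<psi> x \<bullet> b)) \<longlonglongrightarrow> H x * (grad \<psi> x \<bullet> b)"
        proof (rule AE_I2, rule tendsto_mult_right)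
          fix x assume "x \<in> space ?M"
          then have x: "x \<in> \<Omega>" by simp
          have "(\<lambda>n. G n x - H x) \<longlonglongrightarrow> 0"
            by (rule Lim_null_comparison[OF _ LIMSEQ_inverse_real_of_nat])
              (use GH[OF x] in \<open>auto simp: inverse_eq_divide\<close>)
          then show "(\<lambda>n. G n x) \<longlonglongrightarrow> H x" by (simp add: LIM_zero_iff)
        qed
        show "AE x in ?M. norm (G n x * (grad \<psi> x \<bullet> b)) \<le> (\<bar>H x\<bar> + 1) * c" for n
        proof (rule AE_I2)
          fix x assume "x \<in> space ?M"
          then have "\<bar>G n x - H x\<bar> \<le> 1 / Suc n" using GH by simp
          moreover have "1 / real (Suc n) \<le> 1" by simp
          ultimately have "\<bar>G n x\<bar> \<le> \<bar>H x\<bar> + 1" by linarith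
          then show "norm (G n x * (grad \<psi> x \<bullet> b)) \<le> (\<bar>H x\<bar> + 1) * c"
            unfolding real_norm_def abs_mult using cb[of x] c0 by (intro mult_mono) auto
        qed
      qed (use mG mH m\<psi> in auto)
      then have "(\<lambda>n. \<integral>x. \<psi> x * (grad (G n) x \<bullet> b) \<partial>?M) \<longlonglongrightarrow> - (\<integral>x. H x * (grad \<psi> x \<bullet> b) \<partial>?M)"
        unfolding 1 by (rule tendsto_minus)
      moreover have "- (\<integral>x. H x * (grad \<psi> x \<bullet> b) \<partial>?M) = (\<integral>x. \<psi> x * (DG x \<bullet> b) \<partial>?M)"
      proof -
        have iH: "integrable ?M (\<lambda>x. H x *\<^sub>R grad \<psi> x)"
        proof (rule Bochner_Integration.integrable_bound)
          show "integrable ?M (\<lambda>x. c * H x)" using H by auto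
          show "AE x in ?M. norm (H x *\<^sub>R grad \<psi> x) \<le> norm (c * H x)"
            using c c0 by (auto simp: abs_mult mult.commute[of "\<bar>H _\<bar>"] intro!: mult_right_mono)
        qed (use mH m\<psi> in auto)
        have iD: "integrable ?M (\<lambda>x. \<psi> x *\<^sub>R DG x)"
          by (rule integrable_mult_bounded[OF DG m\<psi>', of c']) (use c' in auto)
        have "(\<integral>x. H x * (grad \<psi> x \<bullet> b) \<partial>?M) = (\<integral>x. (H x *\<^sub>R grad \<psi> x) \<bullet> b \<partial>?M)" by simp
        also have "\<dots> = (\<integral>x. H x *\<^sub>R grad \<psi> x \<partial>?M) \<bullet> b" by (rule integral_inner_left) (rule iH)
        also have "\<dots> = - ((\<integral>x. \<psi> x *\<^sub>R DG x \<partial>?M) \<bullet> b)" by (simp add: weak[OF \<psi>])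
        also have "(\<integral>x. \<psi> x *\<^sub>R DG x \<partial>?M) \<bullet> b = (\<integral>x. (\<psi> x *\<^sub>R DG x) \<bullet> b \<partial>?M)" by (rule integral_inner_left[symmetric]) (rule iD)
        finally show ?thesis by simp
      qed
      ultimately show ?thesis by simp
    qed
    show "AE x in ?M. \<bar>DG x \<bullet> b\<bar> \<le> L"
      by (rule weak_limit(1)[OF \<Omega> mgb Lb dgb conv])
    show "(\<lambda>n. \<integral>x. B' x * (grad (G n) x \<bullet> b) \<partial>?M) \<longlonglongrightarrow> (\<integral>x. B' x * (DG x \<bullet> b) \<partial>?M)" if "integrable ?M B'"
      by (rule weak_limit(2)[OF \<Omega> mgb Lb dgb conv that])
  qed
  have i1: "integrable ?M (\<lambda>x. (B x \<bullet> b) * (DG x \<bullet> b))" if "b \<in> Basis" for b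
    using integrable_mult_bounded[of ?M "\<lambda>x. B x \<bullet> b" "\<lambda>x. DG x \<bullet> b" L] B DG comp(1)[OF that] by (auto simp: mult.commute)
  have i2: "integrable ?M (\<lambda>x. (B x \<bullet> b) * (grad (G n) x \<bullet> b))" if b: "b \<in> Basis" for b n
  proof -
    have "AE x in ?M. \<bar>grad (G n) x \<bullet> b\<bar> \<le> L"
    proof (rule AE_I2)
      fix x assume "x \<in> space ?M"
      then show "\<bar>grad (G n) x \<bullet> b\<bar> \<le> L" using Basis_le_norm[OF b, of "grad (G n) x"] L[of x n] by simp
    qed
    then show ?thesis
      using integrable_mult_bounded[of ?M "\<lambda>x. B x \<bullet> b" "\<lambda>x. grad (G n) x \<bullet> b" L] B mg by (auto simp: mult.commute)
  qed
  have e1: "(\<lambda>x. B x \<bullet> DG x) = (\<lambda>x. \<Sum>b\<in>Basis. (B x \<bullet> b) * (DG x \<bullet> b))"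
    and e2: "(\<lambda>x. B x \<bullet> grad (G n) x) = (\<lambda>x. \<Sum>b\<in>Basis. (B x \<bullet> b) * (grad (G n) x \<bullet> b))" for n
    by (rule ext, rule euclidean_inner)+
  show "integrable ?M (\<lambda>x. B x \<bullet> DG x)" by (subst e1) (intro Bochner_Integration.integrable_sum i1)
  show "integrable ?M (\<lambda>x. B x \<bullet> grad (G n) x)" by (subst e2) (intro Bochner_Integration.integrable_sum i2)
  have "(\<integral>x. B x \<bullet> DG x \<partial>?M) = (\<Sum>b\<in>Basis. \<integral>x. (B x \<bullet> b) * (DG x \<bullet> b) \<partial>?M)"
    by (subst e1) (rule Bochner_Integration.integral_sum[OF i1])
  moreover have "(\<integral>x. B x \<bullet> grad (G n) x \<partial>?M) = (\<Sum>b\<in>Basis. \<integral>x. (B x \<bullet> b) * (grad (G n) x \<bullet> b) \<partial>?M)" for n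
    by (subst e2) (rule Bochner_Integration.integral_sum[OF i2])
  moreover have "(\<lambda>n. \<Sum>b\<in>Basis. \<integral>x. (B x \<bullet> b) * (grad (G n) x \<bullet> b) \<partial>?M) \<longlonglongrightarrow> (\<Sum>b\<in>Basis. \<integral>x. (B x \<bullet> b) * (DG x \<bullet> b) \<partial>?M)"
    by (intro tendsto_sum comp(2)) (use B in auto)
  ultimately show "(\<lambda>n. \<integral>x. B x \<bullet> grad (G n) x \<partial>?M) \<longlonglongrightarrow> (\<integral>x. B x \<bullet> DG x \<partial>?M)" by simp
qed

text \<open>\<open>U\<close> is the continuous representative of a weak solution. The gradients of the approximations \<open>f n\<close>
  converge only weakly in \<open>f_weak\<close>, because the boundary datum enters through mollifications of a Lipschitz
  extension whose gradients have no strong limit at hand.\<close>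

locale weak_sol =
  fixes \<Omega> :: "'a::euclidean_space set" and p :: real and lam g U :: "'a \<Rightarrow> real" and Du :: "'a \<Rightarrow> 'a"
    and f :: "nat \<Rightarrow> 'a \<Rightarrow> real" and \<Lambda> :: real
  assumes \<Omega>: "open \<Omega>" "bounded \<Omega>" "\<Omega> \<noteq> {}"
    and p: "p \<ge> 2 * real DIM('a) + 3"
    and lam_meas: "lam \<in> borel_measurable (lebesgue_on \<Omega>)"
    and lam_bd: "\<And>x. x \<in> \<Omega> \<Longrightarrow> 0 < lam x" "\<And>x. x \<in> \<Omega> \<Longrightarrow> lam x \<le> \<Lambda>"
    and U_cont: "continuous_on (closure \<Omega>) U" and U_bd: "\<And>x. x \<in> frontier \<Omega> \<Longrightarrow> U x = g x"
    and f_C1: "\<And>n. Ck_on 1 UNIV (f n)" and f_lim: "uniform_limit (closure \<Omega>) f U sequentially"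
    and Du: "Du \<in> borel_measurable (lebesgue_on \<Omega>)" "integrable (lebesgue_on \<Omega>) (\<lambda>x. norm (Du x) powr p)"
    and f_bound: "\<exists>B. \<forall>n. integrable (lebesgue_on \<Omega>) (\<lambda>x. norm (grad (f n) x) powr p) \<and>
        (\<integral>x. norm (grad (f n) x) powr p \<partial>lebesgue_on \<Omega>) \<le> B"
    and f_weak: "\<And>\<theta>n \<theta> \<psi> c. (\<And>n. \<theta>n n \<in> borel_measurable (lebesgue_on \<Omega>)) \<Longrightarrow> \<theta> \<in> borel_measurable (lebesgue_on \<Omega>) \<Longrightarrow>
        (\<And>n x. x \<in> \<Omega> \<Longrightarrow> \<bar>\<theta>n n x\<bar> \<le> c) \<Longrightarrow> (\<And>x. x \<in> \<Omega> \<Longrightarrow> (\<lambda>n. \<theta>n n x) \<longlonglongrightarrow> \<theta> x) \<Longrightarrow>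
        \<psi> \<in> borel_measurable (lebesgue_on \<Omega>) \<Longrightarrow> integrable (lebesgue_on \<Omega>) (\<lambda>x. norm (\<psi> x) powr (p / (p - 1))) \<Longrightarrow>
        (\<lambda>n. \<integral>x. \<theta>n n x * (\<psi> x \<bullet> grad (f n) x) \<partial>lebesgue_on \<Omega>) \<longlonglongrightarrow> (\<integral>x. \<theta> x * (\<psi> x \<bullet> Du x) \<partial>lebesgue_on \<Omega>)"
    and equation: "\<And>\<phi>. C1_0 \<Omega> \<phi> \<Longrightarrow>
        (\<integral>x. (norm (Du x) powr (p - 2) *\<^sub>R Du x) \<bullet> grad \<phi> x \<partial>lebesgue_on \<Omega>)
        = - (\<integral>x. lam x * indicator {y. U y > 0} x * \<phi> x \<partial>lebesgue_on \<Omega>)"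

lemma Hoelder_vector:
  fixes \<psi> D :: "'a \<Rightarrow> 'b::euclidean_space" and \<theta> :: "'a \<Rightarrow> real"
  assumes p: "p > 1" and \<psi>: "\<psi> \<in> borel_measurable M" "integrable M (\<lambda>x. norm (\<psi> x) powr (p / (p - 1)))"
    and D: "D \<in> borel_measurable M" "integrable M (\<lambda>x. norm (D x) powr p)"
    and \<theta>: "\<theta> \<in> borel_measurable M" "AE x in M. \<bar>\<theta> x\<bar> \<le> c" and c: "c \<ge> 0"
  shows "integrable M (\<lambda>x. \<theta> x * (\<psi> x \<bullet> D x))"
    and "\<bar>\<integral>x. \<theta> x * (\<psi> x \<bullet> D x) \<partial>M\<bar> \<le> c * ((\<integral>x. norm (D x) powr p \<partial>M) powr (1/p) *
      (\<integral>x. norm (\<psi> x) powr (p / (p - 1)) \<partial>M) powr ((p - 1) / p))"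
proof -
  define q where "q = p / (p - 1)"
  have q: "q > 1" "1/p + 1/q = 1" "1/q = (p - 1) / p" using p by (auto simp: q_def field_simps)
  note H = Hoelder_inequality[OF p q(1,2), of "\<lambda>x. norm (D x)" M "\<lambda>x. norm (\<psi> x)"]
  have H1: "integrable M (\<lambda>x. norm (D x) * norm (\<psi> x))"
    by (rule H(1)) (use \<psi> D in \<open>auto simp: q_def\<close>)
  have H2: "(\<integral>x. norm (D x) * norm (\<psi> x) \<partial>M) \<le> (\<integral>x. norm (D x) powr p \<partial>M) powr (1/p) *
      (\<integral>x. norm (\<psi> x) powr (p / (p - 1)) \<partial>M) powr ((p - 1) / p)"
    using H(2) \<psi> D q(3) by (simp add: q_def)
  have le: "AE x in M. \<bar>\<theta> x * (\<psi> x \<bullet> D x)\<bar> \<le> c * (norm (D x) * norm (\<psi> x))"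
    using \<theta>(2)
  proof eventually_elim
    case (elim x)
    have "\<bar>\<psi> x \<bullet> D x\<bar> \<le> norm (D x) * norm (\<psi> x)" using Cauchy_Schwarz_ineq2[of "\<psi> x" "D x"] by (simp add: mult.commute)
    then show ?case unfolding abs_mult using elim c by (intro mult_mono) auto
  qed
  show i: "integrable M (\<lambda>x. \<theta> x * (\<psi> x \<bullet> D x))"
    by (rule Bochner_Integration.integrable_bound[of _ "\<lambda>x. c * (norm (D x) * norm (\<psi> x))"])
      (use H1 le \<psi> D \<theta> in \<open>auto elim!: eventually_mono intro: order_trans[OF _ abs_ge_self]\<close>)
  have "\<bar>\<integral>x. \<theta> x * (\<psi> x \<bullet> D x) \<partial>M\<bar> \<le> (\<integral>x. \<bar>\<theta> x * (\<psi> x \<bullet> D x)\<bar> \<partial>M)" by (rule integral_abs_bound)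
  also have "\<dots> \<le> (\<integral>x. c * (norm (D x) * norm (\<psi> x)) \<partial>M)"
    by (rule integral_mono_AE) (use i H1 le in auto)
  also have "\<dots> = c * (\<integral>x. norm (D x) * norm (\<psi> x) \<partial>M)" by simp
  also have "\<dots> \<le> c * ((\<integral>x. norm (D x) powr p \<partial>M) powr (1/p) *
      (\<integral>x. norm (\<psi> x) powr (p / (p - 1)) \<partial>M) powr ((p - 1) / p))" by (intro mult_left_mono H2 c)
  finally show "\<bar>\<integral>x. \<theta> x * (\<psi> x \<bullet> D x) \<partial>M\<bar> \<le> c * ((\<integral>x. norm (D x) powr p \<partial>M) powr (1/p) *
      (\<integral>x. norm (\<psi> x) powr (p / (p - 1)) \<partial>M) powr ((p - 1) / p))" .
qed

text \<open>The solution is a function \<open>W\<close> with zero boundary values plus the datum,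
  and the approximants are \<open>\<phi> n + G n\<close> accordingly: the first summand converges in
  the Sobolev norm, the second, a mollification of the datum, uniformly and with gradients
  converging weakly.\<close>

lemma weak_solution_weak_sol:
  fixes \<Omega> :: "'a::euclidean_space set"
  assumes \<Omega>: "open \<Omega>" "bounded \<Omega>" "\<Omega> \<noteq> {}" and p: "p \<ge> 2 * real DIM('a) + 3"
    and lam: "lam \<in> borel_measurable (lebesgue_on \<Omega>)"
      "\<And>x. x \<in> \<Omega> \<Longrightarrow> 0 < lam x" "\<And>x. x \<in> \<Omega> \<Longrightarrow> lam x \<le> \<Lambda>"
    and u: "weak_solution p \<Omega> lam g u"
  shows "\<exists>U Du f. weak_sol \<Omega> p lam g U Du f \<Lambda> \<and> (AE x in lebesgue_on \<Omega>. U x = u x)"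
proof -
  let ?M = "lebesgue_on \<Omega>"
  have \<Omega>m: "\<Omega> \<in> lmeasurable" using \<Omega> by (simp add: lmeasurable_open)
  have \<Omega>s: "\<Omega> \<in> sets lebesgue" using \<Omega> by auto
  have N1: "real DIM('a) \<ge> 1" by (simp add: Suc_leI)
  have p': "p \<ge> 2 * real DIM('a)" "p > 1" "p \<ge> 0" "p \<ge> 1" using p N1 by linarith+
  obtain Du where Du: "in_W1p p \<Omega> u Du" and
    eq: "\<And>\<phi>. C1_0 \<Omega> \<phi> \<Longrightarrow> (\<integral>x. (norm (Du x) powr (p - 2) *\<^sub>R Du x) \<bullet> grad \<phi> x \<partial>?M)
           = - (\<integral>x. lam x * indicator {y. u y > 0} x * \<phi> x \<partial>?M)" and bv: "has_boundary_value p \<Omega> u g"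
    using u unfolding weak_solution_def by blast
  obtain G0 L where G0: "L-lipschitz_on (closure \<Omega>) G0" "\<And>x. x \<in> frontier \<Omega> \<Longrightarrow> G0 x = g x"
    and w0: "in_W1p0 p \<Omega> (\<lambda>x. u x - G0 x)"
    using bv unfolding has_boundary_value_def by blast
  obtain Dw \<phi> where Dw: "in_W1p p \<Omega> (\<lambda>x. u x - G0 x) Dw" and \<phi>: "\<And>n::nat. C1_0 \<Omega> (\<phi> n)"
    and c1: "(\<lambda>n. \<integral>x. \<bar>\<phi> n x - (u x - G0 x)\<bar> powr p \<partial>?M) \<longlonglongrightarrow> 0"
    and c2: "(\<lambda>n. \<integral>x. norm (grad (\<phi> n) x - Dw x) powr p \<partial>?M) \<longlonglongrightarrow> 0"
    using w0 unfolding in_W1p0_def by blast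
  have clne: "closure \<Omega> \<noteq> {}" using \<Omega> by auto
  obtain H where H: "L-lipschitz_on UNIV H" "\<And>x. x \<in> closure \<Omega> \<Longrightarrow> H x = G0 x"
    using McShane_extension[OF G0(1) clne] by blast
  have L0: "L \<ge> 0" using H(1) by (rule lipschitz_on_nonneg)
  have cH: "continuous_on UNIV H" using H(1) by (rule lipschitz_on_continuous_on)
  have H\<Omega>: "H x = G0 x" if "x \<in> \<Omega>" for x using H(2) that closure_subset by blast
  have "\<exists>F. Ck_on 1 UNIV F \<and> (\<forall>x\<in>closure \<Omega>. \<bar>F x - H x\<bar> \<le> 1 / real (Suc n) \<and> norm (grad F x) \<le> L)" for n
    by (rule lipschitz_smooth_approx[OF H(1)]) (use \<Omega> in auto)
  then obtain G where G: "\<And>n. Ck_on 1 UNIV (G n)" "\<And>n x. x \<in> closure \<Omega> \<Longrightarrow> \<bar>G n x - H x\<bar> \<le> 1 / real (Suc n)"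
     "\<And>n x. x \<in> closure \<Omega> \<Longrightarrow> norm (grad (G n) x) \<le> L" by metis
  have G\<Omega>: "\<And>n x. x \<in> \<Omega> \<Longrightarrow> \<bar>G n x - H x\<bar> \<le> 1 / real (Suc n)" "\<And>n x. x \<in> \<Omega> \<Longrightarrow> norm (grad (G n) x) \<le> L"
    using G closure_subset by blast+
  have Lu: "u \<in> borel_measurable ?M" "integrable ?M (\<lambda>x. norm (u x) powr p)"
    "Du \<in> borel_measurable ?M" "integrable ?M (\<lambda>x. norm (Du x) powr p)"
    using Du by (auto simp: in_W1p_def in_Lp_def)
  have Lw: "(\<lambda>x. u x - G0 x) \<in> borel_measurable ?M" "integrable ?M (\<lambda>x. norm (u x - G0 x) powr p)"
    "Dw \<in> borel_measurable ?M" "integrable ?M (\<lambda>x. norm (Dw x) powr p)"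
    using Dw by (auto simp: in_W1p_def in_Lp_def)
  note iu = Lp_imp_integrable[OF Lu(1,2) \<Omega>m p'(4)] Lp_imp_integrable[OF Lu(3,4) \<Omega>m p'(4)]
    Lp_imp_integrable[OF Lw(1,2) \<Omega>m p'(4)] Lp_imp_integrable[OF Lw(3,4) \<Omega>m p'(4)]
  obtain W where W: "continuous_on UNIV W" "\<And>x. x \<notin> \<Omega> \<Longrightarrow> W x = 0" "uniform_limit UNIV \<phi> W sequentially"
      "AE x in ?M. W x = u x - G0 x"
    using W1p0_continuous_representative[OF \<Omega>(1,2) p'(1,2) \<phi> Lw c1 c2] by blast
  \<comment> \<open>A weak gradient of the Lipschitz datum, read off as the difference of the weak
    gradients of \<open>u\<close> and of \<open>u - G0\<close>; this avoids almost everywhere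
    differentiability of Lipschitz functions.\<close>
  define DG where "DG = (\<lambda>x. Du x - Dw x)"
  have iDG: "integrable ?M DG" using iu by (auto simp: DG_def)
  have iH: "integrable ?M H"
  proof -
    have "integrable ?M G0" using Bochner_Integration.integrable_diff[OF iu(1) iu(3)] by simp
    then show ?thesis using Bochner_Integration.integrable_cong[of ?M ?M H G0] H\<Omega> by simp
  qed
  have weakG: "(\<integral>x. H x *\<^sub>R grad \<psi> x \<partial>?M) = - (\<integral>x. \<psi> x *\<^sub>R DG x \<partial>?M)" if \<psi>: "C1_0 \<Omega> \<psi>" for \<psi>
  proof -
    obtain c where c: "\<And>x. norm (grad \<psi> x) \<le> c" using C1_0_D(6)[OF \<psi>] by blast
    obtain c' where c': "\<And>x. \<bar>\<psi> x\<bar> \<le> c'" using C1_0_D(7)[OF \<psi>] by blast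
    have c0: "c \<ge> 0" using c[of 0] norm_ge_zero order_trans by blast
    have m\<psi>: "grad \<psi> \<in> borel_measurable ?M" using grad_C1_0_Lp(1)[OF \<psi> \<Omega>m, of 0] by simp
    have m\<psi>': "\<psi> \<in> borel_measurable ?M" using C1_0_integrable[OF \<psi> \<Omega>m] by simp
    have i1: "integrable ?M (\<lambda>x. h x *\<^sub>R grad \<psi> x)" if "integrable ?M h" for h :: "'a \<Rightarrow> real"
    proof (rule Bochner_Integration.integrable_bound)
      show "integrable ?M (\<lambda>x. c * h x)" using that by auto
      show "AE x in ?M. norm (h x *\<^sub>R grad \<psi> x) \<le> norm (c * h x)"
        using c c0 by (auto simp: abs_mult mult.commute[of "\<bar>h _\<bar>"] intro!: mult_right_mono)
    qed (use that m\<psi> in auto)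
    have i2: "integrable ?M (\<lambda>x. \<psi> x *\<^sub>R D x)" if "integrable ?M D" for D :: "'a \<Rightarrow> 'a"
      by (rule integrable_mult_bounded[OF that m\<psi>', of c']) (use c' in auto)
    have "(\<integral>x. H x *\<^sub>R grad \<psi> x \<partial>?M) = (\<integral>x. u x *\<^sub>R grad \<psi> x - (u x - G0 x) *\<^sub>R grad \<psi> x \<partial>?M)"
      by (rule Bochner_Integration.integral_cong) (auto simp: H\<Omega> simp flip: scaleR_diff_left)
    also have "\<dots> = (\<integral>x. u x *\<^sub>R grad \<psi> x \<partial>?M) - (\<integral>x. (u x - G0 x) *\<^sub>R grad \<psi> x \<partial>?M)"
      by (rule Bochner_Integration.integral_diff[OF i1[OF iu(1)] i1[OF iu(3)]])
    also have "(\<integral>x. u x *\<^sub>R grad \<psi> x \<partial>?M) = - (\<integral>x. \<psi> x *\<^sub>R Du x \<partial>?M)"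
      using Du \<psi> by (auto simp: in_W1p_def has_weak_gradient_def)
    also have "(\<integral>x. (u x - G0 x) *\<^sub>R grad \<psi> x \<partial>?M) = - (\<integral>x. \<psi> x *\<^sub>R Dw x \<partial>?M)"
      using Dw \<psi> by (auto simp: in_W1p_def has_weak_gradient_def)
    also have "- (\<integral>x. \<psi> x *\<^sub>R Du x \<partial>?M) - - (\<integral>x. \<psi> x *\<^sub>R Dw x \<partial>?M) = - (\<integral>x. \<psi> x *\<^sub>R Du x - \<psi> x *\<^sub>R Dw x \<partial>?M)"
      using Bochner_Integration.integral_diff[OF i2[OF iu(2)] i2[OF iu(4)]] by simp
    finally show ?thesis by (simp add: DG_def scaleR_diff_right)
  qed
  have wgl: "integrable ?M (\<lambda>x. B x \<bullet> DG x)" "integrable ?M (\<lambda>x. B x \<bullet> grad (G n) x)"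
      "(\<lambda>n. \<integral>x. B x \<bullet> grad (G n) x \<partial>?M) \<longlonglongrightarrow> (\<integral>x. B x \<bullet> DG x \<partial>?M)"
    if "integrable ?M B" for B n
    by (rule weak_gradient_limit[OF \<Omega>(1,2) G(1) _ _ iH iDG _ that]; fact G\<Omega> weakG)+
  define U where "U = (\<lambda>x. W x + H x)"
  define f where "f = (\<lambda>n x. \<phi> n x + G n x)"
  have gf: "(f n has_derivative (\<lambda>v. (grad (\<phi> n) x + grad (G n) x) \<bullet> v)) (at x)" for n x
    unfolding f_def using has_derivative_add[OF C1_0_D(1)[OF \<phi>] Ck_on_1_D(1)[OF G(1) open_UNIV UNIV_I]]
    by (simp add: inner_add_left)
  have gf': "grad (f n) x = grad (\<phi> n) x + grad (G n) x" for n x by (rule grad_eqI[OF gf])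
  have fC1: "Ck_on 1 UNIV (f n)" for n
    by (rule Ck_on_1_I[OF open_UNIV gf]) (intro continuous_intros C1_0_D(2)[OF \<phi>] Ck_on_1_D(2)[OF G(1) open_UNIV])
  note G\<phi> = grad_C1_0_Lp[OF \<phi> \<Omega>m p'(3)]
  have mG: "grad (G n) \<in> borel_measurable ?M" for n
    by (intro continuous_imp_measurable_on_sets_lebesgue[OF _ \<Omega>s] continuous_on_subset[OF Ck_on_1_D(2)[OF G(1) open_UNIV]]) auto
  have iG: "integrable ?M (\<lambda>x. norm (grad (G n) x) powr p)" for n
    by (rule integrable_lebesgue_on_bounded[OF _ \<Omega>m, of _ "L powr p"]) (use mG G\<Omega>(2) p' in \<open>auto intro!: powr_mono2\<close>)
  have iGd: "integrable ?M (\<lambda>x. norm (grad (\<phi> n) x - Dw x) powr p)" for n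
    by (rule Lp_sum(3)[OF G\<phi> Lw(3,4) p'(3)])
  have md: "(\<lambda>x. grad (\<phi> n) x - Dw x) \<in> borel_measurable ?M" for n using G\<phi> Lw by auto
  have "weak_sol \<Omega> p lam g U Du f \<Lambda>"
  proof
    show "open \<Omega>" "bounded \<Omega>" "\<Omega> \<noteq> {}" "2 * real DIM('a) + 3 \<le> p" "lam \<in> borel_measurable ?M" by fact+
    show "0 < lam x" "lam x \<le> \<Lambda>" if "x \<in> \<Omega>" for x using lam that by auto
    show "continuous_on (closure \<Omega>) U" unfolding U_def
      by (intro continuous_intros continuous_on_subset[OF W(1)] continuous_on_subset[OF cH]) auto
    show "U x = g x" if x: "x \<in> frontier \<Omega>" for x
    proof -
      have "x \<notin> \<Omega>" "x \<in> closure \<Omega>" using x \<Omega> by (auto simp: frontier_def interior_open)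
      then show ?thesis using G0(2)[OF x] W(2) H(2) by (simp add: U_def)
    qed
    show "Ck_on 1 UNIV (f n)" for n by (rule fC1)
    have "uniform_limit (closure \<Omega>) G H sequentially"
      unfolding uniform_limit_iff
    proof (intro allI impI)
      fix e :: real assume "e > 0"
      then have "\<forall>\<^sub>F n in sequentially. inverse (real (Suc n)) < e" by (rule order_tendstoD(2)[OF LIMSEQ_inverse_real_of_nat])
      then show "\<forall>\<^sub>F n in sequentially. \<forall>x\<in>closure \<Omega>. dist (G n x) (H x) < e"
      proof eventually_elim
        case (elim n)
        show ?case
        proof
          fix x assume "x \<in> closure \<Omega>"
          from G(2)[OF this, of n] elim show "dist (G n x) (H x) < e" by (simp add: dist_real_def inverse_eq_divide)
        qed
      qed
    qed
    moreover have "uniform_limit (closure \<Omega>) \<phi> W sequentially" by (rule uniform_limit_on_subset[OF W(3)]) auto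
    ultimately show "uniform_limit (closure \<Omega>) f U sequentially"
      unfolding f_def U_def by (intro uniform_limit_intros)
    show "Du \<in> borel_measurable ?M" "integrable ?M (\<lambda>x. norm (Du x) powr p)" using Lu by auto
    show "\<exists>B. \<forall>n. integrable ?M (\<lambda>x. norm (grad (f n) x) powr p) \<and> (\<integral>x. norm (grad (f n) x) powr p \<partial>?M) \<le> B"
    proof -
      have "Bseq (\<lambda>n. \<integral>x. norm (grad (\<phi> n) x - Dw x) powr p \<partial>?M)"
        using c2 by (intro convergent_imp_Bseq) (auto simp: convergent_def)
      then obtain C where C: "\<And>n. norm (\<integral>x. norm (grad (\<phi> n) x - Dw x) powr p \<partial>?M) \<le> C"
        unfolding Bseq_def by blast
      define B1 where "B1 = 2 powr p * (C + (\<integral>x. norm (Dw x) powr p \<partial>?M))"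
      define B2 where "B2 = (\<integral>x. L powr p \<partial>?M)"
      have 1: "(\<integral>x. norm (grad (\<phi> n) x) powr p \<partial>?M) \<le> B1" for n
      proof -
        have "(\<integral>x. norm ((grad (\<phi> n) x - Dw x) + Dw x) powr p \<partial>?M) \<le>
            2 powr p * ((\<integral>x. norm (grad (\<phi> n) x - Dw x) powr p \<partial>?M) + (\<integral>x. norm (Dw x) powr p \<partial>?M))"
          by (rule Lp_sum(2)[OF md iGd Lw(3,4) p'(3)])
        also have "\<dots> \<le> B1" unfolding B1_def using C[of n] by (intro mult_left_mono add_right_mono) auto
        finally show ?thesis by simp
      qed
      have 2: "(\<integral>x. norm (grad (G n) x) powr p \<partial>?M) \<le> B2" for n
        unfolding B2_def
        by (rule integral_mono[OF iG])
          (use \<Omega>m G\<Omega>(2) p' in \<open>auto intro!: powr_mono2 integrable_lebesgue_on_bounded[of _ _ "L powr p"]\<close>)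
      have "integrable ?M (\<lambda>x. norm (grad (f n) x) powr p) \<and>
          (\<integral>x. norm (grad (f n) x) powr p \<partial>?M) \<le> 2 powr p * (B1 + B2)" for n
      proof
        show "integrable ?M (\<lambda>x. norm (grad (f n) x) powr p)" unfolding gf' by (rule Lp_sum(1)[OF G\<phi> mG iG p'(3)])
        have "(\<integral>x. norm (grad (f n) x) powr p \<partial>?M) \<le>
            2 powr p * ((\<integral>x. norm (grad (\<phi> n) x) powr p \<partial>?M) + (\<integral>x. norm (grad (G n) x) powr p \<partial>?M))"
          unfolding gf' by (rule Lp_sum(2)[OF G\<phi> mG iG p'(3)])
        also have "\<dots> \<le> 2 powr p * (B1 + B2)" using 1[of n] 2[of n] by (intro mult_left_mono add_mono) auto
        finally show "(\<integral>x. norm (grad (f n) x) powr p \<partial>?M) \<le> 2 powr p * (B1 + B2)" .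
      qed
      then show ?thesis by blast
    qed
    show "(\<lambda>n. \<integral>x. \<theta>n n x * (\<psi> x \<bullet> grad (f n) x) \<partial>?M) \<longlonglongrightarrow> (\<integral>x. \<theta> x * (\<psi> x \<bullet> Du x) \<partial>?M)"
      if m\<theta>n: "\<And>n. \<theta>n n \<in> borel_measurable ?M" and m\<theta>: "\<theta> \<in> borel_measurable ?M"
        and b: "\<And>n x. x \<in> \<Omega> \<Longrightarrow> \<bar>\<theta>n n x\<bar> \<le> c" and lim: "\<And>x. x \<in> \<Omega> \<Longrightarrow> (\<lambda>n. \<theta>n n x) \<longlonglongrightarrow> \<theta> x"
        and \<psi>: "\<psi> \<in> borel_measurable ?M" "integrable ?M (\<lambda>x. norm (\<psi> x) powr (p / (p - 1)))" for \<theta>n \<theta> \<psi> c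
    proof -
      obtain x0 where x0: "x0 \<in> \<Omega>" using \<Omega> by blast
      have c0: "c \<ge> 0" using b[OF x0, of 0] by linarith
      have b\<theta>: "\<bar>\<theta> x\<bar> \<le> c" if "x \<in> \<Omega>" for x
        by (rule tendsto_upperbound[OF tendsto_rabs[OF lim[OF that]]]) (use b that in auto)
      have AEn: "AE x in ?M. \<bar>\<theta>n n x\<bar> \<le> c" for n using b by (intro AE_I2) auto
      have AE\<theta>: "AE x in ?M. \<bar>\<theta> x\<bar> \<le> c" using b\<theta> by (intro AE_I2) auto
      have q1: "p / (p - 1) \<ge> 1" using p' by simp
      have i\<psi>: "integrable ?M \<psi>" by (rule Lp_imp_integrable[OF \<psi> \<Omega>m q1])
      note Hd = Hoelder_vector[OF p'(2) \<psi> md iGd m\<theta>n AEn c0]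
      note Hw = Hoelder_vector(1)[OF p'(2) \<psi> Lw(3,4)]
      let ?Q = "(\<integral>x. norm (\<psi> x) powr (p / (p - 1)) \<partial>?M) powr ((p - 1) / p)"
      \<comment> \<open>The integral splits into four pieces. Hoelder's inequality removes the
        strong error of the first summand (\<open>t1\<close>), and \<open>Dw\<close> meets the
        moving multiplier by domination (\<open>t2\<close>). In the datum part the multiplier is
        frozen at \<open>\<theta>\<close> to apply weak convergence (\<open>t3\<close>); the
        freezing error tends to zero in L^1 while the gradients stay bounded by \<open>L\<close>
        (\<open>t4\<close>).\<close>
      have t1: "(\<lambda>n. \<integral>x. \<theta>n n x * (\<psi> x \<bullet> (grad (\<phi> n) x - Dw x)) \<partial>?M) \<longlonglongrightarrow> 0"
      proof (rule Lim_null_comparison)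
        show "\<forall>\<^sub>F n in sequentially. norm (\<integral>x. \<theta>n n x * (\<psi> x \<bullet> (grad (\<phi> n) x - Dw x)) \<partial>?M) \<le>
            c * ((\<integral>x. norm (grad (\<phi> n) x - Dw x) powr p \<partial>?M) powr (1/p) * ?Q)"
          using Hd(2) by auto
        have "(\<lambda>n. (\<integral>x. norm (grad (\<phi> n) x - Dw x) powr p \<partial>?M) powr (1/p)) \<longlonglongrightarrow> 0 powr (1/p)"
          by (rule tendsto_powr'[OF c2 tendsto_const]) (use p' in \<open>auto intro!: always_eventually integral_nonneg_AE\<close>)
        then show "(\<lambda>n. c * ((\<integral>x. norm (grad (\<phi> n) x - Dw x) powr p \<partial>?M) powr (1/p) * ?Q)) \<longlonglongrightarrow> 0"
          using p' by (intro tendsto_mult_right_zero tendsto_mult_left_zero) simp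
      qed
      have t2: "(\<lambda>n. \<integral>x. \<theta>n n x * (\<psi> x \<bullet> Dw x) \<partial>?M) \<longlonglongrightarrow> (\<integral>x. \<theta> x * (\<psi> x \<bullet> Dw x) \<partial>?M)"
      proof (rule integral_dominated_convergence[where w="\<lambda>x. c * \<bar>1 * (\<psi> x \<bullet> Dw x)\<bar>"])
        show "integrable ?M (\<lambda>x. c * \<bar>1 * (\<psi> x \<bullet> Dw x)\<bar>)"
          by (intro integrable_mult_right Bochner_Integration.integrable_abs Hw[of "\<lambda>_. 1" 1]) auto
        show "AE x in ?M. (\<lambda>n. \<theta>n n x * (\<psi> x \<bullet> Dw x)) \<longlonglongrightarrow> \<theta> x * (\<psi> x \<bullet> Dw x)"
          using lim by (intro AE_I2 tendsto_mult_right) auto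
        show "AE x in ?M. norm (\<theta>n n x * (\<psi> x \<bullet> Dw x)) \<le> c * \<bar>1 * (\<psi> x \<bullet> Dw x)\<bar>" for n
          using b by (intro AE_I2) (auto simp: abs_mult intro!: mult_right_mono)
      qed (use m\<theta>n m\<theta> \<psi> Lw in auto)
      have i\<psi>\<theta>: "integrable ?M (\<lambda>x. \<theta> x *\<^sub>R \<psi> x)" by (rule integrable_mult_bounded[OF i\<psi> m\<theta> AE\<theta>])
      have i\<psi>\<theta>n: "integrable ?M (\<lambda>x. (\<theta>n n x - \<theta> x) *\<^sub>R \<psi> x)" for n
      proof -
        have "integrable ?M (\<lambda>x. \<theta>n n x *\<^sub>R \<psi> x - \<theta> x *\<^sub>R \<psi> x)"
          by (intro Bochner_Integration.integrable_diff i\<psi>\<theta> integrable_mult_bounded[OF i\<psi> m\<theta>n AEn])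
        then show ?thesis by (simp add: scaleR_diff_left)
      qed
      have t3: "(\<lambda>n. \<integral>x. (\<theta> x *\<^sub>R \<psi> x) \<bullet> grad (G n) x \<partial>?M) \<longlonglongrightarrow> (\<integral>x. (\<theta> x *\<^sub>R \<psi> x) \<bullet> DG x \<partial>?M)"
        by (rule wgl(3)[OF i\<psi>\<theta>])
      have t4: "(\<lambda>n. \<integral>x. ((\<theta>n n x - \<theta> x) *\<^sub>R \<psi> x) \<bullet> grad (G n) x \<partial>?M) \<longlonglongrightarrow> 0"
      proof (rule Lim_null_comparison)
        show "\<forall>\<^sub>F n in sequentially. norm (\<integral>x. ((\<theta>n n x - \<theta> x) *\<^sub>R \<psi> x) \<bullet> grad (G n) x \<partial>?M) \<le>
            L * (\<integral>x. norm ((\<theta>n n x - \<theta> x) *\<^sub>R \<psi> x) \<partial>?M)"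
        proof (rule always_eventually, rule allI)
          fix n
          have "norm (\<integral>x. ((\<theta>n n x - \<theta> x) *\<^sub>R \<psi> x) \<bullet> grad (G n) x \<partial>?M) \<le> (\<integral>x. \<bar>((\<theta>n n x - \<theta> x) *\<^sub>R \<psi> x) \<bullet> grad (G n) x\<bar> \<partial>?M)"
            unfolding real_norm_def by (rule integral_abs_bound)
          also have "\<dots> \<le> (\<integral>x. L * norm ((\<theta>n n x - \<theta> x) *\<^sub>R \<psi> x) \<partial>?M)"
          proof (rule integral_mono)
            fix x assume "x \<in> space ?M"
            then have "norm (grad (G n) x) \<le> L" using G\<Omega> by simp
            then have "norm ((\<theta>n n x - \<theta> x) *\<^sub>R \<psi> x) * norm (grad (G n) x) \<le> norm ((\<theta>n n x - \<theta> x) *\<^sub>R \<psi> x) * L"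
              by (intro mult_left_mono) auto
            with Cauchy_Schwarz_ineq2[of "(\<theta>n n x - \<theta> x) *\<^sub>R \<psi> x" "grad (G n) x"]
            show "\<bar>((\<theta>n n x - \<theta> x) *\<^sub>R \<psi> x) \<bullet> grad (G n) x\<bar> \<le> L * norm ((\<theta>n n x - \<theta> x) *\<^sub>R \<psi> x)"
              by (simp only: mult.commute[of L])
          next
            show "integrable ?M (\<lambda>x. \<bar>((\<theta>n n x - \<theta> x) *\<^sub>R \<psi> x) \<bullet> grad (G n) x\<bar>)"
              by (rule Bochner_Integration.integrable_abs[OF wgl(2)[OF i\<psi>\<theta>n]])
            show "integrable ?M (\<lambda>x. L * norm ((\<theta>n n x - \<theta> x) *\<^sub>R \<psi> x))"
              by (intro integrable_mult_right integrable_norm i\<psi>\<theta>n)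
          qed
          finally show "norm (\<integral>x. ((\<theta>n n x - \<theta> x) *\<^sub>R \<psi> x) \<bullet> grad (G n) x \<partial>?M) \<le>
            L * (\<integral>x. norm ((\<theta>n n x - \<theta> x) *\<^sub>R \<psi> x) \<partial>?M)" by simp
        qed
        have "(\<lambda>n. \<integral>x. norm ((\<theta>n n x - \<theta> x) *\<^sub>R \<psi> x) \<partial>?M) \<longlonglongrightarrow> (\<integral>x. 0 \<partial>?M)"
        proof (rule integral_dominated_convergence[where w="\<lambda>x. 2 * c * norm (\<psi> x)"])
          show "AE x in ?M. (\<lambda>n. norm ((\<theta>n n x - \<theta> x) *\<^sub>R \<psi> x)) \<longlonglongrightarrow> 0"
          proof (rule AE_I2)
            fix x assume "x \<in> space ?M"
            then have "(\<lambda>n. \<theta>n n x - \<theta> x) \<longlonglongrightarrow> 0" using lim by (simp add: LIM_zero)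
            then have t: "(\<lambda>n. (\<theta>n n x - \<theta> x) *\<^sub>R \<psi> x) \<longlonglongrightarrow> 0 *\<^sub>R \<psi> x" by (intro tendsto_intros)
            show "(\<lambda>n. norm ((\<theta>n n x - \<theta> x) *\<^sub>R \<psi> x)) \<longlonglongrightarrow> 0" using tendsto_norm[OF t] by simp
          qed
          show "AE x in ?M. norm (norm ((\<theta>n n x - \<theta> x) *\<^sub>R \<psi> x)) \<le> 2 * c * norm (\<psi> x)" for n
          proof (rule AE_I2)
            fix x assume "x \<in> space ?M"
            then have "\<bar>\<theta>n n x - \<theta> x\<bar> \<le> 2 * c" using b[of x n] b\<theta>[of x] by simp
            then show "norm (norm ((\<theta>n n x - \<theta> x) *\<^sub>R \<psi> x)) \<le> 2 * c * norm (\<psi> x)"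
              by (auto intro!: mult_right_mono)
          qed
        qed (use i\<psi> m\<theta>n m\<theta> in auto)
        then show "(\<lambda>n. L * (\<integral>x. norm ((\<theta>n n x - \<theta> x) *\<^sub>R \<psi> x) \<partial>?M)) \<longlonglongrightarrow> 0"
          by (intro tendsto_mult_right_zero) simp
      qed
      have "(\<integral>x. \<theta>n n x * (\<psi> x \<bullet> grad (f n) x) \<partial>?M) =
          (\<integral>x. \<theta>n n x * (\<psi> x \<bullet> (grad (\<phi> n) x - Dw x)) \<partial>?M) + (\<integral>x. \<theta>n n x * (\<psi> x \<bullet> Dw x) \<partial>?M) +
          ((\<integral>x. (\<theta> x *\<^sub>R \<psi> x) \<bullet> grad (G n) x \<partial>?M) + (\<integral>x. ((\<theta>n n x - \<theta> x) *\<^sub>R \<psi> x) \<bullet> grad (G n) x \<partial>?M))" for n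
      proof -
        have "\<theta>n n x * (\<psi> x \<bullet> grad (f n) x) = \<theta>n n x * (\<psi> x \<bullet> (grad (\<phi> n) x - Dw x)) + \<theta>n n x * (\<psi> x \<bullet> Dw x) +
          ((\<theta> x *\<^sub>R \<psi> x) \<bullet> grad (G n) x + ((\<theta>n n x - \<theta> x) *\<^sub>R \<psi> x) \<bullet> grad (G n) x)" for x
          unfolding gf' by (simp add: inner_simps algebra_simps)
        then show ?thesis
          using Hd(1)[of n] Hw[OF m\<theta>n AEn c0, of n] wgl(2)[OF i\<psi>\<theta>, of n] wgl(2)[OF i\<psi>\<theta>n, of n n] by simp
      qed
      moreover have "(\<integral>x. \<theta> x * (\<psi> x \<bullet> Du x) \<partial>?M) = 0 + (\<integral>x. \<theta> x * (\<psi> x \<bullet> Dw x) \<partial>?M) + ((\<integral>x. (\<theta> x *\<^sub>R \<psi> x) \<bullet> DG x \<partial>?M) + 0)"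
      proof -
        have "\<theta> x * (\<psi> x \<bullet> Du x) = \<theta> x * (\<psi> x \<bullet> Dw x) + (\<theta> x *\<^sub>R \<psi> x) \<bullet> DG x" for x
          by (simp add: DG_def inner_simps algebra_simps)
        then show ?thesis using Hw[OF m\<theta> AE\<theta> c0] wgl(1)[OF i\<psi>\<theta>] by simp
      qed
      ultimately show ?thesis by (simp only:) (intro tendsto_add t1 t2 t3 t4)
    qed
    show "(\<integral>x. (norm (Du x) powr (p - 2) *\<^sub>R Du x) \<bullet> grad \<phi> x \<partial>?M) = - (\<integral>x. lam x * indicator {y. U y > 0} x * \<phi> x \<partial>?M)"
      if "C1_0 \<Omega> \<phi>" for \<phi>
    proof -
      have mU: "U \<in> borel_measurable ?M" unfolding U_def
        by (intro continuous_imp_measurable_on_sets_lebesgue[OF _ \<Omega>s] continuous_intros continuous_on_subset[OF W(1)] continuous_on_subset[OF cH]) auto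
      have ind: "(\<lambda>x. indicator {y. v y > 0} x :: real) \<in> borel_measurable ?M" if v: "v \<in> borel_measurable ?M" for v :: "'a \<Rightarrow> real"
      proof -
        have "(\<lambda>x. indicator {0<..} (v x) :: real) \<in> borel_measurable ?M"
          using measurable_compose[OF v borel_measurable_indicator[of "{0<..}"]] by simp
        then show ?thesis by (simp add: indicator_def)
      qed
      \<comment> \<open>Passing to the continuous representative alters the positivity set in
        \<Omega> by a null set only.\<close>
      have "(\<integral>x. lam x * indicator {y. U y > 0} x * \<phi> x \<partial>?M) = (\<integral>x. lam x * indicator {y. u y > 0} x * \<phi> x \<partial>?M)"
      proof (rule integral_cong_AE)
        have "AE x in ?M. U x = u x" using AE_space[of ?M] W(4)
          by eventually_elim (auto simp: U_def H\<Omega>)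
        then show "AE x in ?M. lam x * indicator {y. U y > 0} x * \<phi> x = lam x * indicator {y. u y > 0} x * \<phi> x"
          by eventually_elim (auto simp: indicator_def)
      qed (use lam(1) ind[OF mU] ind[OF Lu(1)] C1_0_integrable(1)[OF that \<Omega>m] in auto)
      then show ?thesis using eq[OF that] by simp
    qed
  qed
  moreover have "AE x in ?M. U x = u x" using AE_space[of ?M] W(4)
    by eventually_elim (auto simp: U_def H\<Omega>)
  ultimately show ?thesis by blast
qed

section \<open>Truncated differences as test functions\<close>

context weak_sol
begin

text \<open>Since N \<ge> 1, the bound p \<ge> 2 N + 3 gives both Morrey's condition and p \<ge> 5.
  The latter secures p > 4, which is used when the classical field |\<nabla>h|^(p-2) \<nabla>h is
  differentiated.\<close>

lemma standing_facts: "\<Omega> \<in> lmeasurable" "\<Omega> \<in> sets lebesgue" "p \<ge> 5" "p \<ge> 2 * real DIM('a)"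
proof -
  show "\<Omega> \<in> lmeasurable" using \<Omega> by (simp add: lmeasurable_open)
  show "\<Omega> \<in> sets lebesgue" using \<Omega> by auto
  have "real DIM('a) \<ge> 1" by (simp add: Suc_leI)
  then show "p \<ge> 5" "p \<ge> 2 * real DIM('a)" using p by linarith+
qed

definition flux :: "'a \<Rightarrow> 'a" where "flux x = norm (Du x) powr (p - 2) *\<^sub>R Du x"

lemma flux_Lq:
  "flux \<in> borel_measurable (lebesgue_on \<Omega>)" "integrable (lebesgue_on \<Omega>) (\<lambda>x. norm (flux x) powr (p / (p - 1)))"
proof -
  show "flux \<in> borel_measurable (lebesgue_on \<Omega>)" unfolding flux_def using Du by auto
  have "norm (flux x) powr (p / (p - 1)) = norm (Du x) powr p" for x
  proof (cases "Du x = 0")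
    case False
    then have "norm (flux x) = norm (Du x) powr (p - 2) * norm (Du x) powr 1" by (simp add: flux_def)
    also have "\<dots> = norm (Du x) powr (p - 1)" by (simp only: powr_add[symmetric]) simp
    finally show ?thesis using standing_facts(3) by (simp add: powr_powr)
  qed (simp add: flux_def)
  then show "integrable (lebesgue_on \<Omega>) (\<lambda>x. norm (flux x) powr (p / (p - 1)))" using Du by simp
qed

lemma f_lim_pointwise: "x \<in> closure \<Omega> \<Longrightarrow> (\<lambda>n. f n x) \<longlonglongrightarrow> U x"
  by (rule tendsto_uniform_limitI[OF f_lim])

lemma f_uniformly_close:
  assumes "e > 0"
  shows "\<exists>n0. \<forall>n\<ge>n0. \<forall>x\<in>closure \<Omega>. \<bar>f n x - U x\<bar> < e"
  using f_lim assms by (auto simp: uniform_limit_iff eventually_sequentially dist_real_def)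

lemma f_cont: "continuous_on S (f n)" "continuous_on S (grad (f n))"
  using Ck_on_1_D(2,3)[OF f_C1 open_UNIV] continuous_on_subset subset_UNIV by blast+

lemma U_cont': "continuous_on \<Omega> U"
  using U_cont continuous_on_subset closure_subset by blast

end

text \<open>The test function is \<open>T (U - h)\<close> on \<open>V\<close>, extended by zero. Neither \<open>h\<close> nor its gradient need be bounded
  on \<open>V\<close>, since both \<open>T\<close> and \<open>T'\<close> vanish there off the compact set \<open>K\<close>.\<close>

locale weak_sol_test = weak_sol \<Omega> p lam g U Du f \<Lambda>
  for \<Omega> :: "'a::euclidean_space set" and p lam g U Du f \<Lambda> +
  fixes V K :: "'a set" and h :: "'a \<Rightarrow> real" and T T' :: "real \<Rightarrow> real" and n0 :: nat
  assumes V: "open V" "V \<subseteq> \<Omega>" and K: "compact K" "K \<subseteq> V" and h: "Ck_on 1 V h"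
    and T: "\<And>s. (T has_real_derivative T' s) (at s)" and T'c: "continuous_on UNIV T'" and T'b: "\<And>s. \<bar>T' s\<bar> \<le> 1"
    and z: "\<And>n x. n \<ge> n0 \<Longrightarrow> x \<in> V \<Longrightarrow> x \<notin> K \<Longrightarrow> T (f n x - h x) = 0 \<and> T' (f n x - h x) = 0"
begin

text \<open>Only the functions with index n are differentiated classically. \<open>Deta\<close> is
  the formula that the chain rule would give for the gradient of \<open>eta\<close>; what ties it to
  \<open>eta\<close> is the convergence in \<open>grad_etan_weak\<close>.\<close>

definition "etan n x = (if x \<in> V then T (f n x - h x) else 0)"
definition "eta x = (if x \<in> V then T (U x - h x) else 0)"
definition "thetan n x = (if x \<in> V then T' (f n x - h x) else 0)"
definition "theta x = (if x \<in> V then T' (U x - h x) else 0)"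
text \<open>The gradient of \<open>h\<close> cut off to \<open>K\<close>, hence bounded on the whole
  space; off \<open>K\<close> the factor \<open>theta\<close> vanishes, so nothing is lost in
  \<open>Deta\<close>.\<close>

definition "hK x = (if x \<in> K then grad h x else 0)"
definition "Deta x = theta x *\<^sub>R (Du x - hK x)"

lemma Vm: "V \<in> sets lebesgue" "V \<in> lmeasurable"
  using V standing_facts(1) by (auto simp: lmeasurable_open bounded_subset[OF \<Omega>(2)])

lemma T_cont: "continuous_on S T"
  using T by (meson DERIV_isCont continuous_at_imp_continuous_on)

lemma T_lip: "\<bar>T s - T t\<bar> \<le> \<bar>s - t\<bar>"
proof -
  have "norm (T s - T t) \<le> 1 * norm (s - t)"
    by (rule field_differentiable_bound[of UNIV T T']) (use T T'b in auto)
  then show ?thesis by simp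
qed

lemma V_cl: "x \<in> V \<Longrightarrow> x \<in> closure \<Omega>" using V closure_subset by blast

lemma test_limits: "(\<lambda>n. etan n x) \<longlonglongrightarrow> eta x" "(\<lambda>n. thetan n x) \<longlonglongrightarrow> theta x"
proof -
  have "(\<lambda>n. f n x - h x) \<longlonglongrightarrow> U x - h x" if "x \<in> V"
    by (intro tendsto_intros f_lim_pointwise V_cl that)
  then show "(\<lambda>n. etan n x) \<longlonglongrightarrow> eta x" "(\<lambda>n. thetan n x) \<longlonglongrightarrow> theta x"
    using continuous_on_tendsto_compose[OF T_cont[of UNIV]] continuous_on_tendsto_compose[OF T'c]
    by (auto simp: etan_def eta_def thetan_def theta_def)
qed

lemma test_zeros: "n \<ge> n0 \<Longrightarrow> x \<notin> K \<Longrightarrow> etan n x = 0" "n \<ge> n0 \<Longrightarrow> x \<notin> K \<Longrightarrow> thetan n x = 0"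
  "x \<notin> K \<Longrightarrow> eta x = 0" "x \<notin> K \<Longrightarrow> theta x = 0"
proof -
  show 1: "n \<ge> n0 \<Longrightarrow> x \<notin> K \<Longrightarrow> etan n x = 0" and 2: "n \<ge> n0 \<Longrightarrow> x \<notin> K \<Longrightarrow> thetan n x = 0" for n
    using z by (auto simp: etan_def thetan_def)
  show "eta x = 0" if "x \<notin> K"
  proof (rule LIMSEQ_unique[OF test_limits(1)])
    show "(\<lambda>n. etan n x) \<longlonglongrightarrow> 0"
      by (rule tendsto_eventually) (use 1 that in \<open>auto simp: eventually_sequentially\<close>)
  qed
  show "theta x = 0" if "x \<notin> K"
  proof (rule LIMSEQ_unique[OF test_limits(2)])
    show "(\<lambda>n. thetan n x) \<longlonglongrightarrow> 0"
      by (rule tendsto_eventually) (use 2 that in \<open>auto simp: eventually_sequentially\<close>)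
  qed
qed

lemma h_cont: "continuous_on V h" "continuous_on V (grad h)"
  using Ck_on_1_D(2,3)[OF h V(1)] by auto

lemma theta_bounds: "\<bar>thetan n x\<bar> \<le> 1" "\<bar>theta x\<bar> \<le> 1"
  using T'b by (auto simp: thetan_def theta_def)

lemma meas_V: "continuous_on V F \<Longrightarrow> (\<lambda>x. if x \<in> V then F x else 0) \<in> borel_measurable (lebesgue_on \<Omega>)" for F :: "'a \<Rightarrow> real"
  by (subst borel_measurable_if_lebesgue_on[OF Vm(1) standing_facts(2) V(2)]) (rule continuous_imp_measurable_on_sets_lebesgue[OF _ Vm(1)])

lemma test_measurable: "etan n \<in> borel_measurable (lebesgue_on \<Omega>)" "eta \<in> borel_measurable (lebesgue_on \<Omega>)"
  "thetan n \<in> borel_measurable (lebesgue_on \<Omega>)" "theta \<in> borel_measurable (lebesgue_on \<Omega>)"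
  "hK \<in> borel_measurable (lebesgue_on \<Omega>)" "Deta \<in> borel_measurable (lebesgue_on \<Omega>)"
proof -
  have cf: "continuous_on V (\<lambda>x. f n x - h x)" by (intro continuous_intros f_cont h_cont)
  have cU: "continuous_on V (\<lambda>x. U x - h x)" by (intro continuous_intros h_cont continuous_on_subset[OF U_cont' V(2)])
  show "etan n \<in> borel_measurable (lebesgue_on \<Omega>)" unfolding etan_def[abs_def]
    by (rule meas_V, rule continuous_on_compose2[OF T_cont cf]) auto
  show "eta \<in> borel_measurable (lebesgue_on \<Omega>)" unfolding eta_def[abs_def]
    by (rule meas_V, rule continuous_on_compose2[OF T_cont cU]) auto
  show "thetan n \<in> borel_measurable (lebesgue_on \<Omega>)" unfolding thetan_def[abs_def]
    by (rule meas_V, rule continuous_on_compose2[OF T'c cf]) auto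
  show t: "theta \<in> borel_measurable (lebesgue_on \<Omega>)" unfolding theta_def[abs_def]
    by (rule meas_V, rule continuous_on_compose2[OF T'c cU]) auto
  have Ks: "K \<in> sets lebesgue" "K \<subseteq> \<Omega>" using K V by (auto intro: lmeasurable_compact fmeasurableD)
  show hm: "hK \<in> borel_measurable (lebesgue_on \<Omega>)" unfolding hK_def[abs_def]
    by (subst borel_measurable_if_lebesgue_on[OF Ks(1) standing_facts(2) Ks(2)])
      (intro continuous_imp_measurable_on_sets_lebesgue Ks continuous_on_subset[OF h_cont(2) K(2)])
  show "Deta \<in> borel_measurable (lebesgue_on \<Omega>)" unfolding Deta_def[abs_def] using t hm Du by auto
qed

lemma hK_bound: "\<exists>c\<ge>0. \<forall>x. norm (hK x) \<le> c"
proof -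
  have "bounded (grad h ` K)"
    by (intro compact_imp_bounded compact_continuous_image K(1) continuous_on_subset[OF h_cont(2) K(2)])
  then obtain c where "\<forall>x\<in>K. norm (grad h x) \<le> c" by (auto simp: bounded_iff)
  then show ?thesis by (intro exI[of _ "max c 0"]) (auto simp: hK_def)
qed

lemma etan_C1_0:
  assumes n: "n \<ge> n0"
  shows "C1_0 V (etan n)" "C1_0 \<Omega> (etan n)" "grad (etan n) x = thetan n x *\<^sub>R (grad (f n) x - hK x)"
proof -
  have d: "((\<lambda>x. T (f n x - h x)) has_derivative (\<lambda>v. (T' (f n x - h x) *\<^sub>R (grad (f n) x - grad h x)) \<bullet> v)) (at x)" if "x \<in> V" for x
  proof -
    have "((\<lambda>x. f n x - h x) has_derivative (\<lambda>v. (grad (f n) x - grad h x) \<bullet> v)) (at x)"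
      using has_derivative_diff[OF Ck_on_1_D(1)[OF f_C1 open_UNIV UNIV_I] Ck_on_1_D(1)[OF h V(1) that]]
      by (simp add: inner_diff_left)
    from has_derivative_compose[OF this T[unfolded has_field_derivative_def]] show ?thesis by simp
  qed
  have C: "Ck_on 1 V (\<lambda>x. T (f n x - h x))"
    by (rule Ck_on_1_I[OF V(1) d]) (auto intro!: continuous_intros continuous_on_compose2[OF T'c] f_cont h_cont)
  have e: "etan n = (\<lambda>x. if x \<in> V then T (f n x - h x) else 0)" by (simp add: etan_def[abs_def])
  show c: "C1_0 V (etan n)" unfolding e
    by (rule C1_0_glue(1)[OF V(1) K C]) (use z[OF n] in auto)
  then show "C1_0 \<Omega> (etan n)" by (rule C1_0_mono) (rule V)
  have "grad (etan n) x = (if x \<in> V then grad (\<lambda>x. T (f n x - h x)) x else 0)" unfolding e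
    by (rule C1_0_glue(2)[OF V(1) K C]) (use z[OF n] in auto)
  then show "grad (etan n) x = thetan n x *\<^sub>R (grad (f n) x - hK x)"
    using grad_eqI[OF d, of x] test_zeros(2)[OF n, of x] K by (cases "x \<in> K") (auto simp: thetan_def hK_def)
qed

lemma Deta_Lp: "integrable (lebesgue_on \<Omega>) (\<lambda>x. norm (Deta x) powr p)"
proof -
  obtain c where c: "c \<ge> 0" "\<And>x. norm (hK x) \<le> c" using hK_bound by blast
  have ih: "integrable (lebesgue_on \<Omega>) (\<lambda>x. norm (hK x) powr p)"
    by (rule integrable_lebesgue_on_bounded[OF _ standing_facts(1), of _ "c powr p"]) (use test_measurable c standing_facts in \<open>auto intro!: powr_mono2\<close>)
  have i: "integrable (lebesgue_on \<Omega>) (\<lambda>x. norm (Du x - hK x) powr p)"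
    by (rule Lp_sum(3)[OF Du test_measurable(5) ih]) (use standing_facts in simp)
  show ?thesis
  proof (rule Bochner_Integration.integrable_bound[OF i])
    have "norm (Deta x) \<le> norm (Du x - hK x)" for x
      using theta_bounds(2)[of x] by (auto simp: Deta_def intro!: mult_left_le_one_le)
    then show "AE x in lebesgue_on \<Omega>. norm (norm (Deta x) powr p) \<le> norm (norm (Du x - hK x) powr p)"
      using standing_facts(3) by (auto intro!: powr_mono2)
  qed (use test_measurable in auto)
qed

text \<open>A product of a moving multiplier, convergent pointwise and boundedly, with weakly
  convergent gradients. The assumption \<open>f_weak\<close> carries a varying multiplier for
  exactly this purpose.\<close>

lemma grad_etan_weak:
  assumes \<psi>: "\<psi> \<in> borel_measurable (lebesgue_on \<Omega>)" "integrable (lebesgue_on \<Omega>) (\<lambda>x. norm (\<psi> x) powr (p / (p - 1)))"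
  shows "(\<lambda>n. \<integral>x. \<psi> x \<bullet> grad (etan n) x \<partial>lebesgue_on \<Omega>) \<longlonglongrightarrow> (\<integral>x. \<psi> x \<bullet> Deta x \<partial>lebesgue_on \<Omega>)"
proof -
  let ?M = "lebesgue_on \<Omega>"
  obtain c where c: "c \<ge> 0" "\<And>x. norm (hK x) \<le> c" using hK_bound by blast
  have p1: "p > 1" "p / (p - 1) \<ge> 1" using standing_facts by auto
  have i\<psi>: "integrable ?M \<psi>" by (rule Lp_imp_integrable[OF \<psi> standing_facts(1) p1(2)])
  have gf: "grad (f n) \<in> borel_measurable ?M" "integrable ?M (\<lambda>x. norm (grad (f n) x) powr p)" for n
    using f_bound by (auto intro!: continuous_imp_measurable_on_sets_lebesgue standing_facts f_cont)
  have AE1: "AE x in ?M. \<bar>thetan n x\<bar> \<le> 1" "AE x in ?M. \<bar>theta x\<bar> \<le> 1" for n using theta_bounds by auto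
  have ih: "integrable ?M (\<lambda>x. \<psi> x \<bullet> hK x)"
  proof (rule Bochner_Integration.integrable_bound)
    show "integrable ?M (\<lambda>x. c * norm (\<psi> x))" using i\<psi> by auto
    have "\<bar>\<psi> x \<bullet> hK x\<bar> \<le> c * norm (\<psi> x)" for x
      using Cauchy_Schwarz_ineq2[of "\<psi> x" "hK x"] mult_left_mono[OF c(2)[of x], of "norm (\<psi> x)"] by (simp add: mult.commute)
    then show "AE x in ?M. norm (\<psi> x \<bullet> hK x) \<le> norm (c * norm (\<psi> x))" using c by auto
  qed (use \<psi> test_measurable in auto)
  have t1: "(\<lambda>n. \<integral>x. thetan n x * (\<psi> x \<bullet> grad (f n) x) \<partial>?M) \<longlonglongrightarrow> (\<integral>x. theta x * (\<psi> x \<bullet> Du x) \<partial>?M)"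
    by (rule f_weak[OF test_measurable(3,4) theta_bounds(1) test_limits(2) \<psi>])
  have t2: "(\<lambda>n. \<integral>x. thetan n x * (\<psi> x \<bullet> hK x) \<partial>?M) \<longlonglongrightarrow> (\<integral>x. theta x * (\<psi> x \<bullet> hK x) \<partial>?M)"
  proof (rule integral_dominated_convergence[where w="\<lambda>x. \<bar>\<psi> x \<bullet> hK x\<bar>"])
    show "AE x in ?M. (\<lambda>n. thetan n x * (\<psi> x \<bullet> hK x)) \<longlonglongrightarrow> theta x * (\<psi> x \<bullet> hK x)"
      using test_limits(2) by (intro AE_I2 tendsto_mult_right)
    show "AE x in ?M. norm (thetan n x * (\<psi> x \<bullet> hK x)) \<le> \<bar>\<psi> x \<bullet> hK x\<bar>" for n
      using theta_bounds(1) by (auto simp: abs_mult intro!: mult_left_le_one_le)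
  qed (use test_measurable \<psi> ih in auto)
  have i1: "integrable ?M (\<lambda>x. thetan n x * (\<psi> x \<bullet> grad (f n) x))" for n
    by (rule Hoelder_vector(1)[OF p1(1) \<psi> gf test_measurable(3) AE1(1)]) simp
  have i2: "integrable ?M (\<lambda>x. theta x * (\<psi> x \<bullet> Du x))"
    by (rule Hoelder_vector(1)[OF p1(1) \<psi> Du test_measurable(4) AE1(2)]) simp
  have i3: "integrable ?M (\<lambda>x. thetan n x * (\<psi> x \<bullet> hK x))" for n
    using integrable_mult_bounded[OF ih test_measurable(3) AE1(1)] by simp
  have i4: "integrable ?M (\<lambda>x. theta x * (\<psi> x \<bullet> hK x))"
    using integrable_mult_bounded[OF ih test_measurable(4) AE1(2)] by simp
  have "(\<lambda>n. (\<integral>x. thetan n x * (\<psi> x \<bullet> grad (f n) x) \<partial>?M) - (\<integral>x. thetan n x * (\<psi> x \<bullet> hK x) \<partial>?M)) \<longlonglongrightarrow>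
     (\<integral>x. theta x * (\<psi> x \<bullet> Du x) \<partial>?M) - (\<integral>x. theta x * (\<psi> x \<bullet> hK x) \<partial>?M)"
    by (intro tendsto_diff t1 t2)
  also have "(\<integral>x. theta x * (\<psi> x \<bullet> Du x) \<partial>?M) - (\<integral>x. theta x * (\<psi> x \<bullet> hK x) \<partial>?M) = (\<integral>x. \<psi> x \<bullet> Deta x \<partial>?M)"
    by (subst Bochner_Integration.integral_diff[OF i2 i4, symmetric]) (simp add: Deta_def inner_diff_right right_diff_distrib)
  finally show ?thesis
  proof (rule Lim_transform_eventually)
    have "(\<integral>x. thetan n x * (\<psi> x \<bullet> grad (f n) x) \<partial>?M) - (\<integral>x. thetan n x * (\<psi> x \<bullet> hK x) \<partial>?M) =
      (\<integral>x. \<psi> x \<bullet> grad (etan n) x \<partial>?M)" if "n \<ge> n0" for n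
      by (subst Bochner_Integration.integral_diff[OF i1 i3, symmetric])
        (simp add: etan_C1_0(3)[OF that] inner_diff_right right_diff_distrib)
    then show "\<forall>\<^sub>F n in sequentially. (\<integral>x. thetan n x * (\<psi> x \<bullet> grad (f n) x) \<partial>?M) - (\<integral>x. thetan n x * (\<psi> x \<bullet> hK x) \<partial>?M) =
      (\<integral>x. \<psi> x \<bullet> grad (etan n) x \<partial>?M)" by (auto simp: eventually_sequentially)
  qed
qed

text \<open>\<open>T\<close> itself may be unbounded. On the compact set \<open>K\<close> the limit
  function is bounded by continuity, and since \<open>T\<close> is 1-Lipschitz, uniform convergence
  keeps the approximants within 1 of it from some index on.\<close>

lemma eta_bound: "\<exists>c. \<exists>n1\<ge>n0. (\<forall>x. \<bar>eta x\<bar> \<le> c) \<and> (\<forall>n\<ge>n1. \<forall>x. \<bar>etan n x\<bar> \<le> c)"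
proof -
  have "bounded ((\<lambda>x. T (U x - h x)) ` K)"
    using V K by (intro compact_imp_bounded compact_continuous_image K(1) continuous_on_compose2[OF T_cont[of UNIV]] continuous_intros
        continuous_on_subset[OF U_cont'] continuous_on_subset[OF h_cont(1)]) auto
  then obtain c where c: "\<And>x. x \<in> K \<Longrightarrow> \<bar>T (U x - h x)\<bar> \<le> c" by (auto simp: bounded_iff)
  obtain n1 where n1: "\<And>n x. n \<ge> n1 \<Longrightarrow> x \<in> closure \<Omega> \<Longrightarrow> \<bar>f n x - U x\<bar> < 1" using f_uniformly_close[of 1] by auto
  have "\<bar>eta x\<bar> \<le> max c 0 + 1" for x
    using test_zeros(3)[of x] c[of x] K by (cases "x \<in> K") (auto simp: eta_def)
  moreover have "\<bar>etan n x\<bar> \<le> max c 0 + 1" if "n \<ge> max n0 n1" for n x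
  proof (cases "x \<in> K")
    case True
    then have x: "x \<in> V" "x \<in> closure \<Omega>" using K V_cl by auto
    have "\<bar>T (f n x - h x) - T (U x - h x)\<bar> \<le> \<bar>(f n x - h x) - (U x - h x)\<bar>" by (rule T_lip)
    also have "\<dots> < 1" using n1[OF _ x(2), of n] that by simp
    finally show ?thesis using c[OF True] x by (auto simp: etan_def)
  qed (use test_zeros(1)[of n x] that in auto)
  ultimately show ?thesis by (intro exI[of _ "max c 0 + 1"] exI[of _ "max n0 n1"]) auto
qed

lemma source_meas: "(\<lambda>x. lam x * indicator {y. U y > 0} x) \<in> borel_measurable (lebesgue_on \<Omega>)"
proof -
  have mU: "U \<in> borel_measurable (lebesgue_on \<Omega>)"
    by (rule continuous_imp_measurable_on_sets_lebesgue[OF U_cont' standing_facts(2)])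
  have "(\<lambda>x. indicator {0<..} (U x) :: real) \<in> borel_measurable (lebesgue_on \<Omega>)"
    using measurable_compose[OF mU borel_measurable_indicator[of "{0<..}"]] by simp
  moreover have "(\<lambda>x. indicator {0<..} (U x) :: real) = indicator {y. U y > 0}" by (auto simp: indicator_def)
  ultimately show ?thesis using lam_meas by auto
qed

lemma source_bound: "x \<in> \<Omega> \<Longrightarrow> \<bar>lam x * indicator {y. U y > 0} x\<bar> \<le> \<Lambda>"
  using lam_bd[of x] by (auto simp: indicator_def)

lemma integrable_eta: "integrable (lebesgue_on \<Omega>) eta"
  "integrable (lebesgue_on \<Omega>) (\<lambda>x. lam x * indicator {y. U y > 0} x * eta x)"
proof -
  obtain c where c: "\<And>x. \<bar>eta x\<bar> \<le> c" using eta_bound by blast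
  show i: "integrable (lebesgue_on \<Omega>) eta"
    by (rule integrable_lebesgue_on_bounded[OF test_measurable(2) standing_facts(1), of c]) (use c in auto)
  show "integrable (lebesgue_on \<Omega>) (\<lambda>x. lam x * indicator {y. U y > 0} x * eta x)"
    using integrable_mult_bounded[OF i source_meas AE_I2, of \<Lambda>] source_bound by simp
qed

text \<open>Each \<open>etan n\<close> with large n is admissible in the weak equation. The flux
  lies in the conjugate Lebesgue space, so the left side passes to the limit by weak convergence;
  the source term is dominated.\<close>

lemma tested_equation:
  "(\<integral>x. flux x \<bullet> Deta x \<partial>lebesgue_on \<Omega>) = - (\<integral>x. lam x * indicator {y. U y > 0} x * eta x \<partial>lebesgue_on \<Omega>)"
proof -
  let ?M = "lebesgue_on \<Omega>"
  obtain c n1 where c: "\<And>n x. n \<ge> n1 \<Longrightarrow> \<bar>etan n x\<bar> \<le> c" and n1: "n1 \<ge> n0" using eta_bound by blast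
  have c0: "c \<ge> 0" using c[of n1 undefined] by simp
  have 1: "(\<integral>x. flux x \<bullet> grad (etan n) x \<partial>?M) = - (\<integral>x. lam x * indicator {y. U y > 0} x * etan n x \<partial>?M)" if "n \<ge> n1" for n
    using equation[OF etan_C1_0(2), of n] that n1 unfolding flux_def by simp
  have "(\<lambda>n. \<integral>x. lam x * indicator {y. U y > 0} x * etan (n + n1) x \<partial>?M) \<longlonglongrightarrow> (\<integral>x. lam x * indicator {y. U y > 0} x * eta x \<partial>?M)"
  proof (rule integral_dominated_convergence[where w="\<lambda>x. \<bar>\<Lambda>\<bar> * c"])
    show "integrable ?M (\<lambda>x. \<bar>\<Lambda>\<bar> * c)" using standing_facts(1) by (intro integrable_lebesgue_on_bounded[of _ _ "\<bar>\<Lambda>\<bar> * c"]) (use c0 in auto)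
    show "AE x in ?M. (\<lambda>n. lam x * indicator {y. U y > 0} x * etan (n + n1) x) \<longlonglongrightarrow> lam x * indicator {y. U y > 0} x * eta x"
      using test_limits(1) by (intro AE_I2 tendsto_mult_left LIMSEQ_ignore_initial_segment)
    show "AE x in ?M. norm (lam x * indicator {y. U y > 0} x * etan (n + n1) x) \<le> \<bar>\<Lambda>\<bar> * c" for n
    proof (rule AE_I2)
      fix x assume "x \<in> space ?M"
      then have "\<bar>lam x * indicator {y. U y > 0} x\<bar> \<le> \<bar>\<Lambda>\<bar>" using source_bound[of x] by auto
      then show "norm (lam x * indicator {y. U y > 0} x * etan (n + n1) x) \<le> \<bar>\<Lambda>\<bar> * c"
        unfolding real_norm_def abs_mult[of _ "etan _ _"] using c[of "n + n1" x] by (intro mult_mono) auto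
    qed
  next
    show "(\<lambda>x. lam x * indicator {y. U y > 0} x * etan (n + n1) x) \<in> borel_measurable ?M" for n
      by (rule borel_measurable_times[OF source_meas test_measurable(1)])
  qed (rule borel_measurable_times[OF source_meas test_measurable(2)])
  then have "(\<lambda>n. \<integral>x. flux x \<bullet> grad (etan (n + n1)) x \<partial>?M) \<longlonglongrightarrow> - (\<integral>x. lam x * indicator {y. U y > 0} x * eta x \<partial>?M)"
    by (simp add: 1 tendsto_minus)
  moreover have "(\<lambda>n. \<integral>x. flux x \<bullet> grad (etan (n + n1)) x \<partial>?M) \<longlonglongrightarrow> (\<integral>x. flux x \<bullet> Deta x \<partial>?M)"
    by (rule LIMSEQ_ignore_initial_segment[OF grad_etan_weak[OF flux_Lq]])
  ultimately show ?thesis by (rule LIMSEQ_unique[rotated])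
qed

text \<open>The approximants are extended by zero to the whole space, so the estimate also holds for
  points whose joining segment leaves \<Omega>. The bound \<open>B'\<close> on their gradients
  serves domination only and is absent from the conclusion.\<close>

lemma Morrey_eta:
  "\<bar>eta x - eta y\<bar> \<le> 8 * DIM('a) * norm (x - y) powr (1 - DIM('a) / p) * (\<integral>x. norm (Deta x) powr p \<partial>lebesgue_on \<Omega>) powr (1/p)"
proof -
  let ?M = "lebesgue_on \<Omega>"
  obtain c where c: "c \<ge> 0" "\<And>x. norm (hK x) \<le> c" using hK_bound by blast
  have p0: "p \<ge> 0" using standing_facts by simp
  have ih: "integrable ?M (\<lambda>x. norm (hK x) powr p)"
    by (rule integrable_lebesgue_on_bounded[OF _ standing_facts(1), of _ "c powr p"]) (use test_measurable c standing_facts in \<open>auto intro!: powr_mono2\<close>)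
  obtain B where B: "\<And>n. integrable ?M (\<lambda>x. norm (grad (f n) x) powr p)" "\<And>n. (\<integral>x. norm (grad (f n) x) powr p \<partial>?M) \<le> B"
    using f_bound by blast
  have gf: "grad (f n) \<in> borel_measurable ?M" for n
    by (intro continuous_imp_measurable_on_sets_lebesgue standing_facts f_cont)
  define B' where "B' = 2 powr p * (B + (\<integral>x. norm (hK x) powr p \<partial>?M))"
  have bound: "(\<integral>x. norm (grad (etan n) x) powr p \<partial>?M) \<le> B'" if n: "n \<ge> n0" for n
  proof -
    have "(\<integral>x. norm (grad (etan n) x) powr p \<partial>?M) \<le> (\<integral>x. norm (grad (f n) x - hK x) powr p \<partial>?M)"
    proof (rule integral_mono)
      show "integrable ?M (\<lambda>x. norm (grad (etan n) x) powr p)" by (rule grad_C1_0_Lp(2)[OF etan_C1_0(2)[OF n] standing_facts(1) p0])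
      show "integrable ?M (\<lambda>x. norm (grad (f n) x - hK x) powr p)" by (rule Lp_sum(3)[OF gf B(1) test_measurable(5) ih p0])
      fix x
      have "norm (grad (etan n) x) \<le> norm (grad (f n) x - hK x)"
        using theta_bounds(1)[of n x] by (auto simp: etan_C1_0(3)[OF n] intro!: mult_left_le_one_le)
      then show "norm (grad (etan n) x) powr p \<le> norm (grad (f n) x - hK x) powr p" using p0 by (intro powr_mono2) auto
    qed
    also have "\<dots> \<le> 2 powr p * ((\<integral>x. norm (grad (f n) x) powr p \<partial>?M) + (\<integral>x. norm (hK x) powr p \<partial>?M))"
      by (rule Lp_sum(4)[OF gf B(1) test_measurable(5) ih p0])
    also have "\<dots> \<le> B'" unfolding B'_def using B(2)[of n] by (intro mult_left_mono) auto
    finally show ?thesis .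
  qed
  show ?thesis
  proof (rule Morrey_weak[OF \<Omega>(1,2) standing_facts(4), of "\<lambda>n. etan (n + n0)" eta Deta B'])
    show "C1_0 \<Omega> (etan (n + n0))" for n by (rule etan_C1_0) simp
    show "(\<lambda>j. etan (j + n0) x) \<longlonglongrightarrow> eta x" for x by (rule LIMSEQ_ignore_initial_segment[OF test_limits(1)])
    show "(\<integral>x. norm (grad (etan (j + n0)) x) powr p \<partial>?M) \<le> B'" for j by (rule bound) simp
    fix \<psi> :: "'a \<Rightarrow> 'a" and c
    assume \<psi>: "\<psi> \<in> borel_measurable ?M" "\<And>x. norm (\<psi> x) \<le> c"
    have "integrable ?M (\<lambda>x. norm (\<psi> x) powr (p / (p - 1)))"
      by (rule integrable_lebesgue_on_bounded[OF _ standing_facts(1), of _ "c powr (p / (p - 1))"])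
        (use \<psi> standing_facts(3) in \<open>auto intro!: powr_mono2\<close>)
    then show "(\<lambda>j. \<integral>x. \<psi> x \<bullet> grad (etan (j + n0)) x \<partial>?M) \<longlonglongrightarrow> (\<integral>x. \<psi> x \<bullet> Deta x \<partial>?M)"
      by (intro LIMSEQ_ignore_initial_segment[OF grad_etan_weak] \<psi>)
  qed (use test_measurable(6) Deta_Lp in auto)
qed

end


section \<open>Energy estimate and modulus of continuity\<close>

text \<open>With c = k/(2 L) and L \<le> L^p the hypothesis becomes c^p \<le> 2 m + 2 p B c. If c >
  1, the right side is at most (2 m + 2 p B) c, and dividing by c leaves the power p - 1.\<close>

lemma energy_arith:
  fixes k L m B p :: real
  assumes k: "k \<ge> 0" and L: "L \<ge> 1" and m: "m \<ge> 0" and B: "B \<ge> 0" and p: "p > 1"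
    and le: "k powr p \<le> 2 powr p * (2 * m * L powr p + p * B * k)"
  shows "k \<le> 2 * L * max 1 ((2 * m + 2 * p * B) powr (1 / (p - 1)))"
proof -
  define c where "c = k / (2 * L)"
  have kc: "k = 2 * L * c" and c0: "c \<ge> 0" using L k by (auto simp: c_def)
  have "c \<le> max 1 ((2 * m + 2 * p * B) powr (1 / (p - 1)))"
  proof (cases "c \<le> 1")
    case False
    have Lp: "L powr p \<ge> L"
      using powr_mono[of 1 p L] L p by simp
    have "(2 powr p * L powr p) * c powr p = k powr p" using L c0 by (simp add: kc powr_mult)
    also have "\<dots> \<le> 2 powr p * (2 * m * L powr p + p * B * (2 * L * c))" using le by (simp add: kc)
    also have "\<dots> \<le> 2 powr p * (2 * m * L powr p * c + p * B * (2 * L powr p * c))"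
    proof (intro mult_left_mono add_mono)
      have "2 * m * L powr p * 1 \<le> 2 * m * L powr p * c" using False m by (intro mult_left_mono) auto
      then show "2 * m * L powr p \<le> 2 * m * L powr p * c" by simp
      show "2 * L * c \<le> 2 * L powr p * c" using Lp c0 by (intro mult_right_mono) auto
    qed (use p B in auto)
    also have "\<dots> = (2 powr p * L powr p) * ((2 * m + 2 * p * B) * c)" by (simp add: algebra_simps)
    finally have "c powr p \<le> (2 * m + 2 * p * B) * c" using L by simp
    moreover have "c powr p = c powr (p - 1) * c" using False by (simp add: powr_diff)
    ultimately have "c powr (p - 1) \<le> 2 * m + 2 * p * B" using False by simp
    then have "(c powr (p - 1)) powr (1 / (p - 1)) \<le> (2 * m + 2 * p * B) powr (1 / (p - 1))"
      using p by (intro powr_mono2) auto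
    then have "c \<le> (2 * m + 2 * p * B) powr (1 / (p - 1))" using p False by (simp add: powr_powr)
    then show ?thesis by simp
  qed simp
  then have "2 * L * c \<le> 2 * L * max 1 ((2 * m + 2 * p * B) powr (1 / (p - 1)))" using L by (intro mult_left_mono) auto
  then show ?thesis by (simp add: kc)
qed

text \<open>An odd C^1 soft threshold: zero on [-d, d], slope between 0 and 1, within 2 d of the
  identity. Its dead zone absorbs the mismatch with the boundary datum, which gives the truncated
  difference compact support in \<Omega>.\<close>

definition trunc :: "real \<Rightarrow> real \<Rightarrow> real" where "trunc d s = tau d (s - d) - tau d (- s - d)"
definition trunc' :: "real \<Rightarrow> real \<Rightarrow> real" where "trunc' d s = tau' d (s - d) + tau' d (- s - d)"

lemma trunc_facts:
  assumes d: "d > 0"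
  shows "(trunc d has_real_derivative trunc' d s) (at s)" and "continuous_on UNIV (trunc' d)"
    and "0 \<le> trunc' d s" and "trunc' d s \<le> 1" and "\<bar>s\<bar> \<le> d \<Longrightarrow> trunc d s = 0 \<and> trunc' d s = 0"
    and "\<bar>trunc d s - s\<bar> \<le> 2 * d"
proof -
  have "((\<lambda>s. s - d) has_real_derivative 1) (at s)" "((\<lambda>s. - s - d) has_real_derivative - 1) (at s)"
    by (auto intro!: derivative_eq_intros)
  from DERIV_diff[OF DERIV_chain2[OF tau_DERIV[OF d] this(1)] DERIV_chain2[OF tau_DERIV[OF d] this(2)]]
  show "(trunc d has_real_derivative trunc' d s) (at s)" unfolding trunc_def[abs_def] trunc'_def by simp
  show "continuous_on UNIV (trunc' d)" unfolding trunc'_def[abs_def]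
    by (intro continuous_intros continuous_on_compose2[OF continuous_tau'[OF d, of UNIV]]) auto
  show "0 \<le> trunc' d s" using tau'_bounds(1)[OF d] by (simp add: trunc'_def)
  show "trunc' d s \<le> 1"
    using tau'_bounds(2)[OF d] tau_nonpos(2)[OF d, of "s - d"] tau_nonpos(2)[OF d, of "- s - d"] d
    by (cases "s \<ge> 0") (auto simp: trunc'_def)
  show "\<bar>s\<bar> \<le> d \<Longrightarrow> trunc d s = 0 \<and> trunc' d s = 0"
    using tau_nonpos[OF d, of "s - d"] tau_nonpos[OF d, of "- s - d"] by (auto simp: trunc_def trunc'_def)
  show "\<bar>trunc d s - s\<bar> \<le> 2 * d"
  proof -
    consider "\<bar>s\<bar> \<le> d" | "s > d" | "s < - d" by linarith
    then show ?thesis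
    proof cases
      case 1
      then show ?thesis using tau_nonpos(1)[OF d, of "s - d"] tau_nonpos(1)[OF d, of "- s - d"] by (auto simp: trunc_def)
    next
      case 2
      then show ?thesis using tau_nonpos(1)[OF d, of "- s - d"] tau_bounds[OF d, of "s - d"] d by (auto simp: trunc_def)
    next
      case 3
      then show ?thesis using tau_nonpos(1)[OF d, of "s - d"] tau_bounds[OF d, of "- s - d"] d by (auto simp: trunc_def)
    qed
  qed
qed

context weak_sol
begin

text \<open>Morrey's inequality bounds the supremum of \<open>eta\<close> by a multiple of S^(1/p),
  where S is the energy of \<open>Deta\<close>. The source thus adds only a term linear in S^(1/p)
  to an upper bound for S itself, and \<open>energy_arith\<close> closes the loop. \<open>B\<close>
  collects the constants of that term: the bound on \<open>lam\<close>, the volume of \<Omega> and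
  the supremum estimate.\<close>

lemma modulus_eps:
  fixes m B L R \<delta> :: real
  assumes L: "L \<ge> 1" and g: "L-lipschitz_on (frontier \<Omega>) g" and R: "\<Omega> \<subseteq> ball 0 R" "R \<ge> 1" and d: "\<delta> > 0"
    and xy: "x \<in> closure \<Omega>" "y \<in> closure \<Omega>"
  defines "m \<equiv> measure lebesgue \<Omega>"
  defines "B \<equiv> \<Lambda> * (m * (16 * DIM('a) * R))"
  shows "\<bar>U x - U y\<bar> \<le> L * norm (x - y) +
     8 * DIM('a) * norm (x - y) powr (1 - DIM('a) / p) * (2 * L * max 1 ((2 * m + 2 * p * B) powr (1 / (p - 1)))) + 5 * \<delta>"
proof -
  let ?M = "lebesgue_on \<Omega>"
  have fne: "frontier \<Omega> \<noteq> {}" using \<Omega> by (simp add: frontier_eq_empty) (metis not_bounded_UNIV)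
  obtain H where H: "L-lipschitz_on UNIV H" "\<And>x. x \<in> frontier \<Omega> \<Longrightarrow> H x = g x"
    using McShane_extension[OF g fne] by blast
  have "\<exists>F. Ck_on 1 UNIV F \<and> (\<forall>x\<in>closure \<Omega>. \<bar>F x - H x\<bar> \<le> \<delta>/4 \<and> norm (grad F x) \<le> L)"
    by (rule lipschitz_smooth_approx[OF H(1)]) (use \<Omega> d in auto)
  then obtain F where F: "Ck_on 1 UNIV F" "\<And>x. x \<in> closure \<Omega> \<Longrightarrow> \<bar>F x - H x\<bar> \<le> \<delta>/4"
    "\<And>x. x \<in> closure \<Omega> \<Longrightarrow> norm (grad F x) \<le> L" by blast
  have cF: "continuous_on S F" for S using Ck_on_1_D(3)[OF F(1) open_UNIV] continuous_on_subset by blast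
  \<comment> \<open>On the frontier |U - F| \<le> \<delta>/4, so this compact set stays inside
    \<Omega>. Off it, a further error \<delta>/2 between \<open>f n\<close> and \<open>U\<close>
    still leaves the difference in the dead zone of \<open>trunc \<delta>\<close>.\<close>
  define K where "K = {x \<in> closure \<Omega>. \<delta>/2 \<le> \<bar>U x - F x\<bar>}"
  have K1: "compact K"
  proof -
    have "closed (closure \<Omega> \<inter> (\<lambda>x. \<bar>U x - F x\<bar>) -` {\<delta>/2..})"
      by (intro continuous_closed_preimage continuous_intros U_cont cF) auto
    moreover have "K = closure \<Omega> \<inter> (\<lambda>x. \<bar>U x - F x\<bar>) -` {\<delta>/2..}" by (auto simp: K_def)
    moreover have "bounded K" using \<Omega>(2) bounded_closure bounded_subset[of "closure \<Omega>" K] by (auto simp: K_def)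
    ultimately show ?thesis by (simp add: compact_eq_bounded_closed)
  qed
  have fr: "\<bar>U x - F x\<bar> \<le> \<delta>/4" if "x \<in> frontier \<Omega>" for x
  proof -
    have "x \<in> closure \<Omega>" using that by (simp add: frontier_def)
    then show ?thesis using F(2)[of x] U_bd[OF that] H(2)[OF that] by (simp add: abs_minus_commute)
  qed
  have K2: "K \<subseteq> \<Omega>"
  proof
    fix x assume x: "x \<in> K"
    show "x \<in> \<Omega>"
    proof (rule ccontr)
      assume "x \<notin> \<Omega>"
      then have "x \<in> frontier \<Omega>" using x \<Omega> by (auto simp: frontier_def K_def interior_open)
      from fr[OF this] show False using x d by (auto simp: K_def)
    qed
  qed
  obtain n0 where n0: "\<And>n x. n \<ge> n0 \<Longrightarrow> x \<in> closure \<Omega> \<Longrightarrow> \<bar>f n x - U x\<bar> < \<delta>/2"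
    using f_uniformly_close[of "\<delta>/2"] d by auto
  interpret T: weak_sol_test \<Omega> p lam g U Du f \<Lambda> \<Omega> K F "trunc \<delta>" "trunc' \<delta>" n0
  proof unfold_locales
    show "open \<Omega>" "compact K" "K \<subseteq> \<Omega>" "Ck_on 1 \<Omega> F" using \<Omega> K1 K2 Ck_on_mono[OF F(1)] by auto
    show "(trunc \<delta> has_real_derivative trunc' \<delta> s) (at s)" "continuous_on UNIV (trunc' \<delta>)" for s
      by (rule trunc_facts[OF d])+
    show "\<bar>trunc' \<delta> s\<bar> \<le> 1" for s using trunc_facts(3,4)[OF d, of s] by simp
    fix n x assume n: "n \<ge> n0" and x: "x \<in> \<Omega>" "x \<notin> K"
    then have xc: "x \<in> closure \<Omega>" using closure_subset by blast
    then have "\<bar>U x - F x\<bar> < \<delta>/2" using x by (auto simp: K_def)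
    then have "\<bar>f n x - F x\<bar> \<le> \<delta>" using n0[OF n xc] by linarith
    then show "trunc \<delta> (f n x - F x) = 0 \<and> trunc' \<delta> (f n x - F x) = 0" by (rule trunc_facts(5)[OF d])
  qed auto
  have p5: "p \<ge> 5" using standing_facts by simp
  have th: "0 \<le> T.theta x" "T.theta x \<le> 1" for x
    using trunc_facts(3,4)[OF d] by (auto simp: T.theta_def)
  have m0: "m \<ge> 0" by (simp add: m_def)
  have \<Lambda>0: "\<Lambda> \<ge> 0" using lam_bd \<Omega>(3) by (meson all_not_in_conv less_le_trans less_imp_le)
  have B0: "B \<ge> 0" using m0 \<Lambda>0 R by (simp add: B_def)
  have hL: "norm (T.hK x) \<le> L" for x
    using F(3)[of x] K2 closure_subset L by (auto simp: T.hK_def)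
  define S where "S = (\<integral>x. norm (T.Deta x) powr p \<partial>?M)"
  have S0: "S \<ge> 0" unfolding S_def by (rule integral_nonneg_AE) auto
  have c1: "integrable ?M (\<lambda>_. c)" "(\<integral>x. c \<partial>?M) = m * c" for c :: real
  proof -
    show "integrable ?M (\<lambda>_. c)" using standing_facts(1) by (intro integrable_lebesgue_on_bounded[of _ _ "\<bar>c\<bar>"]) auto
    show "(\<integral>x. c \<partial>?M) = m * c" using standing_facts(2) by (simp add: m_def measure_restrict_space)
  qed
  \<comment> \<open>16 N R is 8 N times 2 R; the power of 2 R is replaced by 2 R itself because 2 R
    \<ge> 1 and the exponent is at most 1.\<close>
  have eta_le: "\<bar>T.eta x\<bar> \<le> (16 * DIM('a) * R) * S powr (1/p)" for x
  proof -
    have "\<bar>T.eta x\<bar> \<le> 8 * DIM('a) * (2 * R) powr (1 - DIM('a) / p) * S powr (1/p)"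
      by (rule sup_bound_from_Hoelder[OF R(1) _ _ T.Morrey_eta[folded S_def]])
        (use R T.test_zeros(3) K2 standing_facts(4) p5 in \<open>auto simp: field_simps\<close>)
    also have "\<dots> \<le> 8 * DIM('a) * (2 * R) * S powr (1/p)"
      using R p5 powr_mono[of "1 - DIM('a) / p" 1 "2 * R"] by (intro mult_right_mono mult_left_mono) auto
    finally show ?thesis by simp
  qed
  have int_eta: "(\<integral>x. \<bar>T.eta x\<bar> \<partial>?M) \<le> m * (16 * DIM('a) * R) * S powr (1/p)"
  proof -
    have "(\<integral>x. \<bar>T.eta x\<bar> \<partial>?M) \<le> (\<integral>x. (16 * DIM('a) * R) * S powr (1/p) \<partial>?M)"
      by (rule integral_mono[OF _ c1(1) eta_le]) (use T.integrable_eta in auto)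
    then show ?thesis unfolding c1(2) by (simp add: mult.assoc)
  qed
  have iD: "integrable ?M (\<lambda>x. T.theta x * norm (Du x) powr p)"
    using integrable_mult_bounded[OF Du(2) T.test_measurable(4), of 1] T.theta_bounds(2) by auto
  have iT: "integrable ?M T.theta"
    by (rule integrable_lebesgue_on_bounded[OF T.test_measurable(4) standing_facts(1), of 1]) (use T.theta_bounds in auto)
  have point: "T.theta x * (norm (Du x) powr p / p) - T.theta x * (L powr p / p) \<le> flux x \<bullet> T.Deta x" for x
  proof -
    let ?a = "norm (Du x)"
    \<comment> \<open>Young's inequality with exponents p/(p-1) and p. It takes away (1 - 1/p)
      |Du|^p, so that |Du|^p / p survives; clearing this denominator costs a factor p, whose p-th
      root tends to 1.\<close>
    have Y: "?a powr (p - 1) * L \<le> (1 - 1/p) * ?a powr p + L powr p / p"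
    proof -
      have "?a powr (p - 1) * L \<le> (?a powr (p - 1)) powr (p / (p - 1)) / (p / (p - 1)) + L powr p / p"
        by (rule Youngs_inequality) (use p5 L in \<open>auto simp: field_simps\<close>)
      moreover have "(?a powr (p - 1)) powr (p / (p - 1)) = ?a powr p" using p5 by (simp add: powr_powr)
      moreover have "?a powr p / (p / (p - 1)) = (1 - 1/p) * ?a powr p" using p5 by (simp add: field_simps)
      ultimately show ?thesis by simp
    qed
    have a: "flux x \<bullet> Du x = ?a powr p"
    proof (cases "Du x = 0")
      case False
      have "flux x \<bullet> Du x = ?a powr (p - 2) * ?a powr 2"
        using False by (simp add: flux_def dot_square_norm powr_numeral)
      also have "\<dots> = ?a powr p" by (simp only: powr_add[symmetric]) simp
      finally show ?thesis .
    qed (simp add: flux_def)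
    have b: "flux x \<bullet> T.hK x \<le> ?a powr (p - 1) * L"
    proof -
      have "flux x \<bullet> T.hK x \<le> norm (flux x) * norm (T.hK x)" by (rule norm_cauchy_schwarz)
      also have "\<dots> \<le> norm (flux x) * L" by (intro mult_left_mono hL) auto
      also have "norm (flux x) = ?a powr (p - 1)"
      proof (cases "Du x = 0")
        case False
        then have "norm (flux x) = ?a powr (p - 2) * ?a powr 1" by (simp add: flux_def)
        also have "\<dots> = ?a powr (p - 1)" by (simp only: powr_add[symmetric]) simp
        finally show ?thesis .
      qed (simp add: flux_def)
      finally show ?thesis .
    qed
    have "?a powr p / p - L powr p / p \<le> flux x \<bullet> (Du x - T.hK x)"
      using Y a b by (simp add: inner_diff_right left_diff_distrib)
    then have "T.theta x * (?a powr p / p - L powr p / p) \<le> T.theta x * (flux x \<bullet> (Du x - T.hK x))"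
      by (intro mult_left_mono th)
    then show ?thesis by (simp add: T.Deta_def right_diff_distrib)
  qed
  have i2: "integrable ?M (\<lambda>x. flux x \<bullet> T.Deta x)"
    using Hoelder_vector(1)[OF _ flux_Lq T.test_measurable(6) T.Deta_Lp, of "\<lambda>_. 1" 1] p5 by simp
  have E1: "(\<integral>x. T.theta x * norm (Du x) powr p \<partial>?M) \<le> m * L powr p + p * \<Lambda> * (\<integral>x. \<bar>T.eta x\<bar> \<partial>?M)"
  proof -
    have "(\<integral>x. T.theta x * (norm (Du x) powr p / p) - T.theta x * (L powr p / p) \<partial>?M) \<le> (\<integral>x. flux x \<bullet> T.Deta x \<partial>?M)"
      by (rule integral_mono[OF _ i2 point]) (use iD iT in auto)
    also have "\<dots> = - (\<integral>x. lam x * indicator {y. U y > 0} x * T.eta x \<partial>?M)" by (rule T.tested_equation)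
    also have "\<dots> \<le> \<bar>\<integral>x. lam x * indicator {y. U y > 0} x * T.eta x \<partial>?M\<bar>" by linarith
    also have "\<dots> \<le> (\<integral>x. \<bar>lam x * indicator {y. U y > 0} x * T.eta x\<bar> \<partial>?M)" by (rule integral_abs_bound)
    also have "\<dots> \<le> (\<integral>x. \<Lambda> * \<bar>T.eta x\<bar> \<partial>?M)"
    proof (rule integral_mono)
      show "\<bar>lam x * indicator {y. U y > 0} x * T.eta x\<bar> \<le> \<Lambda> * \<bar>T.eta x\<bar>" if "x \<in> space ?M" for x
        unfolding abs_mult[of _ "T.eta x"] using T.source_bound[of x] that by (intro mult_right_mono) auto
    qed (use T.integrable_eta in auto)
    finally have 1: "(\<integral>x. T.theta x * (norm (Du x) powr p / p) - T.theta x * (L powr p / p) \<partial>?M) \<le> \<Lambda> * (\<integral>x. \<bar>T.eta x\<bar> \<partial>?M)"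
      by simp
    have "(\<integral>x. T.theta x * (norm (Du x) powr p / p) - T.theta x * (L powr p / p) \<partial>?M) =
       (\<integral>x. T.theta x * norm (Du x) powr p \<partial>?M) / p - (\<integral>x. T.theta x \<partial>?M) * (L powr p / p)"
      using iD iT by simp
    moreover have "(\<integral>x. T.theta x \<partial>?M) \<le> m"
      using integral_mono[OF iT c1(1)[of 1]] th unfolding c1(2) by simp
    then have "(\<integral>x. T.theta x \<partial>?M) * (L powr p / p) \<le> m * (L powr p / p)" using p5 by (intro mult_right_mono) auto
    ultimately have "(\<integral>x. T.theta x * norm (Du x) powr p \<partial>?M) / p \<le> m * (L powr p / p) + \<Lambda> * (\<integral>x. \<bar>T.eta x\<bar> \<partial>?M)"
      using 1 by linarith
    then show ?thesis using p5 by (simp add: field_simps)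
  qed
  have "S \<le> (\<integral>x. 2 powr p * (T.theta x * norm (Du x) powr p + L powr p) \<partial>?M)"
    unfolding S_def
  proof (rule integral_mono[OF T.Deta_Lp])
    show "integrable ?M (\<lambda>x. 2 powr p * (T.theta x * norm (Du x) powr p + L powr p))"
      by (intro integrable_mult_right Bochner_Integration.integrable_add iD c1)
    fix x
    \<comment> \<open>As \<open>theta\<close> lies in [0, 1], its p-th power is at most itself; the
      energy weighted with \<open>theta\<close> to the first power is what \<open>E1\<close>
      bounds.\<close>
    have tp: "T.theta x powr p \<le> T.theta x"
      using powr_mono'[of 1 p "T.theta x"] th[of x] p5 by simp
    have "norm (T.Deta x) powr p = T.theta x powr p * norm (Du x - T.hK x) powr p"
      using th[of x] by (simp add: T.Deta_def powr_mult)
    also have "\<dots> \<le> T.theta x * (2 powr p * (norm (Du x) powr p + L powr p))"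
    proof (intro mult_mono tp)
      have "norm (Du x - T.hK x) \<le> norm (Du x) + L" using norm_triangle_ineq4[of "Du x" "T.hK x"] hL[of x] by linarith
      then have "norm (Du x - T.hK x) powr p \<le> (norm (Du x) + L) powr p" using p5 by (intro powr_mono2) auto
      also have "\<dots> \<le> 2 powr p * (norm (Du x) powr p + L powr p)" using L p5 by (intro powr_add_le) auto
      finally show "norm (Du x - T.hK x) powr p \<le> 2 powr p * (norm (Du x) powr p + L powr p)" .
    qed (use th in auto)
    also have "\<dots> = 2 powr p * (T.theta x * norm (Du x) powr p + T.theta x * L powr p)" by (simp add: algebra_simps)
    also have "\<dots> \<le> 2 powr p * (T.theta x * norm (Du x) powr p + L powr p)"
      using th[of x] by (intro mult_left_mono add_left_mono mult_left_le_one_le) auto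
    finally show "norm (T.Deta x) powr p \<le> 2 powr p * (T.theta x * norm (Du x) powr p + L powr p)" .
  qed
  also have "\<dots> = 2 powr p * ((\<integral>x. T.theta x * norm (Du x) powr p \<partial>?M) + m * L powr p)"
    by (subst integral_mult_right_zero, subst Bochner_Integration.integral_add[OF iD c1(1)], subst c1(2)) simp
  also have "\<dots> \<le> 2 powr p * (2 * m * L powr p + p * B * S powr (1/p))"
  proof (intro mult_left_mono)
    have "p * \<Lambda> * (\<integral>x. \<bar>T.eta x\<bar> \<partial>?M) \<le> p * \<Lambda> * (m * (16 * DIM('a) * R) * S powr (1/p))"
      using p5 \<Lambda>0 by (intro mult_left_mono int_eta) auto
    also have "\<dots> = p * B * S powr (1/p)" by (simp add: B_def)
    finally show "(\<integral>x. T.theta x * norm (Du x) powr p \<partial>?M) + m * L powr p \<le> 2 * m * L powr p + p * B * S powr (1/p)"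
      using E1 by simp
  qed auto
  finally have "S \<le> 2 powr p * (2 * m * L powr p + p * B * S powr (1/p))" .
  moreover have "S = (S powr (1/p)) powr p" using S0 p5 by (simp add: powr_powr)
  ultimately have Sk: "S powr (1/p) \<le> 2 * L * max 1 ((2 * m + 2 * p * B) powr (1 / (p - 1)))"
    by (intro energy_arith[OF _ L m0 B0]) (use p5 in auto)
  have close: "\<bar>U x - F x - T.eta x\<bar> \<le> 2 * \<delta>" if x: "x \<in> closure \<Omega>" for x
  proof (cases "x \<in> \<Omega>")
    case True
    then show ?thesis using trunc_facts(6)[OF d, of "U x - F x"] by (simp add: T.eta_def abs_minus_commute)
  next
    case False
    then have "x \<in> frontier \<Omega>" using x \<Omega> by (auto simp: frontier_def interior_open)
    from fr[OF this] show ?thesis using False d by (simp add: T.eta_def)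
  qed
  have "\<bar>F x - F y\<bar> \<le> L * norm (x - y) + \<delta>/2"
  proof -
    have "\<bar>H x - H y\<bar> \<le> L * norm (x - y)"
      using lipschitz_onD[OF H(1), of x y] by (simp add: dist_real_def dist_norm)
    then show ?thesis using F(2)[OF xy(1)] F(2)[OF xy(2)] by linarith
  qed
  moreover have "\<bar>T.eta x - T.eta y\<bar> \<le> 8 * DIM('a) * norm (x - y) powr (1 - DIM('a) / p) * (2 * L * max 1 ((2 * m + 2 * p * B) powr (1 / (p - 1))))"
    by (rule order_trans[OF T.Morrey_eta[folded S_def] mult_left_mono[OF Sk]]) auto
  \<comment> \<open>Error budget: 2 \<delta> at each of the two points from the truncation,
    \<delta>/2 from the mollification.\<close>
  ultimately show ?thesis using close[OF xy(1)] close[OF xy(2)] d by linarith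
qed

lemma modulus:
  fixes m B L R :: real
  assumes L: "L \<ge> 1" and g: "L-lipschitz_on (frontier \<Omega>) g" and R: "\<Omega> \<subseteq> ball 0 R" "R \<ge> 1"
    and xy: "x \<in> closure \<Omega>" "y \<in> closure \<Omega>"
  defines "m \<equiv> measure lebesgue \<Omega>"
  defines "B \<equiv> \<Lambda> * (m * (16 * DIM('a) * R))"
  shows "\<bar>U x - U y\<bar> \<le> L * norm (x - y) +
     8 * DIM('a) * norm (x - y) powr (1 - DIM('a) / p) * (2 * L * max 1 ((2 * m + 2 * p * B) powr (1 / (p - 1))))"
proof (rule field_le_epsilon)
  fix e :: real assume "e > 0"
  then show "\<bar>U x - U y\<bar> \<le> L * norm (x - y) +
     8 * DIM('a) * norm (x - y) powr (1 - DIM('a) / p) * (2 * L * max 1 ((2 * m + 2 * p * B) powr (1 / (p - 1)))) + e"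
    using modulus_eps[OF L g R _ xy, of "e/5"] by (simp add: m_def B_def)
qed

end


section \<open>Comparison with classical functions\<close>

text \<open>Away from 0 this is the chain rule for (v . v)^(s/2). At 0 the claimed derivative is
  zero and the difference quotient is |h|^(s-1).\<close>

lemma norm_powr_has_derivative:
  fixes v :: "'a::euclidean_space"
  assumes s: "s > 2"
  shows "((\<lambda>v. norm v powr s) has_derivative (\<lambda>w. s * norm v powr (s - 2) * (v \<bullet> w))) (at v)"
proof (cases "v = 0")
  case True
  have "((\<lambda>h::'a. norm h powr (s - 1)) \<longlongrightarrow> 0 powr (s - 1)) (at 0)"
    by (rule tendsto_powr'[OF _ tendsto_const]) (use s in \<open>auto intro!: tendsto_eq_intros\<close>)
  then have "((\<lambda>h::'a. norm h powr (s - 1)) \<longlongrightarrow> 0) (at 0)" using s by simp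
  then have "((\<lambda>h::'a. norm h powr s / norm h) \<longlongrightarrow> 0) (at 0)"
  proof (rule Lim_transform_eventually)
    show "\<forall>\<^sub>F h::'a in at 0. norm h powr (s - 1) = norm h powr s / norm h"
      by (auto simp: eventually_at_filter powr_diff intro!: always_eventually)
  qed
  then show ?thesis using True s by (simp add: has_derivative_at)
next
  case False
  then have v: "v \<bullet> v > 0" by simp
  have d1: "((\<lambda>v::'a. v \<bullet> v) has_derivative (\<lambda>w. 2 * (v \<bullet> w))) (at v)"
    by (auto intro!: derivative_eq_intros simp: inner_commute)
  have d2: "((\<lambda>t. t powr (s / 2)) has_real_derivative (s / 2) * (v \<bullet> v) powr (s / 2 - 1)) (at (v \<bullet> v))"
    using has_real_derivative_powr[OF v, of "s/2"] .
  have e: "(u \<bullet> u) powr r = norm u powr (2 * r)" for u :: 'a and r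
  proof -
    have "u \<bullet> u = norm u powr 2" by (cases "u = 0") (simp_all add: dot_square_norm powr_numeral)
    then show ?thesis by (simp only: powr_powr)
  qed
  from has_derivative_compose[OF d1 d2[unfolded has_field_derivative_def]]
  have "((\<lambda>v. (v \<bullet> v) powr (s / 2)) has_derivative (\<lambda>w. (s / 2) * (v \<bullet> v) powr (s / 2 - 1) * (2 * (v \<bullet> w)))) (at v)" .
  then show ?thesis by (simp add: e right_diff_distrib mult.assoc)
qed

text \<open>Replacing the inner product a . b by |a| |b| only lowers the expression, and what
  remains is the monotonicity of r^s r for r \<ge> 0.\<close>

lemma monotone_flux:
  fixes a b :: "'a::euclidean_space"
  assumes s: "s > 0"
  shows "(norm a powr s *\<^sub>R a - norm b powr s *\<^sub>R b) \<bullet> (a - b) \<ge> 0"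
proof -
  let ?A = "norm a" and ?B = "norm b"
  have "0 \<le> (?A powr s * ?A - ?B powr s * ?B) * (?A - ?B)"
  proof (cases "?A \<le> ?B")
    case True
    have "?A powr s * ?A \<le> ?B powr s * ?B" using True s by (intro mult_mono powr_mono2) auto
    then show ?thesis using True by (simp add: mult_nonpos_nonpos)
  next
    case False
    have "?B powr s * ?B \<le> ?A powr s * ?A" using False s by (intro mult_mono powr_mono2) auto
    then show ?thesis using False by simp
  qed
  also have "\<dots> = ?A powr s * (?A * ?A) + ?B powr s * (?B * ?B) - (?A powr s + ?B powr s) * (?A * ?B)"
    by (simp add: algebra_simps)
  also have "\<dots> \<le> ?A powr s * (a \<bullet> a) + ?B powr s * (b \<bullet> b) - (?A powr s + ?B powr s) * (a \<bullet> b)"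
    by (simp add: dot_square_norm power2_eq_square norm_cauchy_schwarz mult_left_mono)
  also have "\<dots> = (norm a powr s *\<^sub>R a - norm b powr s *\<^sub>R b) \<bullet> (a - b)"
    by (simp add: inner_simps algebra_simps inner_commute)
  finally show ?thesis .
qed

text \<open>Continuous functions that differ at a point differ on a nonempty open set, which is not
  negligible.\<close>

lemma continuous_AE_eq:
  fixes f g :: "'a::euclidean_space \<Rightarrow> real"
  assumes S: "open S" and f: "continuous_on S f" and g: "continuous_on S g" and ae: "AE x in lebesgue_on S. f x = g x" and x: "x \<in> S"
  shows "f x = g x"
proof (rule ccontr)
  assume ne: "f x \<noteq> g x"
  define W where "W = {x \<in> S. f x - g x \<in> - {0}}"
  have W: "open W" unfolding W_def
    using continuous_open_preimage[of S "\<lambda>x. f x - g x" "- {0}"] S f g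
    by (auto intro!: continuous_intros simp: vimage_def Int_def)
  have xW: "x \<in> W" using ne x by (simp add: W_def)
  have Ss: "S \<in> sets lebesgue" using S by auto
  have "AE x in lebesgue. x \<in> S \<longrightarrow> f x = g x" using ae Ss by (simp add: AE_restrict_space_iff)
  then have "AE x in lebesgue. x \<notin> W" by eventually_elim (auto simp: W_def)
  then have "W \<in> null_sets lebesgue" using AE_iff_null_sets[of W lebesgue] W by simp
  then show False using open_not_negligible[OF W] xW by (auto simp: negligible_iff_null_sets)
qed

definition lap :: "('a::euclidean_space \<Rightarrow> real) \<Rightarrow> 'a \<Rightarrow> real" where
  "lap h x = (\<Sum>b\<in>Basis. hess h x b b)"

text \<open>The divergence of |\<nabla>h|^(p-2) \<nabla>h written out for C^2 functions. With
  \<open>powr\<close>, both terms are 0 where the gradient vanishes.\<close>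

definition p_lap :: "real \<Rightarrow> ('a::euclidean_space \<Rightarrow> real) \<Rightarrow> 'a \<Rightarrow> real" where
  "p_lap p h x = norm (grad h x) powr (p - 2) * lap h x + (p - 2) * norm (grad h x) powr (p - 4) * inf_laplacian h x"

locale C2_fun =
  fixes \<Omega> :: "'a::euclidean_space set" and h :: "'a \<Rightarrow> real"
  assumes open_dom: "open \<Omega>" and C2: "Ck_on 2 \<Omega> h"
begin

lemma C2_D: "h differentiable_on \<Omega>" "Ck_on 1 \<Omega> (\<lambda>x. frechet_derivative h (at x) v)"
  using C2 by (auto simp: numeral_2_eq_2)

lemma h_C1: "Ck_on 1 \<Omega> h"
  using C2_D Ck_on_1_D(3)[OF C2_D(2) open_dom] by auto

lemma frechet_eq: "x \<in> \<Omega> \<Longrightarrow> frechet_derivative h (at x) v = grad h x \<bullet> v"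
  by (rule frechet_derivative_eq_grad) (use C2_D(1) open_dom in \<open>auto simp: differentiable_on_eq_differentiable_at\<close>)

lemma partial_has_derivative:
  assumes "x \<in> \<Omega>"
  shows "((\<lambda>y. grad h y \<bullet> v) has_derivative (\<lambda>w. hess h x v w)) (at x)"
proof -
  have "((\<lambda>y. frechet_derivative h (at y) v) has_derivative (\<lambda>w. grad (\<lambda>y. frechet_derivative h (at y) v) x \<bullet> w)) (at x)"
    by (rule Ck_on_1_D(1)[OF C2_D(2) open_dom assms])
  then have 1: "((\<lambda>y. frechet_derivative h (at y) v) has_derivative (\<lambda>w. hess h x v w)) (at x)"
    unfolding hess_def using frechet_derivative_at by metis
  show ?thesis
    by (rule has_derivative_transform_within_open[OF 1 open_dom assms]) (simp add: frechet_eq)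
qed

lemma hess_eq_inner: "x \<in> \<Omega> \<Longrightarrow> hess h x v w = (\<Sum>b\<in>Basis. hess h x v b *\<^sub>R b) \<bullet> w"
  by (rule linear_functional_eq_inner) (rule has_derivative_linear[OF partial_has_derivative])

lemma hess_continuous: "continuous_on \<Omega> (\<lambda>x. hess h x v w)"
proof -
  have "continuous_on \<Omega> (\<lambda>x. grad (\<lambda>y. frechet_derivative h (at y) v) x \<bullet> w)"
    by (intro continuous_intros Ck_on_1_D(2)[OF C2_D(2) open_dom])
  then show ?thesis
  proof (rule continuous_on_eq)
    fix x assume "x \<in> \<Omega>"
    show "grad (\<lambda>y. frechet_derivative h (at y) v) x \<bullet> w = hess h x v w"
      unfolding hess_def using frechet_derivative_at[OF Ck_on_1_D(1)[OF C2_D(2) open_dom \<open>x \<in> \<Omega>\<close>]] by metis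
  qed
qed

text \<open>As a derivative, \<open>hess\<close> is linear in its last argument. Linearity in the
  first comes from differentiating the expansion of \<nabla>h . v into partial derivatives and
  uniqueness of the derivative.\<close>

lemma hess_sum_left:
  assumes x: "x \<in> \<Omega>"
  shows "hess h x v w = (\<Sum>b\<in>Basis. (v \<bullet> b) * hess h x b w)"
proof -
  have "((\<lambda>y. \<Sum>b\<in>Basis. (v \<bullet> b) * (grad h y \<bullet> b)) has_derivative (\<lambda>w. \<Sum>b\<in>Basis. (v \<bullet> b) * hess h x b w)) (at x)"
    by (intro has_derivative_sum has_derivative_mult_right partial_has_derivative x)
  moreover have "(\<lambda>y. \<Sum>b\<in>Basis. (v \<bullet> b) * (grad h y \<bullet> b)) = (\<lambda>y. grad h y \<bullet> v)"
    by (simp add: euclidean_inner[of _ v] mult.commute)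
  ultimately show ?thesis
    using has_derivative_unique[OF partial_has_derivative[OF x, of v]] by metis
qed

text \<open>The directions in \<open>inf_laplacian\<close> vary with the point. Expanded into fixed
  directions, its continuity and its vanishing at critical points become visible.\<close>

lemma inf_laplacian_eq:
  assumes x: "x \<in> \<Omega>"
  shows "inf_laplacian h x = (\<Sum>c\<in>Basis. (grad h x \<bullet> c) * (\<Sum>b\<in>Basis. (grad h x \<bullet> b) * hess h x b c))"
proof -
  have "inf_laplacian h x = (\<Sum>c\<in>Basis. hess h x (grad h x) c * (grad h x \<bullet> c))"
    unfolding inf_laplacian_def
    by (subst hess_eq_inner[OF x]) (simp only: inner_sum_left inner_scaleR_left inner_commute[of "grad h x"])
  then show ?thesis by (subst (asm) hess_sum_left[OF x]) (simp add: mult.commute)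
qed

lemma C2_continuous: "continuous_on \<Omega> (grad h)" "continuous_on \<Omega> h" "continuous_on \<Omega> (lap h)" "continuous_on \<Omega> (inf_laplacian h)"
proof -
  show c: "continuous_on \<Omega> (grad h)" "continuous_on \<Omega> h" using Ck_on_1_D(2,3)[OF h_C1 open_dom] by auto
  show "continuous_on \<Omega> (lap h)" unfolding lap_def[abs_def] by (intro continuous_intros hess_continuous)
  have "continuous_on \<Omega> (\<lambda>x. \<Sum>c\<in>Basis. (grad h x \<bullet> c) * (\<Sum>b\<in>Basis. (grad h x \<bullet> b) * hess h x b c))"
    by (intro continuous_intros hess_continuous c)
  then show "continuous_on \<Omega> (inf_laplacian h)"
    by (rule continuous_on_eq) (simp add: inf_laplacian_eq)
qed

lemma cont_powr: "s > 0 \<Longrightarrow> continuous_on \<Omega> (\<lambda>x. norm (grad h x) powr s)"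
  by (intro continuous_on_powr' continuous_intros C2_continuous) auto

lemma cont_p_lap: "p > 4 \<Longrightarrow> continuous_on \<Omega> (p_lap p h)"
  unfolding p_lap_def[abs_def] by (intro continuous_intros cont_powr C2_continuous) auto

text \<open>\<open>X\<close> is one component of the p-flux. Only its derivative in its own
  direction \<open>c\<close> is recorded, since these derivatives sum to the divergence. With p > 4
  the exponent p - 2 exceeds 2, as \<open>norm_powr_has_derivative\<close> asks.\<close>

lemma p_flux_derivative:
  assumes p: "p > 4" and c: "c \<in> Basis"
  defines "X \<equiv> \<lambda>x. norm (grad h x) powr (p - 2) * (grad h x \<bullet> c)"
  shows "Ck_on 1 \<Omega> X"
    and "x \<in> \<Omega> \<Longrightarrow> grad X x \<bullet> c = (p - 2) * norm (grad h x) powr (p - 4) * (grad h x \<bullet> c) * (\<Sum>b\<in>Basis. (grad h x \<bullet> b) * hess h x b c)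
       + norm (grad h x) powr (p - 2) * hess h x c c"
proof -
  define H where "H = (\<lambda>x v. \<Sum>e\<in>Basis. hess h x v e *\<^sub>R e)"
  define G where "G = (\<lambda>x. ((p - 2) * norm (grad h x) powr (p - 4) * (grad h x \<bullet> c)) *\<^sub>R (\<Sum>b\<in>Basis. (grad h x \<bullet> b) *\<^sub>R H x b)
       + norm (grad h x) powr (p - 2) *\<^sub>R H x c)"
  have H: "hess h x v w = H x v \<bullet> w" if "x \<in> \<Omega>" for x v w unfolding H_def by (rule hess_eq_inner[OF that])
  have d: "(X has_derivative (\<lambda>w. G x \<bullet> w)) (at x)" if x: "x \<in> \<Omega>" for x
  proof -
    have d1: "(grad h has_derivative (\<lambda>w. \<Sum>b\<in>Basis. (hess h x b w) *\<^sub>R b)) (at x)"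
    proof -
      have "((\<lambda>y. \<Sum>b\<in>Basis. (grad h y \<bullet> b) *\<^sub>R b) has_derivative (\<lambda>w. \<Sum>b\<in>Basis. (hess h x b w) *\<^sub>R b)) (at x)"
        by (intro has_derivative_sum has_derivative_scaleR_left partial_has_derivative x)
      then show ?thesis by (simp add: euclidean_representation)
    qed
    have s: "p - 2 > 2" using p by simp
    from has_derivative_compose[OF d1 norm_powr_has_derivative[OF s]]
    have d2: "((\<lambda>y. norm (grad h y) powr (p - 2)) has_derivative
       (\<lambda>w. (p - 2) * norm (grad h x) powr (p - 4) * (grad h x \<bullet> (\<Sum>b\<in>Basis. (hess h x b w) *\<^sub>R b)))) (at x)"
      by simp
    have e: "(\<Sum>b\<in>Basis. (grad h x \<bullet> b) *\<^sub>R H x b) \<bullet> w = grad h x \<bullet> (\<Sum>b\<in>Basis. (hess h x b w) *\<^sub>R b)" for w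
      by (simp add: inner_sum_left inner_sum_right H[OF x] mult.commute)
    from has_derivative_mult[OF d2 partial_has_derivative[OF x, of c]]
    show ?thesis unfolding X_def
      by (rule has_derivative_eq_rhs) (rule ext, simp add: G_def inner_add_left e H[OF x] mult_ac)
  qed
  have "continuous_on \<Omega> G" unfolding G_def H_def
    by (intro continuous_intros C2_continuous cont_powr hess_continuous) (use p in auto)
  with d show "Ck_on 1 \<Omega> X" by (intro Ck_on_1_I[OF open_dom])
  show "grad X x \<bullet> c = (p - 2) * norm (grad h x) powr (p - 4) * (grad h x \<bullet> c) * (\<Sum>b\<in>Basis. (grad h x \<bullet> b) * hess h x b c)
       + norm (grad h x) powr (p - 2) * hess h x c c" if x: "x \<in> \<Omega>"
    unfolding grad_eqI[OF d[OF x]] by (simp add: G_def inner_add_left inner_sum_left H[OF x])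
qed

lemma p_lap_by_parts:
  assumes p: "p > 4" and \<Omega>m: "\<Omega> \<in> lmeasurable" and \<eta>: "C1_0 \<Omega> \<eta>"
  shows "(\<integral>x. (norm (grad h x) powr (p - 2) *\<^sub>R grad h x) \<bullet> grad \<eta> x \<partial>lebesgue_on \<Omega>) = - (\<integral>x. \<eta> x * p_lap p h x \<partial>lebesgue_on \<Omega>)"
proof -
  let ?M = "lebesgue_on \<Omega>"
  let ?X = "\<lambda>c x. norm (grad h x) powr (p - 2) * (grad h x \<bullet> c)"
  have P: "integrable ?M (\<lambda>x. ?X c x * (grad \<eta> x \<bullet> c))" "integrable ?M (\<lambda>x. \<eta> x * (grad (?X c) x \<bullet> c))"
    "(\<integral>x. ?X c x * (grad \<eta> x \<bullet> c) \<partial>?M) = - (\<integral>x. \<eta> x * (grad (?X c) x \<bullet> c) \<partial>?M)" if "c \<in> Basis" for c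
    by (rule integration_by_parts_C1_0[OF open_dom \<Omega>m p_flux_derivative(1)[OF p that] \<eta>])+
  have "(\<integral>x. (norm (grad h x) powr (p - 2) *\<^sub>R grad h x) \<bullet> grad \<eta> x \<partial>?M) = (\<integral>x. (\<Sum>c\<in>Basis. ?X c x * (grad \<eta> x \<bullet> c)) \<partial>?M)"
    by (rule Bochner_Integration.integral_cong) (auto simp: euclidean_inner[of "grad h _" "grad \<eta> _"] sum_distrib_left mult.assoc)
  also have "\<dots> = (\<Sum>c\<in>Basis. (\<integral>x. ?X c x * (grad \<eta> x \<bullet> c) \<partial>?M))"
    by (rule Bochner_Integration.integral_sum) (rule P(1))
  also have "\<dots> = - (\<Sum>c\<in>Basis. (\<integral>x. \<eta> x * (grad (?X c) x \<bullet> c) \<partial>?M))"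
    by (simp add: P(3) sum_negf)
  also have "(\<Sum>c\<in>Basis. (\<integral>x. \<eta> x * (grad (?X c) x \<bullet> c) \<partial>?M)) = (\<integral>x. (\<Sum>c\<in>Basis. \<eta> x * (grad (?X c) x \<bullet> c)) \<partial>?M)"
    by (rule Bochner_Integration.integral_sum[symmetric]) (rule P(2))
  also have "\<dots> = (\<integral>x. \<eta> x * p_lap p h x \<partial>?M)"
  proof (rule Bochner_Integration.integral_cong[OF refl])
    fix x assume "x \<in> space ?M"
    then have x: "x \<in> \<Omega>" by simp
    have "(\<Sum>c\<in>Basis. grad (?X c) x \<bullet> c) = p_lap p h x"
      by (simp add: p_flux_derivative(2)[OF p _ x] p_lap_def lap_def inf_laplacian_eq[OF x] sum.distrib sum_distrib_left mult.assoc)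
    then show "(\<Sum>c\<in>Basis. \<eta> x * (grad (?X c) x \<bullet> c)) = \<eta> x * p_lap p h x"
      by (simp add: sum_distrib_left[symmetric])
  qed
  finally show ?thesis .
qed

end

context weak_sol_test
begin

text \<open>Comparison with the classical field \<open>|\<nabla>h|\<^sup>p\<^sup>-\<^sup>2\<nabla>h\<close>, by monotonicity of \<open>v \<mapsto> |v|\<^sup>p\<^sup>-\<^sup>2 v\<close>.\<close>

lemma comparison:
  assumes h2: "Ck_on 2 \<Omega> h" and T'pos: "\<And>s. T' s \<ge> 0"
    and neg: "\<And>x. x \<in> V \<Longrightarrow> eta x \<noteq> 0 \<Longrightarrow> eta x * (p_lap p h x - lam x * indicator {y. U y > 0} x) < 0"
    and x: "x \<in> V"
  shows "eta x = 0"
proof -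
  let ?M = "lebesgue_on \<Omega>"
  interpret C2: C2_fun \<Omega> h by unfold_locales (use \<Omega> h2 in auto)
  have p4: "p > 4" using standing_facts by simp
  have K\<Omega>: "K \<subseteq> \<Omega>" using K V by blast
  have Ks: "K \<in> sets lebesgue" using K by (auto intro: lmeasurable_compact fmeasurableD)
  \<comment> \<open>The classical flux and its divergence are cut off to \<open>K\<close>, where
    they are bounded. The test functions vanish off \<open>K\<close> from index \<open>n0\<close>
    on, so the integrals against them are unchanged.\<close>
  define X where "X = (\<lambda>x. if x \<in> K then norm (grad h x) powr (p - 2) *\<^sub>R grad h x else 0)"
  define P where "P = (\<lambda>x. if x \<in> K then p_lap p h x else 0)"
  have cX: "continuous_on K (\<lambda>x. norm (grad h x) powr (p - 2) *\<^sub>R grad h x)"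
    by (intro continuous_intros continuous_on_subset[OF C2.C2_continuous(1) K\<Omega>] continuous_on_subset[OF C2.cont_powr K\<Omega>]) (use p4 in auto)
  have cP: "continuous_on K (p_lap p h)" by (rule continuous_on_subset[OF C2.cont_p_lap[OF p4] K\<Omega>])
  have mX: "X \<in> borel_measurable ?M" unfolding X_def
    by (subst borel_measurable_if_lebesgue_on[OF Ks standing_facts(2) K\<Omega>]) (rule continuous_imp_measurable_on_sets_lebesgue[OF cX Ks])
  have mP: "P \<in> borel_measurable ?M" unfolding P_def
    by (subst borel_measurable_if_lebesgue_on[OF Ks standing_facts(2) K\<Omega>]) (rule continuous_imp_measurable_on_sets_lebesgue[OF cP Ks])
  obtain cx where cx: "\<And>x. x \<in> K \<Longrightarrow> norm (norm (grad h x) powr (p - 2) *\<^sub>R grad h x) \<le> cx"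
    using compact_imp_bounded[OF compact_continuous_image[OF cX K(1)]] by (auto simp: bounded_iff)
  obtain cp where cp: "\<And>x. x \<in> K \<Longrightarrow> \<bar>p_lap p h x\<bar> \<le> cp"
    using compact_imp_bounded[OF compact_continuous_image[OF cP K(1)]] by (auto simp: bounded_iff)
  have Xb: "norm (X x) \<le> max cx 0" for x
  proof (cases "x \<in> K")
    case True
    then show ?thesis using cx[OF True] by (simp only: X_def if_True le_max_iff_disj simp_thms)
  qed (simp add: X_def)
  have Pb: "\<bar>P x\<bar> \<le> max cp 0" for x using cp[of x] by (auto simp: P_def)
  have XLq: "integrable ?M (\<lambda>x. norm (X x) powr (p / (p - 1)))"
    by (rule integrable_lebesgue_on_bounded[OF _ standing_facts(1), of _ "max cx 0 powr (p / (p - 1))"])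
      (use mX Xb p4 in \<open>auto intro!: powr_mono2\<close>)
  obtain c n1 where c: "\<And>x. \<bar>eta x\<bar> \<le> c" "\<And>n x. n \<ge> n1 \<Longrightarrow> \<bar>etan n x\<bar> \<le> c" and n1: "n1 \<ge> n0" using eta_bound by blast
  have c0: "c \<ge> 0" using c(1)[of undefined] by simp
  have 1: "(\<integral>x. X x \<bullet> grad (etan n) x \<partial>?M) = - (\<integral>x. etan n x * P x \<partial>?M)" if n: "n \<ge> n0" for n
  proof -
    have "(\<integral>x. X x \<bullet> grad (etan n) x \<partial>?M) = (\<integral>x. (norm (grad h x) powr (p - 2) *\<^sub>R grad h x) \<bullet> grad (etan n) x \<partial>?M)"
      by (rule Bochner_Integration.integral_cong) (use test_zeros(2)[OF n] in \<open>auto simp: X_def etan_C1_0(3)[OF n]\<close>)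
    also have "\<dots> = - (\<integral>x. etan n x * p_lap p h x \<partial>?M)"
      by (rule C2.p_lap_by_parts[OF p4 standing_facts(1) etan_C1_0(2)[OF n]])
    also have "(\<integral>x. etan n x * p_lap p h x \<partial>?M) = (\<integral>x. etan n x * P x \<partial>?M)"
      by (rule Bochner_Integration.integral_cong) (use test_zeros(1)[OF n] in \<open>auto simp: P_def\<close>)
    finally show ?thesis .
  qed
  have "(\<lambda>n. \<integral>x. etan (n + n1) x * P x \<partial>?M) \<longlonglongrightarrow> (\<integral>x. eta x * P x \<partial>?M)"
  proof (rule integral_dominated_convergence[where w="\<lambda>x. c * max cp 0"])
    show "integrable ?M (\<lambda>x. c * max cp 0)" using standing_facts(1) by (intro integrable_lebesgue_on_bounded[of _ _ "c * max cp 0"]) (use c0 in auto)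
    show "AE x in ?M. (\<lambda>n. etan (n + n1) x * P x) \<longlonglongrightarrow> eta x * P x"
      by (intro AE_I2 tendsto_mult_right LIMSEQ_ignore_initial_segment[OF test_limits(1)])
    show "AE x in ?M. norm (etan (n + n1) x * P x) \<le> c * max cp 0" for n
      unfolding real_norm_def abs_mult using c(2)[of "n + n1"] Pb c0 by (intro AE_I2 mult_mono) auto
  qed (use test_measurable mP in auto)
  then have "(\<lambda>n. \<integral>x. X x \<bullet> grad (etan (n + n1)) x \<partial>?M) \<longlonglongrightarrow> - (\<integral>x. eta x * P x \<partial>?M)"
    using n1 by (simp add: 1 tendsto_minus)
  moreover have "(\<lambda>n. \<integral>x. X x \<bullet> grad (etan (n + n1)) x \<partial>?M) \<longlonglongrightarrow> (\<integral>x. X x \<bullet> Deta x \<partial>?M)"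
    by (rule LIMSEQ_ignore_initial_segment[OF grad_etan_weak[OF mX XLq]])
  ultimately have XD: "(\<integral>x. X x \<bullet> Deta x \<partial>?M) = - (\<integral>x. eta x * P x \<partial>?M)" by (rule LIMSEQ_unique[rotated])
  have i1: "integrable ?M (\<lambda>x. flux x \<bullet> Deta x)"
    using Hoelder_vector(1)[OF _ flux_Lq test_measurable(6) Deta_Lp, of "\<lambda>_. 1" 1] p4 by simp
  have i2: "integrable ?M (\<lambda>x. X x \<bullet> Deta x)"
    using Hoelder_vector(1)[OF _ mX XLq test_measurable(6) Deta_Lp, of "\<lambda>_. 1" 1] p4 by simp
  have i3: "integrable ?M (\<lambda>x. eta x * P x)"
    using integrable_mult_bounded[OF integrable_eta(1) mP, of "max cp 0"] Pb by (simp add: mult.commute)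
  \<comment> \<open>The integrand that remains when the classical identity is subtracted from the
    tested equation. Monotonicity makes its integral nonnegative, whereas \<open>neg\<close> makes
    it negative wherever \<open>eta\<close> is not zero; so \<open>eta\<close> vanishes almost
    everywhere, and on \<open>V\<close> everywhere by continuity.\<close>
  define W where "W = (\<lambda>x. eta x * P x - lam x * indicator {y. U y > 0} x * eta x)"
  have iW: "integrable ?M W" unfolding W_def by (intro Bochner_Integration.integrable_diff i3 integrable_eta)
  have "(\<integral>x. W x \<partial>?M) = (\<integral>x. flux x \<bullet> Deta x - X x \<bullet> Deta x \<partial>?M)"
    unfolding W_def using Bochner_Integration.integral_diff[OF i3 integrable_eta(2)] Bochner_Integration.integral_diff[OF i1 i2]
      tested_equation XD by simp
  also have "\<dots> \<ge> 0"
  proof (rule integral_nonneg_AE, rule AE_I2)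
    fix x
    show "0 \<le> flux x \<bullet> Deta x - X x \<bullet> Deta x"
    proof (cases "x \<in> K")
      case True
      have "0 \<le> theta x * ((flux x - X x) \<bullet> (Du x - grad h x))"
        using T'pos monotone_flux[of "p - 2" "Du x" "grad h x"] True p4
        by (auto simp: theta_def flux_def X_def)
      then show ?thesis using True by (simp add: Deta_def hK_def inner_diff_left right_diff_distrib)
    qed (simp add: Deta_def test_zeros(4))
  qed
  finally have W0: "(\<integral>x. W x \<partial>?M) \<ge> 0" .
  have Wneg: "W x < 0" if "eta x \<noteq> 0" for x
  proof -
    have "x \<in> K" using test_zeros(3) that by blast
    then show ?thesis using neg[of x] that K by (auto simp: W_def P_def algebra_simps)
  qed
  have Wle: "W x \<le> 0" for x using Wneg[of x] by (cases "eta x = 0") (auto simp: W_def)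
  have "AE x in ?M. - W x = 0"
  proof (subst integral_nonneg_eq_0_iff_AE[symmetric])
    have "0 \<le> (\<integral>x. - W x \<partial>?M)" by (rule integral_nonneg_AE) (use Wle in auto)
    then show "(\<integral>x. - W x \<partial>?M) = 0" using W0 by simp
  qed (use iW Wle in auto)
  then have "AE x in ?M. eta x = 0" by eventually_elim (use Wneg in force)
  then have "AE x in lebesgue. x \<in> \<Omega> \<longrightarrow> eta x = 0" using standing_facts(2) by (simp add: AE_restrict_space_iff)
  then have "AE x in lebesgue_on V. eta x = 0"
    using Vm(1) V(2) by (auto simp: AE_restrict_space_iff elim!: eventually_mono)
  moreover have "continuous_on V eta"
  proof -
    have "continuous_on V (\<lambda>x. T (U x - h x))"
      by (rule continuous_on_compose2[OF T_cont[of UNIV]]) (intro continuous_intros h_cont continuous_on_subset[OF U_cont' V(2)], auto)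
    then show ?thesis by (rule continuous_on_eq) (simp add: eta_def)
  qed
  ultimately show ?thesis using continuous_AE_eq[OF V(1) _ continuous_on_const, of eta 0] x by blast
qed

end


section \<open>Viscosity solutions in the limit\<close>

lemma continuous_on_nhds:
  fixes F :: "'a::metric_space \<Rightarrow> real"
  assumes "continuous_on S F" "open S" "x0 \<in> S"
  shows "F x0 < t \<Longrightarrow> \<forall>\<^sub>F x in nhds x0. F x < t" and "t < F x0 \<Longrightarrow> \<forall>\<^sub>F x in nhds x0. t < F x"
proof -
  have "(F \<longlongrightarrow> F x0) (nhds x0)"
    using assms by (auto simp: continuous_on_eq_continuous_at isCont_def tendsto_at_iff_tendsto_nhds)
  then show "F x0 < t \<Longrightarrow> \<forall>\<^sub>F x in nhds x0. F x < t" and "t < F x0 \<Longrightarrow> \<forall>\<^sub>F x in nhds x0. t < F x"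
    by (auto dest: order_tendstoD)
qed

lemma (in C2_fun) p_lap_factor:
  "p_lap p h x = norm (grad h x) powr (p - 4) * ((norm (grad h x))\<^sup>2 * lap h x + (p - 2) * inf_laplacian h x)"
proof (cases "grad h x = 0")
  case False
  then have "norm (grad h x) powr (p - 2) = norm (grad h x) powr (p - 4) * norm (grad h x) powr 2"
    by (simp only: powr_add[symmetric]) simp
  then show ?thesis using False by (simp add: p_lap_def powr_numeral algebra_simps)
qed (simp add: p_lap_def)

lemma (in C2_fun) inf_laplacian_zero: "x \<in> \<Omega> \<Longrightarrow> grad h x = 0 \<Longrightarrow> inf_laplacian h x = 0"
  by (simp add: inf_laplacian_eq)

text \<open>Neighbourhood and constants are chosen before p: after factoring out |\<nabla>h|^(p-4),
  the Laplacian term stays below \<open>C\<close> while the other one grows like p. Near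
  \<open>x0\<close> the infinity Laplacian is nonzero, so the gradient cannot vanish there.\<close>

lemma (in C2_fun) p_lap_sign:
  assumes x0: "x0 \<in> \<Omega>" and \<sigma>: "\<bar>\<sigma>\<bar> = 1" and neg: "\<sigma> * inf_laplacian h x0 > 0"
  shows "\<exists>\<mu>>0. \<exists>C. \<forall>\<^sub>F x in nhds x0. \<forall>p>4. \<sigma> * p_lap p h x \<ge> norm (grad h x) powr (p - 4) * ((p - 2) * \<mu> - C) \<and> grad h x \<noteq> 0"
proof -
  define \<mu> where "\<mu> = \<sigma> * inf_laplacian h x0 / 2"
  define C where "C = (norm (grad h x0))\<^sup>2 * \<bar>lap h x0\<bar> + 1"
  have \<mu>: "\<mu> > 0" using neg by (simp add: \<mu>_def)
  have c1: "continuous_on \<Omega> (\<lambda>x. \<sigma> * inf_laplacian h x)" by (intro continuous_intros C2_continuous)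
  have c2: "continuous_on \<Omega> (\<lambda>x. (norm (grad h x))\<^sup>2 * \<bar>lap h x\<bar>)" by (intro continuous_intros C2_continuous)
  have "\<forall>\<^sub>F x in nhds x0. \<mu> < \<sigma> * inf_laplacian h x"
    by (rule continuous_on_nhds(2)[OF c1 open_dom x0]) (use neg in \<open>simp add: \<mu>_def\<close>)
  moreover have "\<forall>\<^sub>F x in nhds x0. (norm (grad h x))\<^sup>2 * \<bar>lap h x\<bar> < C"
    by (rule continuous_on_nhds(1)[OF c2 open_dom x0]) (simp add: C_def)
  moreover have "\<forall>\<^sub>F x in nhds x0. x \<in> \<Omega>" using open_dom x0 by (rule eventually_nhds_in_open)
  ultimately have "\<forall>\<^sub>F x in nhds x0. \<forall>p>4. \<sigma> * p_lap p h x \<ge> norm (grad h x) powr (p - 4) * ((p - 2) * \<mu> - C) \<and> grad h x \<noteq> 0"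
  proof eventually_elim
    case (elim x)
    show ?case
    proof (intro allI impI conjI)
      fix p :: real assume p: "p > 4"
      show "grad h x \<noteq> 0" using inf_laplacian_zero[OF elim(3)] elim(1) \<mu> by auto
      have "\<bar>\<sigma> * ((norm (grad h x))\<^sup>2 * lap h x)\<bar> < C" using elim(2) \<sigma> by (simp add: abs_mult)
      moreover have "(p - 2) * \<mu> \<le> (p - 2) * (\<sigma> * inf_laplacian h x)" using elim(1) p by (intro mult_left_mono) auto
      ultimately have "(p - 2) * \<mu> - C \<le> \<sigma> * ((norm (grad h x))\<^sup>2 * lap h x) + (p - 2) * (\<sigma> * inf_laplacian h x)" by linarith
      then have "norm (grad h x) powr (p - 4) * ((p - 2) * \<mu> - C) \<le>
        norm (grad h x) powr (p - 4) * (\<sigma> * ((norm (grad h x))\<^sup>2 * lap h x) + (p - 2) * (\<sigma> * inf_laplacian h x))"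
        by (intro mult_left_mono) auto
      also have "\<dots> = \<sigma> * p_lap p h x" unfolding p_lap_factor by (simp add: algebra_simps)
      finally show "\<sigma> * p_lap p h x \<ge> norm (grad h x) powr (p - 4) * ((p - 2) * \<mu> - C)" .
    qed
  qed
  then show ?thesis using \<mu> by blast
qed

text \<open>Near \<open>x0\<close> the gradient is shorter than some \<theta> < 1, and the decay of
  \<theta>^(p-4) overwhelms the linear growth in p of the remaining factor, uniformly in the
  point.\<close>

lemma (in C2_fun) p_lap_small:
  assumes x0: "x0 \<in> \<Omega>" and g: "norm (grad h x0) < 1"
  shows "\<exists>\<theta> C. 0 < \<theta> \<and> \<theta> < 1 \<and> (\<forall>\<^sub>F x in nhds x0. \<forall>p>4. p_lap p h x \<le> \<theta> powr (p - 4) * (p * C))"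
proof -
  define \<theta> where "\<theta> = (1 + norm (grad h x0)) / 2"
  have \<theta>: "0 < \<theta>" "\<theta> < 1" "norm (grad h x0) < \<theta>" using g by (auto simp: \<theta>_def add_pos_nonneg)
  define C where "C = (norm (grad h x0))\<^sup>2 * \<bar>lap h x0\<bar> + \<bar>inf_laplacian h x0\<bar> + 2"
  have c1: "continuous_on \<Omega> (\<lambda>x. (norm (grad h x))\<^sup>2 * \<bar>lap h x\<bar> + \<bar>inf_laplacian h x\<bar>)" by (intro continuous_intros C2_continuous)
  have c2: "continuous_on \<Omega> (\<lambda>x. norm (grad h x))" by (intro continuous_intros C2_continuous)
  have "\<forall>\<^sub>F x in nhds x0. norm (grad h x) < \<theta>" by (rule continuous_on_nhds(1)[OF c2 open_dom x0 \<theta>(3)])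
  moreover have "\<forall>\<^sub>F x in nhds x0. (norm (grad h x))\<^sup>2 * \<bar>lap h x\<bar> + \<bar>inf_laplacian h x\<bar> < C"
    by (rule continuous_on_nhds(1)[OF c1 open_dom x0]) (simp add: C_def)
  ultimately have "\<forall>\<^sub>F x in nhds x0. \<forall>p>4. p_lap p h x \<le> \<theta> powr (p - 4) * (p * C)"
  proof eventually_elim
    case (elim x)
    show ?case
    proof (intro allI impI)
      fix p :: real assume p: "p > 4"
      let ?A = "(norm (grad h x))\<^sup>2 * \<bar>lap h x\<bar>" and ?B = "\<bar>inf_laplacian h x\<bar>"
      have AB: "?A \<ge> 0" "?B \<ge> 0" by auto
      have "\<bar>(norm (grad h x))\<^sup>2 * lap h x + (p - 2) * inf_laplacian h x\<bar> \<le> ?A + (p - 2) * ?B"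
        using p by (intro order_trans[OF abs_triangle_ineq]) (simp add: abs_mult)
      also have "\<dots> \<le> p * ?A + p * ?B" 
      proof (rule add_mono)
        show "?A \<le> p * ?A" using mult_right_mono[OF _ AB(1), of 1 p] p by simp
        show "(p - 2) * ?B \<le> p * ?B" using p AB by (intro mult_right_mono) auto
      qed
      also have "\<dots> = p * (?A + ?B)" by (simp add: distrib_left)
      also have "\<dots> \<le> p * C" using elim(2) p by (intro mult_left_mono) auto
      finally have b: "\<bar>(norm (grad h x))\<^sup>2 * lap h x + (p - 2) * inf_laplacian h x\<bar> \<le> p * C" .
      have "p_lap p h x \<le> \<bar>p_lap p h x\<bar>" by simp
      also have "\<dots> = norm (grad h x) powr (p - 4) * \<bar>(norm (grad h x))\<^sup>2 * lap h x + (p - 2) * inf_laplacian h x\<bar>"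
        unfolding p_lap_factor by (simp add: abs_mult)
      also have "\<dots> \<le> \<theta> powr (p - 4) * (p * C)"
        using elim(1) p b by (intro mult_mono powr_mono2) auto
      finally show "p_lap p h x \<le> \<theta> powr (p - 4) * (p * C)" .
    qed
  qed
  then show ?thesis using \<theta> by blast
qed

section \<open>Classical functions touching a weak solution\<close>

context weak_sol
begin

text \<open>The test function is a smoothed positive part of U - \<phi> - a. It vanishes off the
  ball of half radius, with the margin \<open>e\<close> reserved for the approximants, and is
  positive at \<open>x0\<close>; yet \<open>comparison\<close> makes it vanish. The smoothing width
  1 is an arbitrary choice, as only the sign of \<open>tau\<close> and the bounds on its slope
  enter.\<close>

lemma no_touching_from_above:
  assumes \<phi>: "Ck_on 2 \<Omega> \<phi>" and r: "r > 0" "ball x0 r \<subseteq> \<Omega>" and e: "e > 0"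
    and out: "\<And>x. x \<in> ball x0 r \<Longrightarrow> x \<notin> cball x0 (r/2) \<Longrightarrow> U x - \<phi> x \<le> a - e"
    and centre: "U x0 - \<phi> x0 > a"
    and less: "\<And>x. x \<in> ball x0 r \<Longrightarrow> p_lap p \<phi> x < lam x * indicator {y. U y > 0} x"
  shows False
proof -
  interpret C2: C2_fun \<Omega> \<phi> by unfold_locales (use \<Omega> \<phi> in auto)
  obtain n0 where n0: "\<And>n x. n \<ge> n0 \<Longrightarrow> x \<in> closure \<Omega> \<Longrightarrow> \<bar>f n x - U x\<bar> < e"
    using f_uniformly_close[OF e] by auto
  interpret T: weak_sol_test \<Omega> p lam g U Du f \<Lambda> "ball x0 r" "cball x0 (r/2)" \<phi> "\<lambda>s. tau 1 (s - a)" "\<lambda>s. tau' 1 (s - a)" n0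
  proof unfold_locales
    show "((\<lambda>s. tau 1 (s - a)) has_real_derivative tau' 1 (s - a)) (at s)" for s
    proof -
      have "((\<lambda>s. s - a) has_real_derivative 1) (at s)" by (auto intro!: derivative_eq_intros)
      from DERIV_chain2[OF tau_DERIV[OF zero_less_one] this] show ?thesis by simp
    qed
    show "continuous_on UNIV (\<lambda>s. tau' 1 (s - a))"
      by (intro continuous_on_compose2[OF continuous_tau'[of 1 UNIV]] continuous_intros) auto
    show "\<bar>tau' 1 (s - a)\<bar> \<le> 1" for s using tau'_bounds[of 1 "s - a"] by simp
    fix n x assume n: "n \<ge> n0" and x: "x \<in> ball x0 r" "x \<notin> cball x0 (r/2)"
    have "x \<in> closure \<Omega>" using x r closure_subset by blast
    then have "f n x - \<phi> x - a \<le> 0" using n0[OF n] out[OF x] by (simp add: abs_less_iff) (smt (verit, best))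
    then show "tau 1 (f n x - \<phi> x - a) = 0 \<and> tau' 1 (f n x - \<phi> x - a) = 0" using tau_nonpos[of 1] by simp
  qed (use r Ck_on_mono[OF C2.h_C1] in auto)
  have x0: "x0 \<in> ball x0 r" using r by simp
  have "T.eta x0 = 0"
  proof (rule T.comparison[OF \<phi> _ _ x0])
    show "0 \<le> tau' 1 (s - a)" for s using tau'_bounds[of 1] by simp
    fix x assume x: "x \<in> ball x0 r" and ne: "T.eta x \<noteq> 0"
    have "T.eta x > 0" using ne x tau_nonpos(1)[of 1 "U x - \<phi> x - a"] tau_pos[of 1 "U x - \<phi> x - a"]
      by (simp add: T.eta_def) (meson not_le)
    then show "T.eta x * (p_lap p \<phi> x - lam x * indicator {y. U y > 0} x) < 0"
      using less[OF x] by (simp add: mult_less_0_iff)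
  qed
  moreover have "T.eta x0 > 0" using centre r by (simp add: T.eta_def tau_pos)
  ultimately show False by simp
qed

text \<open>The mirror image. The minus sign stands in front so that the truncation still increases
  in s, as \<open>comparison\<close> demands.\<close>

lemma no_touching_from_below:
  assumes \<phi>: "Ck_on 2 \<Omega> \<phi>" and r: "r > 0" "ball x0 r \<subseteq> \<Omega>" and e: "e > 0"
    and out: "\<And>x. x \<in> ball x0 r \<Longrightarrow> x \<notin> cball x0 (r/2) \<Longrightarrow> U x - \<phi> x \<ge> a + e"
    and centre: "U x0 - \<phi> x0 < a"
    and less: "\<And>x. x \<in> ball x0 r \<Longrightarrow> p_lap p \<phi> x > lam x * indicator {y. U y > 0} x"
  shows False
proof -
  interpret C2: C2_fun \<Omega> \<phi> by unfold_locales (use \<Omega> \<phi> in auto)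
  obtain n0 where n0: "\<And>n x. n \<ge> n0 \<Longrightarrow> x \<in> closure \<Omega> \<Longrightarrow> \<bar>f n x - U x\<bar> < e"
    using f_uniformly_close[OF e] by auto
  interpret T: weak_sol_test \<Omega> p lam g U Du f \<Lambda> "ball x0 r" "cball x0 (r/2)" \<phi> "\<lambda>s. - tau 1 (a - s)" "\<lambda>s. tau' 1 (a - s)" n0
  proof unfold_locales
    show "((\<lambda>s. - tau 1 (a - s)) has_real_derivative tau' 1 (a - s)) (at s)" for s
    proof -
      have "((\<lambda>s. a - s) has_real_derivative -1) (at s)" by (auto intro!: derivative_eq_intros)
      from DERIV_minus[OF DERIV_chain2[OF tau_DERIV[OF zero_less_one] this]] show ?thesis by simp
    qed
    show "continuous_on UNIV (\<lambda>s. tau' 1 (a - s))"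
      by (intro continuous_on_compose2[OF continuous_tau'[of 1 UNIV]] continuous_intros) auto
    show "\<bar>tau' 1 (a - s)\<bar> \<le> 1" for s using tau'_bounds[of 1 "a - s"] by simp
    fix n x assume n: "n \<ge> n0" and x: "x \<in> ball x0 r" "x \<notin> cball x0 (r/2)"
    have "x \<in> closure \<Omega>" using x r closure_subset by blast
    then have "a - (f n x - \<phi> x) \<le> 0" using n0[OF n] out[OF x] by (simp add: abs_less_iff) (smt (verit, best))
    then show "- tau 1 (a - (f n x - \<phi> x)) = 0 \<and> tau' 1 (a - (f n x - \<phi> x)) = 0" using tau_nonpos[of 1] by simp
  qed (use r Ck_on_mono[OF C2.h_C1] in auto)
  have x0: "x0 \<in> ball x0 r" using r by simp
  have "T.eta x0 = 0"
  proof (rule T.comparison[OF \<phi> _ _ x0])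
    show "0 \<le> tau' 1 (a - s)" for s using tau'_bounds[of 1] by simp
    fix x assume x: "x \<in> ball x0 r" and ne: "T.eta x \<noteq> 0"
    have "T.eta x < 0" using ne x tau_nonpos(1)[of 1 "a - (U x - \<phi> x)"] tau_pos[of 1 "a - (U x - \<phi> x)"]
      by (simp add: T.eta_def) (meson not_le)
    then show "T.eta x * (p_lap p \<phi> x - lam x * indicator {y. U y > 0} x) < 0"
      using less[OF x] by (simp add: mult_less_0_iff)
  qed
  moreover have "T.eta x0 < 0" using centre r by (simp add: T.eta_def tau_pos)
  ultimately show False by simp
qed

end

text \<open>On the closed annulus between the radii r/2 and r, compactness turns strict inequality
  into a uniform gap \<open>k\<close>. This gap is the room in which a uniformly close function may
  replace \<open>v\<close>.\<close>

lemma strict_max_gap: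
  fixes v :: "'a::euclidean_space \<Rightarrow> real"
  assumes S: "open S" "x0 \<in> S" and v: "continuous_on S v" and max: "strict_local_max_at S v x0" and ev: "\<forall>\<^sub>F x in nhds x0. P x"
  shows "\<exists>r>0. \<exists>k>0. ball x0 r \<subseteq> S \<and> (\<forall>x\<in>ball x0 r. P x) \<and> (\<forall>x\<in>ball x0 r. x \<notin> cball x0 (r/2) \<longrightarrow> v x \<le> v x0 - k)"
proof -
  obtain r1 where r1: "r1 > 0" "\<And>x. x \<in> S \<inter> ball x0 r1 \<Longrightarrow> x \<noteq> x0 \<Longrightarrow> v x < v x0"
    using max unfolding strict_local_max_at_def by blast
  obtain r2 where r2: "r2 > 0" "\<And>x. dist x x0 < r2 \<Longrightarrow> P x"
    using ev unfolding eventually_nhds_metric by blast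
  obtain r3 where r3: "r3 > 0" "ball x0 r3 \<subseteq> S" using S openE by blast
  \<comment> \<open>Halved so that the closed ball of radius \<open>r\<close> still lies in all
    three open balls.\<close>
  define r where "r = min r1 (min r2 r3) / 2"
  have r: "r > 0" "r < r1" "r < r2" "r < r3" using r1 r2 r3 by (auto simp: r_def)
  define A where "A = cball x0 r - ball x0 (r/2)"
  have A: "compact A" unfolding A_def by (intro compact_diff) auto
  have AS: "A \<subseteq> S" using r3 r by (force simp: A_def)
  have "\<exists>k>0. \<forall>x\<in>A. v x \<le> v x0 - k"
  proof (cases "A = {}")
    case False
    obtain y where y: "y \<in> A" "\<And>x. x \<in> A \<Longrightarrow> v x \<le> v y"
      using continuous_attains_sup[OF A False continuous_on_subset[OF v AS]] by blast
    have "v y < v x0" using y(1) AS r by (intro r1(2)) (auto simp: A_def)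
    then show ?thesis using y(2) by (intro exI[of _ "v x0 - v y"]) auto
  qed (auto intro: exI[of _ 1])
  then obtain k where k: "k > 0" "\<And>x. x \<in> A \<Longrightarrow> v x \<le> v x0 - k" by blast
  show ?thesis
  proof (rule exI[of _ r], rule conjI, rule r, rule exI[of _ k], intro conjI ballI impI)
    show "ball x0 r \<subseteq> S" using r3 r by force
    show "P x" if "x \<in> ball x0 r" for x using that r by (intro r2(2)) (simp add: dist_commute)
    show "v x \<le> v x0 - k" if "x \<in> ball x0 r" "x \<notin> cball x0 (r/2)" for x
      using that by (intro k(2)) (auto simp: A_def)
  qed (use r k in auto)
qed

section \<open>Viscosity inequalities for uniform limits\<close>

locale limit_sol =
  fixes \<Omega> :: "'a::euclidean_space set" and p :: "nat \<Rightarrow> real" and lam g :: "'a \<Rightarrow> real" and U :: "nat \<Rightarrow> 'a \<Rightarrow> real"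
    and Du :: "nat \<Rightarrow> 'a \<Rightarrow> 'a" and f :: "nat \<Rightarrow> nat \<Rightarrow> 'a \<Rightarrow> real" and \<Lambda> c :: real and w :: "'a \<Rightarrow> real"
  assumes ws: "\<And>j. weak_sol \<Omega> (p j) lam g (U j) (Du j) (f j) \<Lambda>"
    and p_lim: "filterlim p at_top sequentially" and c: "c > 0" "\<And>x. x \<in> \<Omega> \<Longrightarrow> c \<le> lam x"
    and U_lim: "uniform_limit (closure \<Omega>) U w sequentially"
begin

lemma \<Omega>_open: "open \<Omega>" "bounded \<Omega>" "\<Omega> \<noteq> {}" using ws[of 0] by (auto simp: weak_sol_def)

lemma lam_le: "x \<in> \<Omega> \<Longrightarrow> lam x \<le> \<Lambda>" using ws[of 0] by (auto simp: weak_sol_def)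

lemma w_cont: "continuous_on (closure \<Omega>) w" "continuous_on \<Omega> w"
proof -
  show "continuous_on (closure \<Omega>) w"
    by (rule uniform_limit_theorem[OF _ U_lim]) (use ws in \<open>auto simp: weak_sol_def\<close>)
  then show "continuous_on \<Omega> w" using closure_subset continuous_on_subset by blast
qed

lemma U_close: "e > 0 \<Longrightarrow> \<forall>\<^sub>F j in sequentially. \<forall>x\<in>\<Omega>. \<bar>U j x - w x\<bar> < e"
  using uniform_limitD[OF U_lim, of e] closure_subset[of \<Omega>]
  by (auto elim!: eventually_mono simp: dist_real_def)

lemma p_large: "\<forall>\<^sub>F j in sequentially. p j > b"
  using p_lim by (simp add: filterlim_at_top_dense)

text \<open>The predicate \<open>P\<close> singles out a neighbourhood of \<open>x0\<close> fixed
  before j is chosen, so that \<phi> is a strict supersolution of the equation with exponent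
  \<open>p j\<close> throughout it for all large j.\<close>

lemma no_max:
  assumes \<phi>: "Ck_on 2 \<Omega> \<phi>" and x0: "x0 \<in> \<Omega>" and max: "strict_local_max_at \<Omega> (\<lambda>x. w x - \<phi> x) x0"
    and ev: "\<forall>\<^sub>F x in nhds x0. P x"
    and less: "\<forall>\<^sub>F j in sequentially. \<forall>x\<in>\<Omega>. P x \<longrightarrow> p_lap (p j) \<phi> x < lam x * indicator {y. U j y > 0} x"
  shows False
proof -
  interpret C2: C2_fun \<Omega> \<phi> by unfold_locales (use \<Omega>_open \<phi> in auto)
  have "continuous_on \<Omega> (\<lambda>x. w x - \<phi> x)" by (intro continuous_intros w_cont C2.C2_continuous)
  from strict_max_gap[OF \<Omega>_open(1) x0 this max ev] obtain r k where r: "r > 0" "ball x0 r \<subseteq> \<Omega>" and k: "k > 0"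
    and P: "\<And>x. x \<in> ball x0 r \<Longrightarrow> P x" and gap: "\<And>x. x \<in> ball x0 r \<Longrightarrow> x \<notin> cball x0 (r/2) \<Longrightarrow> w x - \<phi> x \<le> w x0 - \<phi> x0 - k" by blast
  have "\<forall>\<^sub>F j in sequentially. \<forall>x\<in>\<Omega>. \<bar>U j x - w x\<bar> < k/4" by (rule U_close) (use k in auto)
  with less have "\<forall>\<^sub>F j in sequentially. False"
  proof eventually_elim
    case (elim j)
    interpret W: weak_sol \<Omega> "p j" lam g "U j" "Du j" "f j" \<Lambda> by (rule ws)
    \<comment> \<open>Relative to the value of w - \<phi> at \<open>x0\<close>: allowing for the
      error k/4, the difference U j - \<phi> exceeds -k/4 at \<open>x0\<close> and is at most -3k/4
      on the annulus. The level -k/2 separates the two.\<close>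
    show False
    proof (rule W.no_touching_from_above[OF \<phi> r, of "k/4" "w x0 - \<phi> x0 - k/2"])
      show "U j x - \<phi> x \<le> w x0 - \<phi> x0 - k/2 - k/4" if x: "x \<in> ball x0 r" "x \<notin> cball x0 (r/2)" for x
      proof -
        have "\<bar>U j x - w x\<bar> < k/4" using elim(2) x(1) r by blast
        then show ?thesis using gap[OF x] by linarith
      qed
      have "\<bar>U j x0 - w x0\<bar> < k/4" using elim(2) x0 by blast
      then show "w x0 - \<phi> x0 - k/2 < U j x0 - \<phi> x0" using k by linarith
      show "p_lap (p j) \<phi> x < lam x * indicator {y. U j y > 0} x" if "x \<in> ball x0 r" for x
        using elim(1) P[OF that] that r by blast
    qed (use k in auto)
  qed
  then show False by simp
qed

lemma no_min:
  assumes \<phi>: "Ck_on 2 \<Omega> \<phi>" and x0: "x0 \<in> \<Omega>" and min: "strict_local_min_at \<Omega> (\<lambda>x. w x - \<phi> x) x0"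
    and ev: "\<forall>\<^sub>F x in nhds x0. P x"
    and less: "\<forall>\<^sub>F j in sequentially. \<forall>x\<in>\<Omega>. P x \<longrightarrow> p_lap (p j) \<phi> x > lam x * indicator {y. U j y > 0} x"
  shows False
proof -
  interpret C2: C2_fun \<Omega> \<phi> by unfold_locales (use \<Omega>_open \<phi> in auto)
  have "continuous_on \<Omega> (\<lambda>x. - (w x - \<phi> x))" by (intro continuous_intros w_cont C2.C2_continuous)
  moreover have "strict_local_max_at \<Omega> (\<lambda>x. - (w x - \<phi> x)) x0"
    using min unfolding strict_local_max_at_def strict_local_min_at_def by (simp only: neg_less_iff_less)
  ultimately obtain r k where r: "r > 0" "ball x0 r \<subseteq> \<Omega>" and k: "k > 0"
    and P: "\<And>x. x \<in> ball x0 r \<Longrightarrow> P x" and gap: "\<And>x. x \<in> ball x0 r \<Longrightarrow> x \<notin> cball x0 (r/2) \<Longrightarrow> - (w x - \<phi> x) \<le> - (w x0 - \<phi> x0) - k"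
    using strict_max_gap[OF \<Omega>_open(1) x0 _ _ ev, of "\<lambda>x. - (w x - \<phi> x)"] by blast
  have "\<forall>\<^sub>F j in sequentially. \<forall>x\<in>\<Omega>. \<bar>U j x - w x\<bar> < k/4" by (rule U_close) (use k in auto)
  with less have "\<forall>\<^sub>F j in sequentially. False"
  proof eventually_elim
    case (elim j)
    interpret W: weak_sol \<Omega> "p j" lam g "U j" "Du j" "f j" \<Lambda> by (rule ws)
    show False
    proof (rule W.no_touching_from_below[OF \<phi> r, of "k/4" "w x0 - \<phi> x0 + k/2"])
      show "U j x - \<phi> x \<ge> w x0 - \<phi> x0 + k/2 + k/4" if x: "x \<in> ball x0 r" "x \<notin> cball x0 (r/2)" for x
      proof -
        have "\<bar>U j x - w x\<bar> < k/4" using elim(2) x(1) r by blast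
        then show ?thesis using gap[OF x] by linarith
      qed
      have "\<bar>U j x0 - w x0\<bar> < k/4" using elim(2) x0 by blast
      then show "U j x0 - \<phi> x0 < w x0 - \<phi> x0 + k/2" using k by linarith
      show "p_lap (p j) \<phi> x > lam x * indicator {y. U j y > 0} x" if "x \<in> ball x0 r" for x
        using elim(1) P[OF that] that r by blast
    qed (use k in auto)
  qed
  then show False by simp
qed

lemma subsolution: "viscosity_subsolution \<Omega> w"
  unfolding viscosity_subsolution_def
proof (intro conjI ballI allI impI)
  show "usc_on \<Omega> w"
    unfolding usc_on_def using w_cont(2) by (auto simp: continuous_on_def intro: order_tendstoD(2))
  fix x0 \<phi> assume x0: "x0 \<in> \<Omega>" and A: "Ck_on 2 \<Omega> \<phi> \<and> strict_local_max_at \<Omega> (\<lambda>x. w x - \<phi> x) x0"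
  then have \<phi>: "Ck_on 2 \<Omega> \<phi>" and max: "strict_local_max_at \<Omega> (\<lambda>x. w x - \<phi> x) x0" by auto
  interpret C2: C2_fun \<Omega> \<phi> by unfold_locales (use \<Omega>_open \<phi> in auto)
  \<comment> \<open>Otherwise the p-Laplacian of \<phi> is negative near \<open>x0\<close> for large
    p, below a source that is nonnegative whatever the sign of \<open>U j\<close>.\<close>
  have "- inf_laplacian \<phi> x0 \<le> 0"
  proof (rule ccontr)
    assume "\<not> - inf_laplacian \<phi> x0 \<le> 0"
    then obtain \<mu> C where \<mu>: "\<mu> > 0" and ev: "\<forall>\<^sub>F x in nhds x0. \<forall>p>4. (-1) * p_lap p \<phi> x \<ge> norm (grad \<phi> x) powr (p - 4) * ((p - 2) * \<mu> - C) \<and> grad \<phi> x \<noteq> 0"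
      using C2.p_lap_sign[OF x0, of "-1"] by auto
    show False
    proof (rule no_max[OF \<phi> x0 max ev])
      show "\<forall>\<^sub>F j in sequentially. \<forall>x\<in>\<Omega>. (\<forall>p>4. (-1) * p_lap p \<phi> x \<ge> norm (grad \<phi> x) powr (p - 4) * ((p - 2) * \<mu> - C) \<and> grad \<phi> x \<noteq> 0) \<longrightarrow>
         p_lap (p j) \<phi> x < lam x * indicator {y. U j y > 0} x"
        using p_large[of 4] p_large[of "2 + C / \<mu>"]
      proof eventually_elim
        case (elim j)
        show ?case
        proof (intro ballI impI)
          fix x assume x: "x \<in> \<Omega>" and P: "\<forall>p>4. (-1) * p_lap p \<phi> x \<ge> norm (grad \<phi> x) powr (p - 4) * ((p - 2) * \<mu> - C) \<and> grad \<phi> x \<noteq> 0"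
          have "(p j - 2) * \<mu> > C" using elim(2) \<mu> by (simp add: field_simps)
          then have "norm (grad \<phi> x) powr (p j - 4) * ((p j - 2) * \<mu> - C) > 0" using P elim(1) by (intro mult_pos_pos) auto
          then have "p_lap (p j) \<phi> x < 0" using P elim(1) by fastforce
          also have "0 \<le> lam x * indicator {y. U j y > 0} x" using c(2)[OF x] c(1) by (auto simp: indicator_def)
          finally show "p_lap (p j) \<phi> x < lam x * indicator {y. U j y > 0} x" .
        qed
      qed
    qed
  qed
  \<comment> \<open>Failure means w > 0 and |\<nabla>\<phi>| < 1 at \<open>x0\<close>. Then
    \<open>U j\<close> is positive nearby for large j and the source is at least \<open>c\<close>,
    while the p-Laplacian of \<phi> has an upper bound tending to zero.\<close>
  moreover have "indicator {x. w x > 0} x0 - norm (grad \<phi> x0) \<le> 0"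
  proof (rule ccontr)
    assume "\<not> indicator {x. w x > 0} x0 - norm (grad \<phi> x0) \<le> 0"
    then have A: "norm (grad \<phi> x0) < indicator {x. w x > 0} x0" by simp
    have w0: "w x0 > 0"
    proof (rule ccontr)
      assume "\<not> w x0 > 0"
      then show False using A norm_ge_zero[of "grad \<phi> x0"] by simp
    qed
    have g1: "norm (grad \<phi> x0) < 1" using A w0 by simp
    obtain \<theta> C where \<theta>: "0 < \<theta>" "\<theta> < 1" and ev1: "\<forall>\<^sub>F x in nhds x0. \<forall>p>4. p_lap p \<phi> x \<le> \<theta> powr (p - 4) * (p * C)"
      using C2.p_lap_small[OF x0 g1] by blast
    have ev2: "\<forall>\<^sub>F x in nhds x0. w x0 / 2 < w x"
      by (rule continuous_on_nhds(2)[OF w_cont(2) \<Omega>_open(1) x0]) (use w0 in simp)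
    have "((\<lambda>p. \<theta> powr (p - 4) * (p * C)) \<longlongrightarrow> 0) at_top" using \<theta> by real_asymp
    then have "(\<lambda>j. \<theta> powr (p j - 4) * (p j * C)) \<longlonglongrightarrow> 0" by (rule filterlim_compose[OF _ p_lim])
    then have ev3: "\<forall>\<^sub>F j in sequentially. \<theta> powr (p j - 4) * (p j * C) < c" by (rule order_tendstoD(2)) (rule c)
    show False
    proof (rule no_max[OF \<phi> x0 max eventually_conj[OF ev1 ev2]])
      have "\<forall>\<^sub>F j in sequentially. \<forall>x\<in>\<Omega>. \<bar>U j x - w x\<bar> < w x0 / 2" by (rule U_close) (use w0 in simp)
      with p_large[of 4] ev3
      show "\<forall>\<^sub>F j in sequentially. \<forall>x\<in>\<Omega>. (\<forall>p>4. p_lap p \<phi> x \<le> \<theta> powr (p - 4) * (p * C)) \<and> w x0 / 2 < w x \<longrightarrow>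
         p_lap (p j) \<phi> x < lam x * indicator {y. U j y > 0} x"
      proof eventually_elim
        case (elim j)
        show ?case
        proof (intro ballI impI, elim conjE)
          fix x assume x: "x \<in> \<Omega>" and P: "\<forall>p>4. p_lap p \<phi> x \<le> \<theta> powr (p - 4) * (p * C)" and wx: "w x0 / 2 < w x"
          have "\<bar>U j x - w x\<bar> < w x0 / 2" using elim(3) x by blast
          then have "U j x > 0" using wx by linarith
          moreover have "p_lap (p j) \<phi> x < c" using P elim(1,2) by fastforce
          ultimately show "p_lap (p j) \<phi> x < lam x * indicator {y. U j y > 0} x" using c(2)[OF x] by simp
        qed
      qed
    qed
  qed
  ultimately show "max (- inf_laplacian \<phi> x0) (indicator {x. w x > 0} x0 - norm (grad \<phi> x0)) \<le> 0" by simp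
qed

lemma supersolution: "viscosity_supersolution \<Omega> w"
  unfolding viscosity_supersolution_def
proof (intro conjI ballI allI impI)
  show "lsc_on \<Omega> w"
    unfolding lsc_on_def using w_cont(2) by (auto simp: continuous_on_def intro: order_tendstoD(1))
  fix x0 \<phi> assume x0: "x0 \<in> \<Omega>" and A: "Ck_on 2 \<Omega> \<phi> \<and> strict_local_min_at \<Omega> (\<lambda>x. w x - \<phi> x) x0"
  then have \<phi>: "Ck_on 2 \<Omega> \<phi>" and min: "strict_local_min_at \<Omega> (\<lambda>x. w x - \<phi> x) x0" by auto
  interpret C2: C2_fun \<Omega> \<phi> by unfold_locales (use \<Omega>_open \<phi> in auto)
  show "max (- inf_laplacian \<phi> x0) (indicator {x. w x \<ge> 0} x0 - norm (grad \<phi> x0)) \<ge> 0"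
  proof (rule ccontr)
    assume "\<not> max (- inf_laplacian \<phi> x0) (indicator {x. w x \<ge> 0} x0 - norm (grad \<phi> x0)) \<ge> 0"
    then have D: "inf_laplacian \<phi> x0 > 0" and I: "indicator {x. w x \<ge> 0} x0 < norm (grad \<phi> x0)" by auto
    obtain \<mu> C where \<mu>: "\<mu> > 0" and ev: "\<forall>\<^sub>F x in nhds x0. \<forall>p>4. 1 * p_lap p \<phi> x \<ge> norm (grad \<phi> x) powr (p - 4) * ((p - 2) * \<mu> - C) \<and> grad \<phi> x \<noteq> 0"
      using C2.p_lap_sign[OF x0, of 1] D by auto
    show False
    proof (cases "w x0 \<ge> 0")
      case True
      \<comment> \<open>The p-Laplacian is then at least (p - 2) \<mu> - C and outgrows
        \<open>\<Lambda>\<close>, which bounds the source irrespective of the sign of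
        \<open>U j\<close>; that sign is undetermined near points with w = 0.\<close>
      then have g1: "norm (grad \<phi> x0) > 1" using I by simp
      have ev2: "\<forall>\<^sub>F x in nhds x0. 1 < norm (grad \<phi> x)"
        by (rule continuous_on_nhds(2)[OF continuous_on_norm[OF C2.C2_continuous(1)] \<Omega>_open(1) x0 g1])
      show False
      proof (rule no_min[OF \<phi> x0 min eventually_conj[OF ev ev2]])
        show "\<forall>\<^sub>F j in sequentially. \<forall>x\<in>\<Omega>. (\<forall>p>4. 1 * p_lap p \<phi> x \<ge> norm (grad \<phi> x) powr (p - 4) * ((p - 2) * \<mu> - C) \<and> grad \<phi> x \<noteq> 0) \<and> 1 < norm (grad \<phi> x) \<longrightarrow>
           lam x * indicator {y. U j y > 0} x < p_lap (p j) \<phi> x"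
          using p_large[of 4] p_large[of "2 + (C + \<bar>\<Lambda>\<bar>) / \<mu>"]
        proof eventually_elim
          case (elim j)
          show ?case
          proof (intro ballI impI, elim conjE)
            fix x assume x: "x \<in> \<Omega>" and P: "\<forall>p>4. 1 * p_lap p \<phi> x \<ge> norm (grad \<phi> x) powr (p - 4) * ((p - 2) * \<mu> - C) \<and> grad \<phi> x \<noteq> 0"
              and g: "1 < norm (grad \<phi> x)"
            have big: "(p j - 2) * \<mu> - C > \<bar>\<Lambda>\<bar>" using elim(2) \<mu> by (simp add: field_simps)
            have "1 \<le> norm (grad \<phi> x) powr (p j - 4)" using g elim(1) by (intro ge_one_powr_ge_zero) auto
            then have "1 * ((p j - 2) * \<mu> - C) \<le> norm (grad \<phi> x) powr (p j - 4) * ((p j - 2) * \<mu> - C)"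
              using big by (intro mult_right_mono) auto
            also have "\<dots> \<le> p_lap (p j) \<phi> x" using P elim(1) by fastforce
            finally have "(p j - 2) * \<mu> - C \<le> p_lap (p j) \<phi> x" by (simp only: mult_1_left)
            with big have "\<bar>\<Lambda>\<bar> < p_lap (p j) \<phi> x" by (rule less_le_trans)
            moreover have "lam x * indicator {y. U j y > 0} x \<le> \<bar>\<Lambda>\<bar>" using lam_le[OF x] by (auto simp: indicator_def)
            ultimately show "lam x * indicator {y. U j y > 0} x < p_lap (p j) \<phi> x" by linarith
          qed
        qed
      qed
    next
      case False
      \<comment> \<open>Here w is negative near \<open>x0\<close>, hence so is \<open>U j\<close>
        for large j; the source vanishes there and positivity of the p-Laplacian is already a
        contradiction.\<close>
      have ev2: "\<forall>\<^sub>F x in nhds x0. w x < w x0 / 2"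
        by (rule continuous_on_nhds(1)[OF w_cont(2) \<Omega>_open(1) x0]) (use False in simp)
      show False
      proof (rule no_min[OF \<phi> x0 min eventually_conj[OF ev ev2]])
        have "\<forall>\<^sub>F j in sequentially. \<forall>x\<in>\<Omega>. \<bar>U j x - w x\<bar> < - w x0 / 2" by (rule U_close) (use False in simp)
        with p_large[of 4] p_large[of "2 + C / \<mu>"]
        show "\<forall>\<^sub>F j in sequentially. \<forall>x\<in>\<Omega>. (\<forall>p>4. 1 * p_lap p \<phi> x \<ge> norm (grad \<phi> x) powr (p - 4) * ((p - 2) * \<mu> - C) \<and> grad \<phi> x \<noteq> 0) \<and> w x < w x0 / 2 \<longrightarrow>
           lam x * indicator {y. U j y > 0} x < p_lap (p j) \<phi> x"
        proof eventually_elim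
          case (elim j)
          show ?case
          proof (intro ballI impI, elim conjE)
            fix x assume x: "x \<in> \<Omega>" and P: "\<forall>p>4. 1 * p_lap p \<phi> x \<ge> norm (grad \<phi> x) powr (p - 4) * ((p - 2) * \<mu> - C) \<and> grad \<phi> x \<noteq> 0"
              and wx: "w x < w x0 / 2"
            have "(p j - 2) * \<mu> > C" using elim(2) \<mu> by (simp add: field_simps)
            then have "norm (grad \<phi> x) powr (p j - 4) * ((p j - 2) * \<mu> - C) > 0" using P elim(1) by (intro mult_pos_pos) auto
            then have "p_lap (p j) \<phi> x > 0" using P elim(1) by fastforce
            moreover have "\<bar>U j x - w x\<bar> < - w x0 / 2" using elim(3) x by blast
            then have "\<not> U j x > 0" using wx by linarith
            ultimately show "lam x * indicator {y. U j y > 0} x < p_lap (p j) \<phi> x" by simp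
          qed
        qed
      qed
    qed
  qed
qed

lemma viscosity: "viscosity_solution \<Omega> w"
  unfolding viscosity_solution_def using w_cont(2) subsolution supersolution by blast

end


section \<open>The limit problem\<close>

text \<open>A real supremum is known to bound its members only when the family is bounded above; the
  a priori constant \<open>L0\<close> provides this.\<close>

lemma lip_seminorm_lipschitz:
  fixes f :: "'a::metric_space \<Rightarrow> real"
  assumes "L0-lipschitz_on S f"
  shows "(max 1 (lip_seminorm S f))-lipschitz_on S f"
proof (rule lipschitz_onI)
  fix x y assume xy: "x \<in> S" "y \<in> S"
  show "dist (f x) (f y) \<le> max 1 (lip_seminorm S f) * dist x y"
  proof (cases "x = y")
    case False
    let ?A = "{(x, y). x \<in> S \<and> y \<in> S \<and> x \<noteq> y}"
    have "bdd_above ((\<lambda>(x, y). \<bar>f x - f y\<bar> / dist x y) ` ?A)"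
    proof (rule bdd_aboveI2)
      fix q assume "q \<in> ?A"
      then show "(case q of (x, y) \<Rightarrow> \<bar>f x - f y\<bar> / dist x y) \<le> L0"
        using lipschitz_onD[OF assms, of "fst q" "snd q"] by (auto simp: dist_real_def field_simps)
    qed
    then have "(case (x, y) of (x, y) \<Rightarrow> \<bar>f x - f y\<bar> / dist x y) \<le> lip_seminorm S f"
      unfolding lip_seminorm_def by (rule cSUP_upper[rotated]) (use xy False in auto)
    then have "\<bar>f x - f y\<bar> / dist x y \<le> max 1 (lip_seminorm S f)" by simp
    then show ?thesis using False by (simp add: dist_real_def field_simps)
  qed simp
qed auto

text \<open>Two distinct points keep the supremum from ranging over the empty set, where its value
  would be unspecified.\<close>

lemma lip_seminorm_le:
  fixes f :: "'a::metric_space \<Rightarrow> real"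
  assumes "\<And>x y. x \<in> S \<Longrightarrow> y \<in> S \<Longrightarrow> \<bar>f x - f y\<bar> \<le> C * dist x y" and "a \<in> S" "b \<in> S" "a \<noteq> b"
  shows "lip_seminorm S f \<le> C"
  unfolding lip_seminorm_def
proof (rule cSUP_least)
  show "{(x, y). x \<in> S \<and> y \<in> S \<and> x \<noteq> y} \<noteq> {}" using assms by auto
  fix q assume "q \<in> {(x, y). x \<in> S \<and> y \<in> S \<and> x \<noteq> y}"
  then show "(case q of (x, y) \<Rightarrow> \<bar>f x - f y\<bar> / dist x y) \<le> C"
    using assms(1)[of "fst q" "snd q"] by (auto simp: field_simps)
qed

text \<open>The logarithm of the power is of order (log p)/p. Hence the volume, the radius and the
  source bound hidden in \<open>m\<close> and \<open>B\<close>, and the factor p from Young's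
  inequality, disappear in the limit; this is why the final constant depends on N alone.\<close>

lemma energy_factor_limit:
  fixes m B :: real
  assumes "m > 0" "B > 0"
  shows "((\<lambda>p. max 1 ((2 * m + 2 * p * B) powr (1 / (p - 1)))) \<longlongrightarrow> 1) at_top"
proof -
  have "((\<lambda>p. (2 * m + 2 * p * B) powr (1 / (p - 1))) \<longlongrightarrow> 1) at_top" using assms by real_asymp
  then have "((\<lambda>p. max 1 ((2 * m + 2 * p * B) powr (1 / (p - 1)))) \<longlongrightarrow> max 1 1) at_top" by (intro tendsto_intros)
  then show ?thesis by simp
qed

theorem theorem1p2:
  shows "\<exists>C::real. \<forall>(\<Omega> :: 'a::euclidean_space set) lam g u.
    bounded_regular_domain \<Omega> \<and>
    lam \<in> borel_measurable (lebesgue_on \<Omega>) \<and>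
    (\<exists>c M. 0 < c \<and> (\<forall>x\<in>\<Omega>. c \<le> lam x \<and> lam x \<le> M)) \<and>
    (\<exists>L. L-lipschitz_on (frontier \<Omega>) g) \<and>
    (\<forall>p\<ge>2. weak_solution p \<Omega> lam g (u p)) \<longrightarrow>
      (\<exists>w. uniform_subsequential_limit \<Omega> u w) \<and>
      (\<forall>w. uniform_subsequential_limit \<Omega> u w \<longrightarrow>
         viscosity_solution \<Omega> w \<and>
         continuous_on (closure \<Omega>) w \<and> (\<forall>x\<in>frontier \<Omega>. w x = g x) \<and>
         (\<exists>L. L-lipschitz_on (closure \<Omega>) w) \<and>
         lip_seminorm (closure \<Omega>) w \<le> C * max 1 (lip_seminorm (frontier \<Omega>) g))"
proof (intro exI[of _ "1 + 16 * real DIM('a)"] allI impI, elim conjE exE)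
  fix \<Omega> :: "'a set" and lam g u c \<Lambda> L0
  assume reg: "bounded_regular_domain \<Omega>" and lam: "lam \<in> borel_measurable (lebesgue_on \<Omega>)"
    and c: "0 < c" and bd: "\<forall>x\<in>\<Omega>. c \<le> lam x \<and> lam x \<le> \<Lambda>"
    and g: "L0-lipschitz_on (frontier \<Omega>) g" and sol: "\<forall>p\<ge>2. weak_solution p \<Omega> lam g (u p)"
  have \<Omega>: "open \<Omega>" "bounded \<Omega>" "\<Omega> \<noteq> {}" using reg by (auto simp: bounded_regular_domain_def)
  let ?N = "DIM('a)"
  define L where "L = max 1 (lip_seminorm (frontier \<Omega>) g)"
  have L1: "L \<ge> 1" by (simp add: L_def)
  have gL: "L-lipschitz_on (frontier \<Omega>) g" unfolding L_def by (rule lip_seminorm_lipschitz[OF g])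
  \<comment> \<open>Solutions with smaller exponents can be discarded, since all claims concern
    sequences with p tending to infinity.\<close>
  define p0 where "p0 = 2 * real ?N + 3"
  have p02: "p0 \<ge> 2" by (simp add: p0_def)
  have "\<exists>U Du f. weak_sol \<Omega> p lam g U Du f \<Lambda> \<and> (AE x in lebesgue_on \<Omega>. U x = u p x)" if "p \<ge> p0" for p
  proof (rule weak_solution_weak_sol[OF \<Omega> _ lam])
    show "0 < lam x" "lam x \<le> \<Lambda>" if "x \<in> \<Omega>" for x using bd c that by force+
  qed (use sol that p02 in \<open>auto simp: p0_def\<close>)
  then obtain U Du f where ws: "\<And>p. p \<ge> p0 \<Longrightarrow> weak_sol \<Omega> p lam g (U p) (Du p) (f p) \<Lambda>"
    and ae: "\<And>p. p \<ge> p0 \<Longrightarrow> AE x in lebesgue_on \<Omega>. U p x = u p x" by metis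
  obtain R0 where R0: "\<Omega> \<subseteq> ball 0 R0" using bounded_subset_ballD[OF \<Omega>(2), of 0] by auto
  define R where "R = max 1 R0"
  have R: "\<Omega> \<subseteq> ball 0 R" "R \<ge> 1" using R0 by (auto simp: R_def)
  define m where "m = measure lebesgue \<Omega>"
  have m: "m > 0"
  proof -
    have "\<not> negligible \<Omega>" using open_not_negligible[OF \<Omega>(1)] \<Omega> by simp
    then show ?thesis unfolding m_def using \<Omega>
      by (metis lmeasurable_open measure_nonneg negligible_iff_measure order_le_less)
  qed
  have \<Lambda>: "\<Lambda> > 0" using bd c \<Omega>(3) by force
  define B where "B = \<Lambda> * (m * (16 * ?N * R))"
  have B: "B > 0" using \<Lambda> m R by (simp add: B_def)
  define \<kappa> where "\<kappa> = (\<lambda>p. max 1 ((2 * m + 2 * p * B) powr (1 / (p - 1))))"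
  have \<kappa>: "(\<kappa> \<longlongrightarrow> 1) at_top" unfolding \<kappa>_def by (rule energy_factor_limit[OF m B])
  have modulus: "\<bar>U p x - U p y\<bar> \<le> L * norm (x - y) + 8 * ?N * norm (x - y) powr (1 - ?N / p) * (2 * L * \<kappa> p)"
    if "p \<ge> p0" "x \<in> closure \<Omega>" "y \<in> closure \<Omega>" for p x y
    using weak_sol.modulus[OF ws[OF that(1)] L1 gL R that(2,3)] by (simp add: m_def B_def \<kappa>_def)
  have Ucont: "continuous_on (closure \<Omega>) (U p)" and Ubd: "\<And>x. x \<in> frontier \<Omega> \<Longrightarrow> U p x = g x" if "p \<ge> p0" for p
    using ws[OF that] by (auto simp: weak_sol_def)
  have expo: "1/2 \<le> 1 - ?N / p" "1 - ?N / p \<le> 1" if "p \<ge> p0" for p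
    using that by (auto simp: p0_def field_simps)
  show "(\<exists>w. uniform_subsequential_limit \<Omega> u w) \<and>
      (\<forall>w. uniform_subsequential_limit \<Omega> u w \<longrightarrow>
         viscosity_solution \<Omega> w \<and>
         continuous_on (closure \<Omega>) w \<and> (\<forall>x\<in>frontier \<Omega>. w x = g x) \<and>
         (\<exists>L. L-lipschitz_on (closure \<Omega>) w) \<and>
         lip_seminorm (closure \<Omega>) w \<le> (1 + 16 * real ?N) * max 1 (lip_seminorm (frontier \<Omega>) g))"
  proof (intro conjI allI impI)
    have "\<forall>\<^sub>F p in at_top. \<kappa> p < 2" by (rule order_tendstoD(2)[OF \<kappa>]) simp
    then obtain P where P: "\<And>p. p \<ge> P \<Longrightarrow> \<kappa> p < 2" by (auto simp: eventually_at_top_linorder)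
    define p where "p = (\<lambda>j::nat. max P p0 + real j)"
    have p: "p j \<ge> p0" "\<kappa> (p j) < 2" for j using P[of "p j"] by (auto simp: p_def)
    have plim: "filterlim p at_top sequentially" unfolding p_def by real_asymp
    define F where "F = (\<lambda>j. U (p j))"
    \<comment> \<open>32 is 8 * 2 * 2, the last factor bounding \<open>\<kappa>\<close> along the
      chosen sequence.\<close>
    have mod: "\<bar>F j x - F j y\<bar> \<le> L * norm (x - y) + 32 * ?N * L * norm (x - y) powr (1 - ?N / p j)"
      if "x \<in> closure \<Omega>" "y \<in> closure \<Omega>" for j x y
    proof -
      have "8 * ?N * norm (x - y) powr (1 - ?N / p j) * (2 * L * \<kappa> (p j)) \<le> 8 * ?N * norm (x - y) powr (1 - ?N / p j) * (2 * L * 2)"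
        using p(2)[of j] L1 by (intro mult_left_mono) auto
      also have "\<dots> = 32 * ?N * L * norm (x - y) powr (1 - ?N / p j)" by simp
      finally show ?thesis using modulus[OF p(1) that, of j] unfolding F_def by linarith
    qed
    have fne: "frontier \<Omega> \<noteq> {}" using \<Omega> by (simp add: frontier_eq_empty) (metis not_bounded_UNIV)
    then obtain z where z: "z \<in> frontier \<Omega>" by blast
    then have zc: "z \<in> closure \<Omega>" by (simp add: frontier_def)
    have clR: "norm x \<le> R" if "x \<in> closure \<Omega>" for x
    proof -
      have "closure \<Omega> \<subseteq> cball 0 R" by (rule closure_minimal) (use R in force)+
      then show ?thesis using that by auto
    qed
    have "compact (closure \<Omega>)" using \<Omega>(2) by simp
    then obtain w r where "continuous_on (closure \<Omega>) w" and r: "strict_mono (r :: nat \<Rightarrow> nat)"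
      and w: "\<And>e. 0 < e \<Longrightarrow> \<exists>N. \<forall>n x. n \<ge> N \<and> x \<in> closure \<Omega> \<longrightarrow> norm (F (r n) x - w x) < e"
    proof (rule Arzela_Ascoli[of "closure \<Omega>" F])
      \<comment> \<open>Equiboundedness: all \<open>F j\<close> take the value \<open>g z\<close> at
        the boundary point \<open>z\<close>, and the modulus controls the deviation from it over
        distances up to 2 R.\<close>
      show "norm (F j x) \<le> \<bar>g z\<bar> + L * (2 * R) + 32 * ?N * L * (2 * R)" if x: "x \<in> closure \<Omega>" for j x
      proof -
        have n: "norm (x - z) \<le> 2 * R" using norm_triangle_ineq4[of x z] clR[OF x] clR[OF zc] by linarith
        have "norm (x - z) powr (1 - ?N / p j) \<le> (2 * R) powr (1 - ?N / p j)"
          by (rule powr_mono2) (use n expo(1)[OF p(1), of j] in \<open>(linarith | simp)+\<close>)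
        also have "\<dots> \<le> (2 * R) powr 1" using R expo[OF p(1), of j] by (intro powr_mono) auto
        finally have "norm (x - z) powr (1 - ?N / p j) \<le> 2 * R" using R by simp
        then have "32 * ?N * L * norm (x - z) powr (1 - ?N / p j) \<le> 32 * ?N * L * (2 * R)" using L1 by (intro mult_left_mono) auto
        moreover have "L * norm (x - z) \<le> L * (2 * R)" using n L1 by (intro mult_left_mono) auto
        ultimately have "\<bar>F j x - F j z\<bar> \<le> L * (2 * R) + 32 * ?N * L * (2 * R)" using mod[OF x zc, of j] by linarith
        moreover have "F j z = g z" using Ubd[OF p(1) z] by (simp add: F_def)
        ultimately show ?thesis by auto
      qed
      show "\<exists>d>0. \<forall>n y. y \<in> closure \<Omega> \<and> norm (x - y) < d \<longrightarrow> norm (F n x - F n y) < e"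
        if x: "x \<in> closure \<Omega>" and e: "0 < e" for x e
      proof -
        \<comment> \<open>For t = |x - y| < 1 both t and t^(1 - N/p) are at most sqrt t, because the
          exponents are at least 1/2. So A sqrt t is a modulus for all j at once, and
          \<open>d\<close> is the solution of A sqrt d = e, capped at 1.\<close>
        define A where "A = L + 32 * ?N * L"
        have A: "A > 0" using L1 by (simp add: A_def add_pos_nonneg)
        define d where "d = min 1 ((e / A)\<^sup>2)"
        have d: "d > 0" using e A by (simp add: d_def)
        have "norm (F n x - F n y) < e" if y: "y \<in> closure \<Omega>" and n: "norm (x - y) < d" for n y
        proof -
          let ?t = "norm (x - y)"
          have t: "?t < 1" "?t < (e / A)\<^sup>2" using n by (auto simp: d_def)
          have "?t powr (1 - ?N / p n) \<le> ?t powr (1/2)"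
            using t expo[OF p(1), of n] by (intro powr_mono') auto
          then have s1: "?t powr (1 - ?N / p n) \<le> sqrt ?t" by (simp add: powr_half_sqrt)
          have "?t powr 1 \<le> ?t powr (1/2)" using t by (intro powr_mono') auto
          then have s2: "?t \<le> sqrt ?t" by (simp add: powr_half_sqrt)
          have "sqrt ?t < e / A" using real_sqrt_less_mono[OF t(2)] e A by simp
          have "\<bar>F n x - F n y\<bar> \<le> L * sqrt ?t + 32 * ?N * L * sqrt ?t"
            using L1 by (intro order_trans[OF mod[OF x y]] add_mono mult_left_mono s1 s2) auto
          also have "\<dots> = A * sqrt ?t" by (simp add: A_def algebra_simps)
          also have "\<dots> < A * (e / A)" using A \<open>sqrt ?t < e / A\<close> by (intro mult_strict_left_mono)
          also have "\<dots> = e" using A by simp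
          finally show ?thesis by simp
        qed
        then show ?thesis using d by blast
      qed
    qed blast
    have "uniform_subsequential_limit \<Omega> u w"
      unfolding uniform_subsequential_limit_def
    proof (intro exI[of _ "p \<circ> r"] exI[of _ "F \<circ> r"] conjI allI)
      show "(p \<circ> r) j \<ge> 2" for j using p(1)[of "r j"] p02 by simp
      show "filterlim (p \<circ> r) at_top sequentially"
        unfolding o_def by (rule filterlim_compose[OF plim filterlim_subseq[OF r]])
      show "continuous_representative \<Omega> (u ((p \<circ> r) j)) ((F \<circ> r) j)" for j
        using Ucont[OF p(1)] ae[OF p(1)] by (simp add: continuous_representative_def F_def)
      show "uniform_limit (closure \<Omega>) (F \<circ> r) w sequentially"
        unfolding uniform_limit_iff eventually_sequentially dist_norm o_def using w by meson
    qed
    then show "\<exists>w. uniform_subsequential_limit \<Omega> u w" by blast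
  next
    \<comment> \<open>The remaining claims concern every subsequential limit, along a sequence and
      with representatives not chosen here. Hence the shift by \<open>j0\<close> past the threshold
      \<open>p0\<close>, and the identification \<open>same\<close> by continuity on the
      closure.\<close>
    fix w assume "uniform_subsequential_limit \<Omega> u w"
    then obtain q v where q: "filterlim q at_top sequentially"
      and rep: "\<And>j. continuous_representative \<Omega> (u (q j)) (v j)" and vlim: "uniform_limit (closure \<Omega>) v w sequentially"
      unfolding uniform_subsequential_limit_def by blast
    obtain j0 where j0: "\<And>j. j \<ge> j0 \<Longrightarrow> q j \<ge> p0"
      using q unfolding filterlim_at_top eventually_sequentially by blast
    define p where "p = (\<lambda>j. q (j + j0))"
    have p: "p j \<ge> p0" for j using j0[of "j + j0"] by (simp add: p_def)
    have plim: "filterlim p at_top sequentially"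
      unfolding p_def by (rule filterlim_compose[OF q filterlim_add_const_nat_at_top])
    have same: "U (p j) x = v (j + j0) x" if x: "x \<in> closure \<Omega>" for j x
    proof -
      have vc: "continuous_on (closure \<Omega>) (v (j + j0))" and vae: "AE x in lebesgue_on \<Omega>. v (j + j0) x = u (p j) x"
        using rep[of "j + j0"] by (auto simp: continuous_representative_def p_def)
      have "AE x in lebesgue_on \<Omega>. U (p j) x = v (j + j0) x" using vae ae[OF p, of j] by eventually_elim simp
      then have eq: "U (p j) y = v (j + j0) y" if "y \<in> \<Omega>" for y
        using continuous_AE_eq[OF \<Omega>(1) continuous_on_subset[OF Ucont[OF p] closure_subset] continuous_on_subset[OF vc closure_subset]] that by blast
      have "U (p j) x - v (j + j0) x = 0"
        by (rule continuous_constant_on_closure[OF continuous_on_diff[OF Ucont[OF p] vc] _ x]) (simp add: eq)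
      then show ?thesis by simp
    qed
    have "uniform_limit (closure \<Omega>) (\<lambda>j. v (j + j0)) w sequentially"
      using filterlim_compose[OF vlim filterlim_add_const_nat_at_top] by simp
    then have Ulim: "uniform_limit (closure \<Omega>) (\<lambda>j. U (p j)) w sequentially"
      by (rule uniform_limit_cong'[THEN iffD1, rotated 2]) (auto simp: same)
    interpret W: limit_sol \<Omega> p lam g "\<lambda>j. U (p j)" "\<lambda>j. Du (p j)" "\<lambda>j. f (p j)" \<Lambda> c w
      by (rule limit_sol.intro) (use ws[OF p] plim c bd Ulim in auto)
    show "viscosity_solution \<Omega> w" by (rule W.viscosity)
    show "continuous_on (closure \<Omega>) w" by (rule W.w_cont)
    have pt: "(\<lambda>j. U (p j) x) \<longlonglongrightarrow> w x" if "x \<in> closure \<Omega>" for x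
      by (rule tendsto_uniform_limitI[OF Ulim that])
    show "\<forall>x\<in>frontier \<Omega>. w x = g x"
    proof
      fix x assume x: "x \<in> frontier \<Omega>"
      then have "x \<in> closure \<Omega>" by (simp add: frontier_def)
      from pt[OF this] show "w x = g x" using Ubd[OF p x] by (simp add: LIMSEQ_const_iff)
    qed
    have lip: "\<bar>w x - w y\<bar> \<le> ((1 + 16 * ?N) * L) * dist x y" if xy: "x \<in> closure \<Omega>" "y \<in> closure \<Omega>" for x y
    proof -
      let ?d = "norm (x - y)"
      have "(\<lambda>j. ?N / p j) \<longlonglongrightarrow> 0"
        by (rule tendsto_divide_0[OF tendsto_const filterlim_at_top_imp_at_infinity[OF plim]])
      then have e1: "(\<lambda>j. 1 - ?N / p j) \<longlonglongrightarrow> 1 - 0" by (intro tendsto_intros)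
      have t1: "(\<lambda>j. ?d powr (1 - ?N / p j)) \<longlonglongrightarrow> ?d"
      proof (cases "?d = 0")
        case False
        from tendsto_powr[OF tendsto_const e1 False] show ?thesis by simp
      qed simp
      have t2: "(\<lambda>j. \<kappa> (p j)) \<longlonglongrightarrow> 1" by (rule filterlim_compose[OF \<kappa> plim])
      \<comment> \<open>In the limit the exponent 1 - N/p and the factor \<open>\<kappa>\<close>
        both become 1, so the modulus of continuity turns into a Lipschitz bound free of quantities
        depending on \<Omega> or \<open>lam\<close>.\<close>
      have "\<bar>w x - w y\<bar> \<le> L * ?d + 8 * ?N * ?d * (2 * L * 1)"
      proof (rule LIMSEQ_le)
        show "(\<lambda>j. \<bar>U (p j) x - U (p j) y\<bar>) \<longlonglongrightarrow> \<bar>w x - w y\<bar>" by (intro tendsto_intros pt xy)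
        show "(\<lambda>j. L * ?d + 8 * ?N * ?d powr (1 - ?N / p j) * (2 * L * \<kappa> (p j))) \<longlonglongrightarrow> L * ?d + 8 * ?N * ?d * (2 * L * 1)"
          by (intro tendsto_intros t1 t2)
        show "\<exists>N. \<forall>j\<ge>N. \<bar>U (p j) x - U (p j) y\<bar> \<le> L * ?d + 8 * ?N * ?d powr (1 - ?N / p j) * (2 * L * \<kappa> (p j))"
          using modulus[OF p xy] by blast
      qed
      then show ?thesis by (simp add: dist_norm algebra_simps)
    qed
    show "\<exists>L. L-lipschitz_on (closure \<Omega>) w"
    proof
      show "((1 + 16 * ?N) * L)-lipschitz_on (closure \<Omega>) w"
        by (rule lipschitz_onI) (use lip L1 in \<open>auto simp: dist_real_def\<close>)
    qed
    \<comment> \<open>Two distinct points of the closure, as \<open>lip_seminorm_le\<close>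
      requires.\<close>
    obtain a where a: "a \<in> \<Omega>" using \<Omega> by blast
    then obtain s where s: "s > 0" "ball a s \<subseteq> \<Omega>" using \<Omega>(1) openE by blast
    obtain b :: 'a where b: "b \<in> Basis" by (meson SOME_Basis)
    have "a + (s/2) *\<^sub>R b \<in> ball a s" "a \<noteq> a + (s/2) *\<^sub>R b" using b s by (auto simp: dist_norm)
    then have ab: "a \<in> closure \<Omega>" "a + (s/2) *\<^sub>R b \<in> closure \<Omega>" "a \<noteq> a + (s/2) *\<^sub>R b"
      using a s closure_subset by blast+
    show "lip_seminorm (closure \<Omega>) w \<le> (1 + 16 * real ?N) * max 1 (lip_seminorm (frontier \<Omega>) g)"
      using lip_seminorm_le[OF lip ab] by (simp add: L_def)
  qed
qed

end
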